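(* Let $(M,g)$ be a closed Riemannian manifold, let $\pi:M\to B$ be a Riemannian submersion with domain $M$, and let $X$ be a smooth vector field on $M$ such that the map $p\mapsto \pi_*(X_p)$ is constant along the fibers of $\pi$. If $Y$ and $Z$ are horizontal vector fields and $U$ and $V$ are vertical vector fields on $M$, then $$R_X^V(U,U)=\hat R_{\mathcal V X}^V(U,U)+g(T_UV,T_UV)-g(T_UU,T_VV)-g(T_VV,\mathcal H X)\,g(U,U),$$ $$R_X^Z(Y,Y)=\check R_{\pi_*X}^{\pi_*Z}(\pi_*Y,\pi_*Y)-3g(A_YZ,A_YZ),$$ and the same two identities hold with $R_X$, $\hat R_{\mathcal V X}$ and $\check R_{\pi_*X}$ replaced by the strongly weighted directional curvature operators $\overline R_X$, $\overline{\hat R}_{\mathcal V X}$ and $\overline{\check R}_{\pi_*X}$ on $M$, the fibers, and the base, respectively. In particular, if $(Y,Z)$ is an orthonormal pair of horizontal vector fields, then $$\sec_{\pi_*X}^{\pi_*Y}(\pi_*Z)=\sec_X^Y(Z)+\tfrac34\left|[Y,Z]^{\mathcal V}\right|^2,$$ and likewise with $\sec$ replaced by $\overline{\sec}$ on both sides, i.e. $\overline{\sec}_{\pi_*X}^{\pi_*Y}(\pi_*Z)=\overline{\sec}_X^Y(Z)+\tfrac34\left|[Y,Z]^{\mathcal V}\right|^2$.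
   Context: For a Riemannian manifold $(M,g)$ with Levi-Civita connection $\nabla$ and a vector $V$, the directional curvature operator is $R^V(U)=R(U,V)V=\nabla_U\nabla_VV-\nabla_V\nabla_UV-\nabla_{[U,V]}V$. Given a smooth vector field $X$, the weighted and strongly weighted directional curvature operators are the symmetric $(1,1)$-tensors $$R_X^V=R^V+\tfrac12(L_Xg)(V,V)\,\mathrm{id},\qquad \overline R_X^V=R_X^V+g(X,V)^2\,\mathrm{id},$$ and $R_X^V(U,W)$ denotes $g(R_X^V(U),W)$ (similarly for $\overline R$). For an orthonormal pair $(U,V)$, $\sec_X^V(U)=g(R_X^V(U),U)=\sec(U,V)+\tfrac12(L_Xg)(V,V)$ and $\overline{\sec}_X^V(U)=g(\overline R_X^V(U),U)=\sec_X^V(U)+g(X,V)^2$. For the Riemannian submersion $\pi$, $\mathcal V$ and $\mathcal H$ denote projections onto the vertical and horizontal spaces; $W^{\mathcal V}$ denotes the vertical part of $W$. $R$, $\hat R$, $\check R$ denote the curvature tensors of $M$, of the fibers (with the induced metrics), and of the base $B$; $\hat R_{\mathcal VX}$ and $\check R_{\pi_*X}$ are the corresponding weighted operators on the fibers (with vector field $\mathcal VX$) and on the base (with the vector field $\pi_*X$, which is well defined by hypothesis). The O'Neill tensors are $$T_{E}F=\mathcal H\nabla_{\mathcal VE}\mathcal VF+\mathcal V\nabla_{\mathcal VE}\mathcal HF,\qquad A_EF=\mathcal H\nabla_{\mathcal HE}\mathcal VF+\mathcal V\nabla_{\mathcal HE}\mathcal HF.$$ All identities are pointwise. *)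

theory Defs
  imports "HOL-Analysis.Analysis"
begin

section \<open>Smooth maps between subsets of Euclidean spaces\<close>

primrec Ck_on :: "nat \<Rightarrow> ('m::euclidean_space \<Rightarrow> 'n::euclidean_space) \<Rightarrow> 'm set \<Rightarrow> bool" where
  "Ck_on 0 f S \<longleftrightarrow> continuous_on S f"
| "Ck_on (Suc k) f S \<longleftrightarrow>
     (\<forall>x\<in>S. f differentiable (at x)) \<and> (\<forall>v. Ck_on k (\<lambda>x. frechet_derivative f (at x) v) S)"

text \<open>Smoothness on an arbitrary set means local extendability to a smooth map on an open set. It is
  used below only for sets that are open in a linear subspace \<open>S\<close> of \<open>'m\<close>, where it is
  \<open>C\<^sup>\<infinity>\<close>-smoothness with respect to the directions in \<open>S\<close>.\<close>

definition smooth_on :: "'m::euclidean_space set \<Rightarrow> ('m \<Rightarrow> 'n::euclidean_space) \<Rightarrow> bool" where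
  "smooth_on W f \<longleftrightarrow>
     (\<forall>x\<in>W. \<exists>G F. open G \<and> x \<in> G \<and> (\<forall>k. Ck_on k F G) \<and> (\<forall>y\<in>G \<inter> W. F y = f y))"


section \<open>Spaces with smooth functions and a metric; smooth manifolds\<close>

text \<open>Tangent vectors at \<open>p\<close> are derivations at \<open>p\<close> of the algebra of smooth functions,
  extended by \<open>0\<close> to non-smooth functions so that they are equal iff they agree on smooth functions.
  All functions, vector fields, metrics etc. are total, and their values at points outside the space
  are irrelevant.\<close>

type_synonym 'a tvec = "('a \<Rightarrow> real) \<Rightarrow> real"
type_synonym 'a vfield = "'a \<Rightarrow> 'a tvec"

text \<open>The common data of \<open>M\<close>, \<open>B\<close> and the fibres: a topology, the algebra of smooth
  functions, and a metric.\<close>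

record 'a rspace =
  rtop :: "'a topology"
  smf :: "('a \<Rightarrow> real) set"
  met :: "'a \<Rightarrow> 'a tvec \<Rightarrow> 'a tvec \<Rightarrow> real"

abbreviation pts :: "('a, 'z) rspace_scheme \<Rightarrow> 'a set" where
  "pts N \<equiv> topspace (rtop N)"

text \<open>Manifolds are modelled on a linear subspace of a Euclidean space rather than on a whole type,
  because \<open>DIM('m)\<close> is positive and the base of a submersion may be \<open>0\<close>-dimensional.
  A chart is a pair of a domain and a map defined on it.\<close>

record ('a, 'm) rmanifold = "'a rspace" +
  model :: "'m set"
  atlas :: "('a set \<times> ('a \<Rightarrow> 'm)) set"

definition second_countable_top :: "'a topology \<Rightarrow> bool" where
  "second_countable_top X \<longleftrightarrow>
     (\<exists>\<B>. countable \<B> \<and> (\<forall>V\<in>\<B>. openin X V) \<and>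
          (\<forall>U x. openin X U \<and> x \<in> U \<longrightarrow> (\<exists>V\<in>\<B>. x \<in> V \<and> V \<subseteq> U)))"

definition smooth_manifold :: "('a, 'm::euclidean_space) rmanifold \<Rightarrow> bool" where
  "smooth_manifold M \<longleftrightarrow>
     Hausdorff_space (rtop M) \<and> second_countable_top (rtop M) \<and> subspace (model M) \<and>
     (\<forall>(U, \<phi>)\<in>atlas M.
        openin (rtop M) U \<and> openin (top_of_set (model M)) (\<phi> ` U) \<and>
        homeomorphic_map (subtopology (rtop M) U) (top_of_set (\<phi> ` U)) \<phi>) \<and>
     \<Union>(fst ` atlas M) = pts M \<and>
     (\<forall>(U, \<phi>)\<in>atlas M. \<forall>(V, \<psi>)\<in>atlas M. smooth_on (\<phi> ` (U \<inter> V)) (\<psi> \<circ> inv_into U \<phi>)) \<and>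
     smf M = {f. \<forall>(U, \<phi>)\<in>atlas M. smooth_on (\<phi> ` U) (f \<circ> inv_into U \<phi>)}"

definition smooth_map ::
    "('a, 'm::euclidean_space) rmanifold \<Rightarrow> ('b, 'n::euclidean_space) rmanifold \<Rightarrow> ('a \<Rightarrow> 'b) \<Rightarrow> bool" where
  "smooth_map M B \<pi> \<longleftrightarrow>
     continuous_map (rtop M) (rtop B) \<pi> \<and>
     (\<forall>(U, \<phi>)\<in>atlas M. \<forall>(V, \<psi>)\<in>atlas B.
        smooth_on (\<phi> ` {p \<in> U. \<pi> p \<in> V}) (\<psi> \<circ> \<pi> \<circ> inv_into U \<phi>))"


section \<open>Tangent vectors, vector fields, Riemannian metrics\<close>

definition tangent_space :: "('a, 'z) rspace_scheme \<Rightarrow> 'a \<Rightarrow> 'a tvec set" where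
  "tangent_space N p =
     {v. (\<forall>f\<in>smf N. \<forall>h\<in>smf N. v (\<lambda>x. f x + h x) = v f + v h) \<and>
         (\<forall>f\<in>smf N. \<forall>c. v (\<lambda>x. c * f x) = c * v f) \<and>
         (\<forall>f\<in>smf N. \<forall>h\<in>smf N. v (\<lambda>x. f x * h x) = f p * v h + h p * v f) \<and>
         (\<forall>f. f \<notin> smf N \<longrightarrow> v f = 0)}"

definition vector_field :: "('a, 'z) rspace_scheme \<Rightarrow> 'a vfield \<Rightarrow> bool" where
  "vector_field N V \<longleftrightarrow>
     (\<forall>p\<in>pts N. V p \<in> tangent_space N p) \<and> (\<forall>f\<in>smf N. (\<lambda>p. V p f) \<in> smf N)"

definition lie_bracket :: "'a vfield \<Rightarrow> 'a vfield \<Rightarrow> 'a vfield" where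
  "lie_bracket V W = (\<lambda>p f. V p (\<lambda>q. W q f) - W p (\<lambda>q. V q f))"

definition pushforward :: "('b, 'z) rspace_scheme \<Rightarrow> ('a \<Rightarrow> 'b) \<Rightarrow> 'a tvec \<Rightarrow> 'b tvec" where
  "pushforward N \<pi> v = (\<lambda>f. if f \<in> smf N then v (f \<circ> \<pi>) else 0)"

definition riemannian_metric :: "('a, 'z) rspace_scheme \<Rightarrow> bool" where
  "riemannian_metric N \<longleftrightarrow>
     (\<forall>p\<in>pts N. \<forall>u\<in>tangent_space N p. \<forall>v\<in>tangent_space N p. \<forall>w\<in>tangent_space N p. \<forall>a b.
        met N p (\<lambda>f. a * u f + b * v f) w = a * met N p u w + b * met N p v w \<and>
        met N p u v = met N p v u) \<and>
     (\<forall>p\<in>pts N. \<forall>v\<in>tangent_space N p. v \<noteq> (\<lambda>f. 0) \<longrightarrow> met N p v v > 0) \<and>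
     (\<forall>V W. vector_field N V \<and> vector_field N W \<longrightarrow> (\<lambda>p. met N p (V p) (W p)) \<in> smf N)"

definition riemannian_manifold :: "('a, 'm::euclidean_space) rmanifold \<Rightarrow> bool" where
  "riemannian_manifold M \<longleftrightarrow> smooth_manifold M \<and> riemannian_metric M"

definition closed_riemannian_manifold :: "('a, 'm::euclidean_space) rmanifold \<Rightarrow> bool" where
  "closed_riemannian_manifold M \<longleftrightarrow> riemannian_manifold M \<and> compact_space (rtop M)"


section \<open>Levi-Civita connection and curvature\<close>

definition levi_civita ::
    "('a, 'z) rspace_scheme \<Rightarrow> ('a vfield \<Rightarrow> 'a vfield \<Rightarrow> 'a vfield) \<Rightarrow> bool" where
  "levi_civita N D \<longleftrightarrow>
     (\<forall>U V. vector_field N U \<and> vector_field N V \<longrightarrow> vector_field N (D U V)) \<and>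
     (\<forall>U V W. vector_field N U \<and> vector_field N V \<and> vector_field N W \<longrightarrow>
        (\<forall>p\<in>pts N.
          (\<forall>a\<in>smf N. \<forall>b\<in>smf N. \<forall>f.
             D (\<lambda>q h. a q * U q h + b q * V q h) W p f = a p * D U W p f + b p * D V W p f) \<and>
          (\<forall>f. D U (\<lambda>q h. V q h + W q h) p f = D U V p f + D U W p f) \<and>
          (\<forall>a\<in>smf N. \<forall>f. D U (\<lambda>q h. a q * V q h) p f = U p a * V p f + a p * D U V p f) \<and>
          (\<forall>f. D U V p f - D V U p f = lie_bracket U V p f) \<and>
          U p (\<lambda>q. met N q (V q) (W q)) = met N p (D U V p) (W p) + met N p (V p) (D U W p)))"

definition curvature_field ::
    "('a vfield \<Rightarrow> 'a vfield \<Rightarrow> 'a vfield) \<Rightarrow> 'a vfield \<Rightarrow> 'a vfield \<Rightarrow> 'a vfield \<Rightarrow> 'a vfield" where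
  "curvature_field D U V W =
     (\<lambda>p f. D U (D V W) p f - D V (D U W) p f - D (lie_bracket U V) W p f)"

text \<open>The curvature \<open>R(u,v)w\<close> and \<open>(L\<^sub>X g)(v,w)\<close> are tensorial, so at vectors of one
  tangent space they are evaluated on arbitrary smooth extensions.\<close>

definition extension :: "('a, 'z) rspace_scheme \<Rightarrow> 'a \<Rightarrow> 'a tvec \<Rightarrow> 'a vfield" where
  "extension N p v = (SOME V. vector_field N V \<and> V p = v)"

definition curvature ::
    "('a, 'z) rspace_scheme \<Rightarrow> ('a vfield \<Rightarrow> 'a vfield \<Rightarrow> 'a vfield) \<Rightarrow>
     'a \<Rightarrow> 'a tvec \<Rightarrow> 'a tvec \<Rightarrow> 'a tvec \<Rightarrow> 'a tvec" where
  "curvature N D p u v w = curvature_field D (extension N p u) (extension N p v) (extension N p w) p"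

definition lie_metric ::
    "('a, 'z) rspace_scheme \<Rightarrow> 'a vfield \<Rightarrow> 'a \<Rightarrow> 'a tvec \<Rightarrow> 'a tvec \<Rightarrow> real" where
  "lie_metric N X p v w =
     (let V = extension N p v; W = extension N p w in
        X p (\<lambda>q. met N q (V q) (W q))
        - met N p (lie_bracket X V p) w - met N p v (lie_bracket X W p))"

definition dir_curv ::
    "('a, 'z) rspace_scheme \<Rightarrow> ('a vfield \<Rightarrow> 'a vfield \<Rightarrow> 'a vfield) \<Rightarrow>
     'a \<Rightarrow> 'a tvec \<Rightarrow> 'a tvec \<Rightarrow> 'a tvec" where
  "dir_curv N D p v u = curvature N D p u v v"

definition wdir_curv ::
    "('a, 'z) rspace_scheme \<Rightarrow> ('a vfield \<Rightarrow> 'a vfield \<Rightarrow> 'a vfield) \<Rightarrow> 'a vfield \<Rightarrow>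
     'a \<Rightarrow> 'a tvec \<Rightarrow> 'a tvec \<Rightarrow> 'a tvec" where
  "wdir_curv N D X p v u = (\<lambda>f. dir_curv N D p v u f + 1/2 * lie_metric N X p v v * u f)"

definition swdir_curv ::
    "('a, 'z) rspace_scheme \<Rightarrow> ('a vfield \<Rightarrow> 'a vfield \<Rightarrow> 'a vfield) \<Rightarrow> 'a vfield \<Rightarrow>
     'a \<Rightarrow> 'a tvec \<Rightarrow> 'a tvec \<Rightarrow> 'a tvec" where
  "swdir_curv N D X p v u = (\<lambda>f. wdir_curv N D X p v u f + (met N p (X p) v)\<^sup>2 * u f)"

text \<open>\<open>wcurv_form N D X p v u w\<close> is \<open>R\<^sub>X\<^sup>v(u,w)\<close> at \<open>p\<close>, and
  \<open>swcurv_form\<close> is its strongly weighted version.\<close>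

definition wcurv_form ::
    "('a, 'z) rspace_scheme \<Rightarrow> ('a vfield \<Rightarrow> 'a vfield \<Rightarrow> 'a vfield) \<Rightarrow> 'a vfield \<Rightarrow>
     'a \<Rightarrow> 'a tvec \<Rightarrow> 'a tvec \<Rightarrow> 'a tvec \<Rightarrow> real" where
  "wcurv_form N D X p v u w = met N p (wdir_curv N D X p v u) w"

definition swcurv_form ::
    "('a, 'z) rspace_scheme \<Rightarrow> ('a vfield \<Rightarrow> 'a vfield \<Rightarrow> 'a vfield) \<Rightarrow> 'a vfield \<Rightarrow>
     'a \<Rightarrow> 'a tvec \<Rightarrow> 'a tvec \<Rightarrow> 'a tvec \<Rightarrow> real" where
  "swcurv_form N D X p v u w = met N p (swdir_curv N D X p v u) w"

text \<open>\<open>wsec N D X p v u\<close> is \<open>sec\<^sub>X\<^sup>v(u)\<close>, for an orthonormal pair \<open>(u,v)\<close>.\<close>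

definition wsec ::
    "('a, 'z) rspace_scheme \<Rightarrow> ('a vfield \<Rightarrow> 'a vfield \<Rightarrow> 'a vfield) \<Rightarrow> 'a vfield \<Rightarrow>
     'a \<Rightarrow> 'a tvec \<Rightarrow> 'a tvec \<Rightarrow> real" where
  "wsec N D X p v u = met N p (wdir_curv N D X p v u) u"

definition swsec ::
    "('a, 'z) rspace_scheme \<Rightarrow> ('a vfield \<Rightarrow> 'a vfield \<Rightarrow> 'a vfield) \<Rightarrow> 'a vfield \<Rightarrow>
     'a \<Rightarrow> 'a tvec \<Rightarrow> 'a tvec \<Rightarrow> real" where
  "swsec N D X p v u = met N p (swdir_curv N D X p v u) u"


section \<open>Riemannian submersions\<close>

definition vertical_space ::
    "('a, 'y) rspace_scheme \<Rightarrow> ('b, 'z) rspace_scheme \<Rightarrow> ('a \<Rightarrow> 'b) \<Rightarrow> 'a \<Rightarrow> 'a tvec set" where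
  "vertical_space M B \<pi> p = {v \<in> tangent_space M p. pushforward B \<pi> v = (\<lambda>f. 0)}"

definition horizontal_space ::
    "('a, 'y) rspace_scheme \<Rightarrow> ('b, 'z) rspace_scheme \<Rightarrow> ('a \<Rightarrow> 'b) \<Rightarrow> 'a \<Rightarrow> 'a tvec set" where
  "horizontal_space M B \<pi> p =
     {w \<in> tangent_space M p. \<forall>v\<in>vertical_space M B \<pi> p. met M p v w = 0}"

definition riemannian_submersion ::
    "('a, 'm::euclidean_space) rmanifold \<Rightarrow> ('b, 'n::euclidean_space) rmanifold \<Rightarrow> ('a \<Rightarrow> 'b) \<Rightarrow> bool" where
  "riemannian_submersion M B \<pi> \<longleftrightarrow>
     smooth_map M B \<pi> \<and> \<pi> ` pts M = pts B \<and>
     (\<forall>p\<in>pts M. pushforward B \<pi> ` tangent_space M p = tangent_space B (\<pi> p) \<and>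
        (\<forall>v\<in>horizontal_space M B \<pi> p. \<forall>w\<in>horizontal_space M B \<pi> p.
           met B (\<pi> p) (pushforward B \<pi> v) (pushforward B \<pi> w) = met M p v w))"

definition vertical_part ::
    "('a, 'y) rspace_scheme \<Rightarrow> ('b, 'z) rspace_scheme \<Rightarrow> ('a \<Rightarrow> 'b) \<Rightarrow> 'a \<Rightarrow> 'a tvec \<Rightarrow> 'a tvec" where
  "vertical_part M B \<pi> p w =
     (THE v. v \<in> vertical_space M B \<pi> p \<and> (\<lambda>f. w f - v f) \<in> horizontal_space M B \<pi> p)"

definition horizontal_part ::
    "('a, 'y) rspace_scheme \<Rightarrow> ('b, 'z) rspace_scheme \<Rightarrow> ('a \<Rightarrow> 'b) \<Rightarrow> 'a \<Rightarrow> 'a tvec \<Rightarrow> 'a tvec" where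
  "horizontal_part M B \<pi> p w =
     (THE h. h \<in> horizontal_space M B \<pi> p \<and> (\<lambda>f. w f - h f) \<in> vertical_space M B \<pi> p)"

abbreviation vertical_proj ::
    "('a, 'y) rspace_scheme \<Rightarrow> ('b, 'z) rspace_scheme \<Rightarrow> ('a \<Rightarrow> 'b) \<Rightarrow> 'a vfield \<Rightarrow> 'a vfield" where
  "vertical_proj M B \<pi> E \<equiv> (\<lambda>p. vertical_part M B \<pi> p (E p))"

abbreviation horizontal_proj ::
    "('a, 'y) rspace_scheme \<Rightarrow> ('b, 'z) rspace_scheme \<Rightarrow> ('a \<Rightarrow> 'b) \<Rightarrow> 'a vfield \<Rightarrow> 'a vfield" where
  "horizontal_proj M B \<pi> E \<equiv> (\<lambda>p. horizontal_part M B \<pi> p (E p))"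

definition vertical_field ::
    "('a, 'y) rspace_scheme \<Rightarrow> ('b, 'z) rspace_scheme \<Rightarrow> ('a \<Rightarrow> 'b) \<Rightarrow> 'a vfield \<Rightarrow> bool" where
  "vertical_field M B \<pi> V \<longleftrightarrow> vector_field M V \<and> (\<forall>p\<in>pts M. V p \<in> vertical_space M B \<pi> p)"

definition horizontal_field ::
    "('a, 'y) rspace_scheme \<Rightarrow> ('b, 'z) rspace_scheme \<Rightarrow> ('a \<Rightarrow> 'b) \<Rightarrow> 'a vfield \<Rightarrow> bool" where
  "horizontal_field M B \<pi> V \<longleftrightarrow> vector_field M V \<and> (\<forall>p\<in>pts M. V p \<in> horizontal_space M B \<pi> p)"

definition oneill_T ::
    "('a, 'y) rspace_scheme \<Rightarrow> ('b, 'z) rspace_scheme \<Rightarrow> ('a \<Rightarrow> 'b) \<Rightarrow>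
     ('a vfield \<Rightarrow> 'a vfield \<Rightarrow> 'a vfield) \<Rightarrow> 'a vfield \<Rightarrow> 'a vfield \<Rightarrow> 'a vfield" where
  "oneill_T M B \<pi> D E F = (\<lambda>p f.
     horizontal_proj M B \<pi> (D (vertical_proj M B \<pi> E) (vertical_proj M B \<pi> F)) p f +
     vertical_proj M B \<pi> (D (vertical_proj M B \<pi> E) (horizontal_proj M B \<pi> F)) p f)"

definition oneill_A ::
    "('a, 'y) rspace_scheme \<Rightarrow> ('b, 'z) rspace_scheme \<Rightarrow> ('a \<Rightarrow> 'b) \<Rightarrow>
     ('a vfield \<Rightarrow> 'a vfield \<Rightarrow> 'a vfield) \<Rightarrow> 'a vfield \<Rightarrow> 'a vfield \<Rightarrow> 'a vfield" where
  "oneill_A M B \<pi> D E F = (\<lambda>p f.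
     horizontal_proj M B \<pi> (D (horizontal_proj M B \<pi> E) (vertical_proj M B \<pi> F)) p f +
     vertical_proj M B \<pi> (D (horizontal_proj M B \<pi> E) (horizontal_proj M B \<pi> F)) p f)"

text \<open>The fibre over \<open>b\<close> with its structure of embedded submanifold (smooth functions are
  those that locally are restrictions of smooth functions on \<open>M\<close>) and the metric induced along
  the inclusion.\<close>

definition fibre :: "('a, 'z) rspace_scheme \<Rightarrow> ('a \<Rightarrow> 'b) \<Rightarrow> 'b \<Rightarrow> 'a rspace" where
  "fibre M \<pi> b = \<lparr>
     rtop = subtopology (rtop M) {p. \<pi> p = b},
     smf = {f. \<forall>p\<in>{p\<in>pts M. \<pi> p = b}. \<exists>G h. openin (rtop M) G \<and> p \<in> G \<and> h \<in> smf M \<and>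
                 (\<forall>q\<in>G. \<pi> q = b \<longrightarrow> f q = h q)},
     met = (\<lambda>p v w. met M p (pushforward M (\<lambda>x. x) v) (pushforward M (\<lambda>x. x) w)) \<rparr>"

text \<open>A vertical vector at \<open>p\<close>, regarded as a tangent vector of the fibre through \<open>p\<close>: its
  preimage under the differential of the inclusion of the fibre.\<close>

definition to_fibre :: "('a, 'z) rspace_scheme \<Rightarrow> ('a \<Rightarrow> 'b) \<Rightarrow> 'a \<Rightarrow> 'a tvec \<Rightarrow> 'a tvec" where
  "to_fibre M \<pi> p v =
     (THE w. w \<in> tangent_space (fibre M \<pi> (\<pi> p)) p \<and> pushforward M (\<lambda>x. x) w = v)"

abbreviation fibre_field :: "('a, 'z) rspace_scheme \<Rightarrow> ('a \<Rightarrow> 'b) \<Rightarrow> 'a vfield \<Rightarrow> 'a vfield" where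
  "fibre_field M \<pi> V \<equiv> (\<lambda>p. to_fibre M \<pi> p (V p))"

definition projectable ::
    "('a, 'y) rspace_scheme \<Rightarrow> ('b, 'z) rspace_scheme \<Rightarrow> ('a \<Rightarrow> 'b) \<Rightarrow> 'a vfield \<Rightarrow> bool" where
  "projectable M B \<pi> X \<longleftrightarrow>
     (\<forall>p\<in>pts M. \<forall>q\<in>pts M. \<pi> p = \<pi> q \<longrightarrow> pushforward B \<pi> (X p) = pushforward B \<pi> (X q))"

text \<open>The field \<open>\<pi>\<^sub>*X\<close> on the base, meaningful for surjective \<open>\<pi>\<close> and projectable \<open>X\<close>.\<close>

definition projected_field ::
    "('a, 'y) rspace_scheme \<Rightarrow> ('b, 'z) rspace_scheme \<Rightarrow> ('a \<Rightarrow> 'b) \<Rightarrow> 'a vfield \<Rightarrow> 'b vfield" where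
  "projected_field M B \<pi> X = (\<lambda>b. pushforward B \<pi> (X (SOME p. p \<in> pts M \<and> \<pi> p = b)))"

end

(*
  Near a point every tangent vector is v = sum v(x_i) E_i for smooth functions x_i and vector fields
  E_i (on a manifold by Hadamard's lemma), so whatever is linear over the smooth functions is
  pointwise; in particular curvature may be computed on any extensions of the given vectors.  Vertical
  vectors extend to vertical fields, which restrict to the fibres, and horizontal vectors extend to
  horizontal lifts of fields on the base.  By the Koszul formula the Levi-Civita connection of a fibre
  is the vertical part of D on vertical fields, and that of the base is the projection of D on lifts.
  The curvature identities are then the Gauss equation of the fibres and O'Neill's equation, and the
  weights follow from (1/2) (L_X g)(V,V) = g(D_V X, V).

  Two facts need analysis: vertical vectors are tangent to the fibre (an open mapping argument), and
  a function on the base is smooth if its pullback is (which makes the projected field smooth).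
*)
theory Submission
  imports Defs
begin

section \<open>Calculus of smooth functions on Euclidean spaces\<close>

text \<open>The fibres carry no atlas, only an algebra of functions and a metric. Therefore
  everything up to curvature is derived from a few axioms (locality, bump functions, spanning
  fields) that \<open>M\<close>, \<open>B\<close> and every fibre satisfy; charts serve below that
  level. Fields are total functions with arbitrary values off the space, hence the repeated passage
  from equality on the space to equality of derivatives. The splitting into vertical and horizontal
  vectors comes from the adjoint of d\<pi>: a smooth Riesz representation makes it produce fields,
  and the isometry condition makes it a right inverse of d\<pi>. Horizontal projection and
  horizontal lift are thus one construction. Constants: [Y,Z] has vertical part 2 A_Y Z, because A
  is skew. In O'Neill's equation D_Z D_Y Z contributes |A_Y Z|^2 and D_[Y,Z] Z contributes 2 |A_Y
  Z|^2, which makes 3; dividing by the 4 in |2 A_Y Z|^2 gives 3/4.\<close>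

definition Cinf_on :: "('m::euclidean_space \<Rightarrow> 'n::euclidean_space) \<Rightarrow> 'm set \<Rightarrow> bool" where
  "Cinf_on f S \<longleftrightarrow> (\<forall>k. Ck_on k f S)"

lemma frechet_derivative_open_cong:
  assumes "open S" "x \<in> S" "\<And>y. y \<in> S \<Longrightarrow> f y = g y"
  shows "frechet_derivative f (at x) = frechet_derivative g (at x)"
    and "f differentiable (at x) \<longleftrightarrow> g differentiable (at x)"
proof -
  have *: "(f has_derivative F) (at x) \<longleftrightarrow> (g has_derivative F) (at x)" for F
    using has_derivative_transform_within_open[OF _ assms(1,2)] assms(3) by (metis (no_types))
  then show "frechet_derivative f (at x) = frechet_derivative g (at x)"
    and "f differentiable (at x) \<longleftrightarrow> g differentiable (at x)"
    by (simp_all add: frechet_derivative_def differentiable_def)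
qed

lemma Ck_on_cong:
  assumes "open S" "\<And>y. y \<in> S \<Longrightarrow> f y = g y"
  shows "Ck_on k f S \<longleftrightarrow> Ck_on k g S"
  using assms
proof (induction k arbitrary: f g)
  case 0
  then show ?case by (simp cong: continuous_on_cong)
next
  case (Suc k)
  have "Ck_on k (\<lambda>x. frechet_derivative f (at x) v) S \<longleftrightarrow> Ck_on k (\<lambda>x. frechet_derivative g (at x) v) S" for v
    by (rule Suc.IH) (use frechet_derivative_open_cong(1)[OF Suc.prems(1) _ Suc.prems(2)] Suc.prems(1) in simp_all)
  then show ?case
    using frechet_derivative_open_cong(2)[OF Suc.prems(1) _ Suc.prems(2)] by auto
qed

lemma Ck_on_differentiable: "Ck_on (Suc k) f S \<Longrightarrow> x \<in> S \<Longrightarrow> f differentiable (at x)"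
  by simp

lemma Ck_on_derivative: "Ck_on (Suc k) f S \<Longrightarrow> Ck_on k (\<lambda>x. frechet_derivative f (at x) v) S"
  by simp

lemma Ck_on_continuous: "Ck_on k f S \<Longrightarrow> continuous_on S f"
  by (cases k)
    (auto intro!: continuous_at_imp_continuous_on simp: differentiable_imp_continuous_within)

lemma Ck_on_mono_Suc: "Ck_on (Suc k) f S \<Longrightarrow> Ck_on k f S"
proof (induction k arbitrary: f)
  case 0
  then show ?case using Ck_on_continuous by fastforce
next
  case (Suc k)
  then show ?case by (metis Ck_on.simps(2))
qed

lemma Ck_on_subset: "Ck_on k f S \<Longrightarrow> T \<subseteq> S \<Longrightarrow> Ck_on k f T"
  by (induction k arbitrary: f) (auto intro: continuous_on_subset)

lemma Ck_on_local:
  assumes "\<And>x. x \<in> S \<Longrightarrow> \<exists>T. open T \<and> x \<in> T \<and> Ck_on k f T"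
  shows "Ck_on k f S"
  using assms
proof (induction k arbitrary: f)
  case 0
  show ?case
    using 0 by (auto intro!: continuous_at_imp_continuous_on) (metis continuous_on_eq_continuous_at)
next
  case (Suc k)
  have "Ck_on k (\<lambda>x. frechet_derivative f (at x) v) S" for v
    by (rule Suc.IH) (use Suc.prems in \<open>fastforce\<close>)
  then show ?case
    using Suc.prems by fastforce
qed

lemma Ck_on_const [simp]: "Ck_on k (\<lambda>x. c) S"
  by (induction k arbitrary: c) auto

lemma Ck_on_linear:
  assumes "bounded_linear f"
  shows "Ck_on k f S"
proof (cases k)
  case 0
  then show ?thesis using assms by (simp add: linear_continuous_on)
next
  case (Suc l)
  have "frechet_derivative f (at x) = f" for x
    by (rule frechet_derivative_at[symmetric]) (rule bounded_linear_imp_has_derivative[OF assms])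
  then show ?thesis
    using Suc assms bounded_linear_imp_differentiable by auto
qed

lemma frechet_derivative_has_derivative:
  "f differentiable (at x) \<Longrightarrow> (f has_derivative frechet_derivative f (at x)) (at x)"
  by (simp add: frechet_derivative_works)

lemma Ck_on_add:
  assumes "open S" "Ck_on k f S" "Ck_on k g S"
  shows "Ck_on k (\<lambda>x. f x + g x) S"
  using assms(2,3)
proof (induction k arbitrary: f g)
  case 0
  then show ?case by (simp add: continuous_on_add)
next
  case (Suc k)
  have eq: "frechet_derivative (\<lambda>x. f x + g x) (at x) =
      (\<lambda>v. frechet_derivative f (at x) v + frechet_derivative g (at x) v)" if "x \<in> S" for x
    by (rule frechet_derivative_at[symmetric])
       (use Suc.prems that in \<open>auto intro!: has_derivative_add frechet_derivative_has_derivative\<close>)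
  have "Ck_on k (\<lambda>x. frechet_derivative (\<lambda>x. f x + g x) (at x) v) S" for v
  proof -
    have "Ck_on k (\<lambda>x. frechet_derivative f (at x) v + frechet_derivative g (at x) v) S"
      using Suc by simp
    then show ?thesis
      by (subst Ck_on_cong[OF assms(1)]) (auto simp: eq)
  qed
  then show ?case
    using Suc.prems by simp
qed

text \<open>The product rule yields a sum of expressions of the same shape, so induction on the
  order closes. An abstract bilinear map covers products, scalings and inner products at
  once.\<close>

lemma Ck_on_bilinear:
  assumes "bounded_bilinear bb" "open S" "Ck_on k f S" "Ck_on k g S"
  shows "Ck_on k (\<lambda>x. bb (f x) (g x)) S"
  using assms(3,4)
proof (induction k arbitrary: f g)
  case 0
  then show ?case by (simp add: bounded_bilinear.continuous_on[OF assms(1)])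
next
  case (Suc k)
  have d: "((\<lambda>x. bb (f x) (g x)) has_derivative
      (\<lambda>v. bb (f x) (frechet_derivative g (at x) v) + bb (frechet_derivative f (at x) v) (g x))) (at x)"
    if "x \<in> S" for x
    by (rule bounded_bilinear.FDERIV[OF assms(1)])
       (use Suc.prems that in \<open>auto intro!: frechet_derivative_has_derivative\<close>)
  have "Ck_on k (\<lambda>x. frechet_derivative (\<lambda>x. bb (f x) (g x)) (at x) v) S" for v
  proof -
    have "Ck_on k (\<lambda>x. bb (f x) (frechet_derivative g (at x) v) + bb (frechet_derivative f (at x) v) (g x)) S"
      by (intro Ck_on_add[OF assms(2)] Suc.IH Ck_on_mono_Suc[OF Suc.prems(1)] Ck_on_mono_Suc[OF Suc.prems(2)]
          Ck_on_derivative[OF Suc.prems(1)] Ck_on_derivative[OF Suc.prems(2)])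
    then show ?thesis
      by (subst Ck_on_cong[OF assms(2)]) (simp_all add: frechet_derivative_at[OF d, symmetric])
  qed
  then show ?case
    using d by (auto simp: differentiable_def)
qed

lemmas Ck_on_mult = Ck_on_bilinear[OF bounded_bilinear_mult]
lemmas Ck_on_scaleR = Ck_on_bilinear[OF bounded_bilinear_scaleR]
lemmas Ck_on_inner = Ck_on_bilinear[OF bounded_bilinear_inner]

lemma Ck_on_sum:
  assumes "open S" "\<And>i. i \<in> I \<Longrightarrow> Ck_on k (f i) S"
  shows "Ck_on k (\<lambda>x. \<Sum>i\<in>I. f i x) S"
  using assms(2) by (induction I rule: infinite_finite_induct) (auto intro: Ck_on_add assms(1) simp del: Ck_on.simps)

lemma Ck_on_compose:
  fixes f :: "'m::euclidean_space \<Rightarrow> 'n::euclidean_space" and g :: "'n \<Rightarrow> 'k::euclidean_space"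
  assumes "open S" "open T" "f ` S \<subseteq> T" "Ck_on k f S" "Ck_on k g T"
  shows "Ck_on k (\<lambda>x. g (f x)) S"
  using assms(4,5)
proof (induction k arbitrary: g)
  case 0
  then show ?case using assms(3) by (auto intro: continuous_on_compose2)
next
  case (Suc k)
  have d: "((\<lambda>x. g (f x)) has_derivative (\<lambda>v. frechet_derivative g (at (f x)) (frechet_derivative f (at x) v))) (at x)"
    if "x \<in> S" for x
    by (rule has_derivative_compose[of f _ x UNIV g])
      (use Suc.prems assms(3) that in \<open>auto intro!: frechet_derivative_has_derivative\<close>)
  \<comment> \<open>\<open>Ck_on\<close> controls derivatives in fixed directions, whereas here the
    direction \<open>frechet_derivative f (at x) v\<close> moves with \<open>x\<close>; expanding it
    in the standard basis separates the two.\<close>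
  have s: "frechet_derivative g (at (f x)) (frechet_derivative f (at x) v) =
      (\<Sum>b\<in>Basis. (frechet_derivative f (at x) v \<bullet> b) *\<^sub>R frechet_derivative g (at (f x)) b)"
    if "x \<in> S" for x v
  proof -
    have l: "linear (frechet_derivative g (at (f x)))"
      using Suc.prems assms(3) that by (auto intro!: linear_frechet_derivative)
    have "frechet_derivative g (at (f x)) (\<Sum>b\<in>Basis. (w \<bullet> b) *\<^sub>R b) =
      (\<Sum>b\<in>Basis. (w \<bullet> b) *\<^sub>R frechet_derivative g (at (f x)) b)" for w
      unfolding linear_sum[OF l] o_def by (intro sum.cong refl linear_scale[OF l])
    from this[of "frechet_derivative f (at x) v"] show ?thesis
      unfolding euclidean_representation .
  qed
  have "Ck_on k (\<lambda>x. frechet_derivative (\<lambda>x. g (f x)) (at x) v) S" for v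
  proof -
    have "Ck_on k (\<lambda>x. \<Sum>b\<in>Basis. (frechet_derivative f (at x) v \<bullet> b) *\<^sub>R frechet_derivative g (at (f x)) b) S"
      by (intro Ck_on_sum Ck_on_scaleR Ck_on_inner assms Ck_on_const Suc.IH
          Ck_on_mono_Suc[OF Suc.prems(1)] Ck_on_derivative[OF Suc.prems(1)] Ck_on_derivative[OF Suc.prems(2)])
    then show ?thesis
      by (subst Ck_on_cong[OF assms(1)]) (simp_all add: frechet_derivative_at[OF d, symmetric] s)
  qed
  then show ?case
    using d by (auto simp: differentiable_def)
qed

text \<open>The derivative is the derivative of \<open>f\<close> times two copies of the inverse
  itself, whose lower order of smoothness is the induction hypothesis.\<close>

lemma Ck_on_inverse:
  fixes f :: "'m::euclidean_space \<Rightarrow> real"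
  assumes "open S" "Ck_on k f S" "\<And>x. x \<in> S \<Longrightarrow> f x \<noteq> 0"
  shows "Ck_on k (\<lambda>x. inverse (f x)) S"
  using assms(2)
proof (induction k)
  case 0
  then show ?case using assms(3) by (auto intro: continuous_on_inverse)
next
  case (Suc k)
  have d: "((\<lambda>x. inverse (f x)) has_derivative
      (\<lambda>v. - (inverse (f x) * frechet_derivative f (at x) v * inverse (f x)))) (at x)" if "x \<in> S" for x
    by (rule Deriv.has_derivative_inverse[of f x, OF assms(3)[OF that] frechet_derivative_has_derivative])
       (use Suc.prems that in simp)
  have "Ck_on k (\<lambda>x. frechet_derivative (\<lambda>x. inverse (f x)) (at x) v) S" for v
  proof -
    have "Ck_on k (\<lambda>x. (- 1) * (inverse (f x) * frechet_derivative f (at x) v * inverse (f x))) S"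
      by (intro Ck_on_mult assms(1) Suc.IH Ck_on_const Ck_on_mono_Suc[OF Suc.prems(1)] Ck_on_derivative[OF Suc.prems(1)])
    then show ?thesis
      by (subst Ck_on_cong[OF assms(1)]) (simp_all add: frechet_derivative_at[OF d, symmetric])
  qed
  then show ?case
    using d by (auto simp: differentiable_def)
qed

section \<open>Functions of class C-infinity on open sets\<close>

lemma Cinf_on_cong: "open S \<Longrightarrow> (\<And>y. y \<in> S \<Longrightarrow> f y = g y) \<Longrightarrow> Cinf_on f S \<longleftrightarrow> Cinf_on g S"
  unfolding Cinf_on_def using Ck_on_cong by blast

lemma Cinf_on_subset: "Cinf_on f S \<Longrightarrow> T \<subseteq> S \<Longrightarrow> Cinf_on f T"
  unfolding Cinf_on_def using Ck_on_subset by blast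

lemma Cinf_on_local:
  "(\<And>x. x \<in> S \<Longrightarrow> \<exists>T. open T \<and> x \<in> T \<and> Cinf_on f T) \<Longrightarrow> Cinf_on f S"
  unfolding Cinf_on_def by (metis Ck_on_local)

lemma Cinf_on_const [simp]: "Cinf_on (\<lambda>x. c) S"
  by (simp add: Cinf_on_def)

lemma Cinf_on_linear: "bounded_linear f \<Longrightarrow> Cinf_on f S"
  by (simp add: Cinf_on_def Ck_on_linear)

lemma Cinf_on_id: "Cinf_on (\<lambda>x. x) S"
  by (rule Cinf_on_linear) (rule bounded_linear_ident)

lemma Cinf_on_add: "open S \<Longrightarrow> Cinf_on f S \<Longrightarrow> Cinf_on g S \<Longrightarrow> Cinf_on (\<lambda>x. f x + g x) S"
  by (simp add: Cinf_on_def Ck_on_add)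

lemma Cinf_on_mult:
  fixes f :: "'m::euclidean_space \<Rightarrow> real"
  shows "open S \<Longrightarrow> Cinf_on f S \<Longrightarrow> Cinf_on g S \<Longrightarrow> Cinf_on (\<lambda>x. f x * g x) S"
  by (simp add: Cinf_on_def Ck_on_mult)

lemma Cinf_on_scaleR: "open S \<Longrightarrow> Cinf_on f S \<Longrightarrow> Cinf_on g S \<Longrightarrow> Cinf_on (\<lambda>x. f x *\<^sub>R g x) S"
  by (simp add: Cinf_on_def Ck_on_scaleR)

lemma Cinf_on_inner: "open S \<Longrightarrow> Cinf_on f S \<Longrightarrow> Cinf_on g S \<Longrightarrow> Cinf_on (\<lambda>x. f x \<bullet> g x) S"
  by (simp add: Cinf_on_def Ck_on_inner)

lemma Cinf_on_diff: 
  fixes f g :: "'m::euclidean_space \<Rightarrow> 'n::euclidean_space"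
  assumes "open S" "Cinf_on f S" "Cinf_on g S"
  shows "Cinf_on (\<lambda>x. f x - g x) S"
proof -
  have "Cinf_on (\<lambda>x. f x + (- 1) *\<^sub>R g x) S"
    by (intro Cinf_on_add Cinf_on_scaleR assms Cinf_on_const)
  then show ?thesis by simp
qed

lemma Cinf_on_compose:
  "open S \<Longrightarrow> open T \<Longrightarrow> f ` S \<subseteq> T \<Longrightarrow> Cinf_on f S \<Longrightarrow> Cinf_on g T \<Longrightarrow> Cinf_on (\<lambda>x. g (f x)) S"
  by (simp add: Cinf_on_def Ck_on_compose)

lemma Cinf_on_inverse:
  fixes f :: "'m::euclidean_space \<Rightarrow> real"
  shows "open S \<Longrightarrow> Cinf_on f S \<Longrightarrow> (\<And>x. x \<in> S \<Longrightarrow> f x \<noteq> 0) \<Longrightarrow> Cinf_on (\<lambda>x. inverse (f x)) S"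
  by (simp add: Cinf_on_def Ck_on_inverse)

lemma Cinf_on_differentiable: "Cinf_on f S \<Longrightarrow> x \<in> S \<Longrightarrow> f differentiable (at x)"
  unfolding Cinf_on_def using Ck_on_differentiable by blast

lemma Cinf_on_continuous: "Cinf_on f S \<Longrightarrow> continuous_on S f"
  unfolding Cinf_on_def using Ck_on_continuous by blast

lemma Cinf_on_derivative: "Cinf_on f S \<Longrightarrow> Cinf_on (\<lambda>x. frechet_derivative f (at x) v) S"
  unfolding Cinf_on_def by (metis Ck_on.simps(2))

section \<open>Flat functions and bump functions\<close>

definition flat :: "real poly \<Rightarrow> real \<Rightarrow> real" where
  "flat p x = (if x > 0 then poly p (1 / x) * exp (- (1 / x)) else 0)"

lemma tendsto_poly_exp_minus: "((\<lambda>y. poly p y * exp (- y)) \<longlongrightarrow> 0) at_top" for p :: "real poly"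
proof -
  have "((\<lambda>y. \<Sum>i\<le>degree p. coeff p i * (y ^ i / exp y)) \<longlongrightarrow> (\<Sum>i\<le>degree p. coeff p i * 0)) at_top"
    by (intro tendsto_intros tendsto_power_div_exp_0)
  then show ?thesis
    by (simp add: poly_altdef sum_distrib_right exp_minus divide_inverse mult.assoc)
qed

text \<open>With y = 1/x the derivative of p(y) exp(-y) is y^2 (p(y) - p'(y)) exp(-y), because dy/dx
  = -y^2; \<open>[:0, 0, 1:]\<close> is the polynomial y^2. Carrying a general polynomial makes the
  family closed under differentiation.\<close>

lemma flat_has_derivative: "(flat p has_field_derivative flat ([:0, 0, 1:] * (p - pderiv p)) x) (at x)"
proof -
  consider "x > 0" | "x < 0" | "x = 0" by linarith
  then show ?thesis
  proof cases
    case 1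
    have i: "((\<lambda>x. 1 / x) has_field_derivative - (1 / x\<^sup>2)) (at x)"
      using 1 by (auto intro!: derivative_eq_intros simp: power2_eq_square)
    have "((\<lambda>x. poly p (1 / x) * exp (- (1 / x))) has_field_derivative
        poly (pderiv p) (1 / x) * - (1 / x\<^sup>2) * exp (- (1 / x))
        + exp (- (1 / x)) * - (- (1 / x\<^sup>2)) * poly p (1 / x)) (at x)"
      by (intro DERIV_mult DERIV_chain2[OF poly_DERIV i] DERIV_chain2[OF DERIV_exp DERIV_minus[OF i]])
    also have "poly (pderiv p) (1 / x) * - (1 / x\<^sup>2) * exp (- (1 / x))
        + exp (- (1 / x)) * - (- (1 / x\<^sup>2)) * poly p (1 / x) = flat ([:0, 0, 1:] * (p - pderiv p)) x"
      using 1 by (simp add: flat_def power2_eq_square algebra_simps)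
    finally have "((\<lambda>x. poly p (1 / x) * exp (- (1 / x))) has_field_derivative
        flat ([:0, 0, 1:] * (p - pderiv p)) x) (at x)" .
    then show ?thesis
      by (rule has_field_derivative_transform_within_open[of _ _ _ "{0<..}"]) (use 1 in \<open>auto simp: flat_def\<close>)
  next
    case 2
    have "((\<lambda>x. 0) has_field_derivative flat ([:0, 0, 1:] * (p - pderiv p)) x) (at x)"
      using 2 by (simp add: flat_def)
    then show ?thesis
      by (rule has_field_derivative_transform_within_open[of _ _ _ "{..<0}"]) (use 2 in \<open>auto simp: flat_def\<close>)
  next
    case 3
    have r: "((\<lambda>h. flat p h / h) \<longlongrightarrow> 0) (at_right 0)"
    proof -
      \<comment> \<open>The difference quotient at 0 is y p(y) exp(-y) with y = 1/h, hence the extra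
        factor \<open>[:0, 1:]\<close>.\<close>
      have "((\<lambda>h. poly ([:0, 1:] * p) (inverse h) * exp (- inverse h)) \<longlongrightarrow> 0) (at_right 0)"
        by (rule filterlim_compose[OF tendsto_poly_exp_minus filterlim_inverse_at_top_right])
      then show ?thesis
        by (rule tendsto_cong[THEN iffD1, rotated])
           (auto simp: eventually_at_filter flat_def field_simps)
    qed
    have l: "((\<lambda>h. flat p h / h) \<longlongrightarrow> 0) (at_left 0)"
      by (rule tendsto_cong[THEN iffD1, rotated, OF tendsto_const])
         (auto simp: eventually_at_filter flat_def)
    have "((\<lambda>h. flat p h / h) \<longlongrightarrow> 0) (at 0)"
      using r l by (simp add: filterlim_split_at)
    then show ?thesis
      using 3 by (simp add: DERIV_def flat_def)
  qed
qed

lemma Cinf_on_flat: "Cinf_on (flat p) S"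
proof -
  \<comment> \<open>The derivative in direction v is v times a flat function, so the induction
    carries a constant factor \<open>c\<close>.\<close>
  have "Ck_on k (\<lambda>x. c * flat p x) S" for k c
  proof (induction k arbitrary: p c)
    case 0
    have "continuous_on S (flat p)"
      by (meson continuous_at_imp_continuous_on DERIV_isCont flat_has_derivative)
    then show ?case by (simp add: continuous_on_mult_left)
  next
    case (Suc k)
    have d: "((\<lambda>x. c * flat p x) has_derivative (\<lambda>v. (c * v) * flat ([:0, 0, 1:] * (p - pderiv p)) x)) (at x)" for x
    proof -
      have "(\<lambda>v. (c * v) * flat q x) = (*) (c * flat q x)" for q by (auto simp: mult_ac)
      then show ?thesis
        using DERIV_cmult[OF flat_has_derivative[of p x], of c] by (simp only: has_field_derivative_def)
    qed
    show ?case
      using Suc[of "c * _" "[:0, 0, 1:] * (p - pderiv p)"] d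
      by (auto simp: frechet_derivative_at[OF d, symmetric] differentiable_def)
  qed
  from this[of _ 1] show ?thesis by (simp add: Cinf_on_def)
qed

text \<open>The quotient f / (f + g), where f is positive exactly inside the ball of radius r and g
  exactly outside the closed ball of radius r/2. The two regions cover the space, so the denominator
  never vanishes.\<close>

lemma smooth_bump:
  fixes a :: "'m::euclidean_space"
  assumes "r > 0"
  shows "\<exists>\<beta> :: 'm \<Rightarrow> real. Cinf_on \<beta> UNIV \<and> (\<forall>x. x \<in> ball a (r / 2) \<longrightarrow> \<beta> x = 1) \<and>
    (\<forall>x. x \<notin> ball a r \<longrightarrow> \<beta> x = 0)"
proof -
  define f where "f x = flat 1 (r\<^sup>2 - (x - a) \<bullet> (x - a))" for x
  define g where "g x = flat 1 ((x - a) \<bullet> (x - a) - (r / 2)\<^sup>2)" for x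
  have n: "(x - a) \<bullet> (x - a) = (dist a x)\<^sup>2" for x
    by (metis dist_commute dist_norm power2_norm_eq_inner)
  have nn: "flat 1 y \<ge> 0" for y by (simp add: flat_def)
  have pos: "f x + g x > 0" for x
  proof (cases "dist a x < r")
    case True
    then have "(dist a x)\<^sup>2 < r\<^sup>2" by (intro power_strict_mono) auto
    then have "f x > 0" by (simp add: f_def n flat_def)
    then show ?thesis using nn[of "(x - a) \<bullet> (x - a) - (r / 2)\<^sup>2"] by (simp add: g_def)
  next
    case False
    then have "(r / 2)\<^sup>2 < (dist a x)\<^sup>2" using assms by (intro power_strict_mono) auto
    then have "g x > 0" by (simp add: g_def n flat_def)
    then show ?thesis using nn[of "r\<^sup>2 - (x - a) \<bullet> (x - a)"] by (simp add: f_def)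
  qed
  have i: "Cinf_on (\<lambda>x. (x - a) \<bullet> (x - a)) UNIV"
    by (intro Cinf_on_inner Cinf_on_diff Cinf_on_id Cinf_on_const open_UNIV)
  have "Cinf_on f UNIV" unfolding f_def
    by (rule Cinf_on_compose[OF _ _ _ _ Cinf_on_flat, of _ UNIV]) (auto intro: Cinf_on_diff i)
  moreover have "Cinf_on g UNIV" unfolding g_def
    by (rule Cinf_on_compose[OF _ _ _ _ Cinf_on_flat, of _ UNIV]) (auto intro: Cinf_on_diff i)
  ultimately have "Cinf_on (\<lambda>x. f x * inverse (f x + g x)) UNIV"
    using pos by (intro Cinf_on_mult Cinf_on_inverse Cinf_on_add open_UNIV) (auto simp: less_imp_neq dest: less_imp_neq[symmetric])
  moreover have "f x * inverse (f x + g x) = 1" if "x \<in> ball a (r / 2)" for x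
  proof -
    have "dist a x < r / 2" using that by simp
    then have "(dist a x)\<^sup>2 < (r / 2)\<^sup>2" by (intro power_strict_mono) auto
    then have "g x = 0" by (simp add: g_def n flat_def)
    then show ?thesis using pos[of x] by simp
  qed
  moreover have "f x * inverse (f x + g x) = 0" if "x \<notin> ball a r" for x
  proof -
    have "r \<le> dist a x" using that by simp
    then have "r\<^sup>2 \<le> (dist a x)\<^sup>2" using assms by (intro power_mono) auto
    then show ?thesis by (simp add: f_def n flat_def)
  qed
  ultimately show ?thesis by blast
qed

section \<open>Parameter integrals and Hadamard's lemma\<close>

lemma Ck_on_integral:
  fixes H :: "'m::euclidean_space \<times> real \<Rightarrow> real"
  assumes "open U" "convex U" "open V" "U \<times> {0..1} \<subseteq> V" "Ck_on k H V"
  shows "Ck_on k (\<lambda>x. integral {0..1} (\<lambda>t. H (x, t))) U"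
  using assms(5)
proof (induction k arbitrary: H)
  case 0
  have "continuous_on (U \<times> cbox 0 1) (\<lambda>(x, t). H (x, t))"
    using 0 assms(4) by (auto intro: continuous_on_subset)
  from integral_continuous_on_param[OF this] show ?case by simp
next
  case (Suc k)
  \<comment> \<open>\<open>leibniz_rule\<close> asks for the derivative as a continuous family of
    bounded linear maps; continuity is checked on basis vectors, where it is part of the
    \<open>Ck_on\<close> hypothesis.\<close>
  define H' where "H' x t = Blinfun (\<lambda>v. frechet_derivative H (at (x, t)) (v, 0))" for x t
  have d: "((\<lambda>x. H (x, t)) has_derivative (\<lambda>v. frechet_derivative H (at (x, t)) (v, 0))) (at x)"
    if "(x, t) \<in> V" for x t
    by (rule has_derivative_compose[of "\<lambda>x. (x, t)" "\<lambda>v. (v, 0)" x UNIV H])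
       (use Suc.prems that in \<open>auto intro!: frechet_derivative_has_derivative derivative_eq_intros\<close>)
  have H': "blinfun_apply (H' x t) = (\<lambda>v. frechet_derivative H (at (x, t)) (v, 0))" if "(x, t) \<in> V" for x t
    unfolding H'_def by (rule bounded_linear_Blinfun_apply) (rule has_derivative_bounded_linear[OF d[OF that]])
  have inV: "(x, t) \<in> V" if "x \<in> U" "t \<in> cbox 0 1" for x t
    using assms(4) that by auto
  have cH: "continuous_on (U \<times> cbox 0 1) (\<lambda>(x, t). H' x t)"
  proof (rule continuous_on_blinfun_componentwise)
    fix b :: 'm assume "b \<in> Basis"
    have "continuous_on V (\<lambda>z. frechet_derivative H (at z) (b, 0))"
      using Suc.prems Ck_on_continuous by fastforce
    then have "continuous_on (U \<times> cbox 0 1) (\<lambda>z. frechet_derivative H (at z) (b, 0))"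
      by (rule continuous_on_subset) (use assms(4) in auto)
    then show "continuous_on (U \<times> cbox 0 1) (\<lambda>z. blinfun_apply (case z of (x, t) \<Rightarrow> H' x t) b)"
      by (rule continuous_on_cong[THEN iffD1, OF refl, rotated]) (use inV in \<open>auto simp: H'\<close>)
  qed
  have cHV: "continuous_on V H" using Suc.prems Ck_on_continuous by blast
  have int: "H' x integrable_on cbox 0 1" if "x \<in> U" for x
    by (rule integrable_continuous)
       (use continuous_on_compose2[OF cH, of "cbox 0 1" "\<lambda>t. (x, t)"] that in
         \<open>force intro!: continuous_intros\<close>)
  have D: "((\<lambda>x. integral {0..1} (\<lambda>t. H (x, t))) has_derivative
      (\<lambda>v. integral {0..1} (\<lambda>t. frechet_derivative H (at (x, t)) (v, 0)))) (at x)" if x: "x \<in> U" for x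
  proof -
    have "((\<lambda>x. integral (cbox 0 1) (\<lambda>t. H (x, t))) has_derivative
       integral (cbox 0 1) (H' x)) (at x within U)"
    proof (rule leibniz_rule[OF _ _ cH x assms(2)])
      show "((\<lambda>x. H (x, t)) has_derivative blinfun_apply (H' x t)) (at x within U)"
        if "x \<in> U" "t \<in> cbox 0 1" for x t
        using d[OF inV[OF that]] H'[OF inV[OF that]] by (simp add: has_derivative_at_withinI)
      show "(\<lambda>t. H (x, t)) integrable_on cbox 0 1" if "x \<in> U" for x
        by (rule integrable_continuous, rule continuous_on_compose2[OF cHV])
           (use inV that in \<open>auto intro!: continuous_intros\<close>)
    qed
    moreover have "blinfun_apply (integral (cbox 0 1) (H' x)) v =
        integral {0..1} (\<lambda>t. frechet_derivative H (at (x, t)) (v, 0))" for v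
      unfolding blinfun_apply_integral[OF int[OF x]] box_real(2)[symmetric]
      by (rule integral_cong) (simp add: H'[OF inV[OF x]])
    moreover have "at x within U = at x" using x assms(1) by (rule at_within_open)
    ultimately show ?thesis
      by (metis (no_types, lifting) ext box_real(2))
  qed
  \<comment> \<open>The partial derivative is an integral of the same kind, with \<open>H\<close>
    replaced by its derivative in direction \<open>(v, 0)\<close>.\<close>
  have "Ck_on k (\<lambda>x. frechet_derivative (\<lambda>x. integral {0..1} (\<lambda>t. H (x, t))) (at x) v) U" for v
  proof -
    have "Ck_on k (\<lambda>x. integral {0..1} (\<lambda>t. frechet_derivative H (at (x, t)) (v, 0))) U"
      using Suc.prems by (intro Suc.IH) simp
    then show ?thesis
      by (subst Ck_on_cong[OF assms(1)]) (auto simp: frechet_derivative_at[OF D, symmetric])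
  qed
  then show ?case
    using D by (auto simp: differentiable_def)
qed

text \<open>The remainder is the integral of the derivative of \<open>f\<close> along the segment
  from \<open>a\<close> to \<open>x\<close>. The direction is kept as a separate argument of
  \<open>g\<close>, linear in it, so that it can be expanded in any basis afterwards.\<close>

lemma hadamard:
  fixes f :: "'m::euclidean_space \<Rightarrow> real"
  assumes f: "Cinf_on f (ball a r)" and "r > 0"
  obtains g :: "'m \<Rightarrow> 'm \<Rightarrow> real" where "\<And>v. Cinf_on (g v) (ball a r)"
    "\<And>x. x \<in> ball a r \<Longrightarrow> f x = f a + g (x - a) x" "\<And>x. x \<in> ball a r \<Longrightarrow> linear (\<lambda>v. g v x)"
    "\<And>v. g v a = frechet_derivative f (at a) v"
proof -
  define l where "l = (\<lambda>(x :: 'm, t :: real). a + t *\<^sub>R (x - a))"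
  \<comment> \<open>An open neighbourhood of the ball times the closed unit interval on which the
    integrand is smooth, so that no one-sided derivatives in \<open>t\<close> arise.\<close>
  define V where "V = l -` ball a r"
  have cl: "Cinf_on l UNIV"
    unfolding l_def case_prod_unfold
    by (intro Cinf_on_add Cinf_on_scaleR Cinf_on_diff open_UNIV Cinf_on_const Cinf_on_linear
        bounded_linear_fst bounded_linear_snd)
  have oV: "open V" unfolding V_def
    by (rule open_vimage) (use Cinf_on_continuous[OF cl] in auto)
  have UV: "ball a r \<times> {0..1} \<subseteq> V"
  proof
    fix z :: "'m \<times> real" assume "z \<in> ball a r \<times> {0..1}"
    then obtain x t where z: "z = (x, t)" "dist a x < r" "0 \<le> t" "t \<le> 1" by auto
    have "dist a (a + t *\<^sub>R (x - a)) = t * dist a x"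
      using z by (simp add: dist_norm norm_minus_commute)
    also have "\<dots> \<le> dist a x" using z by (simp add: mult_left_le_one_le)
    finally show "z \<in> V" using z by (simp add: V_def l_def)
  qed
  define g where "g v x = integral {0..1} (\<lambda>t. frechet_derivative f (at (l (x, t))) v)" for v x
  have "Cinf_on (\<lambda>z. frechet_derivative f (at (l z)) v) V" for v
    by (rule Cinf_on_compose[OF oV open_ball _ Cinf_on_subset[OF cl] Cinf_on_derivative[OF f]])
       (auto simp: V_def)
  then have Cg: "Cinf_on (g v) (ball a r)" for v
    unfolding g_def Cinf_on_def
    by (intro allI Ck_on_integral[OF open_ball convex_ball oV UV, of _ "\<lambda>z. frechet_derivative f (at (l z)) v"]) (simp add: Cinf_on_def)
  have df: "f differentiable (at (l (x, t)))" if "x \<in> ball a r" "t \<in> {0..1}" for x t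
  proof (rule Cinf_on_differentiable[OF f])
    have "(x, t) \<in> V" using UV that by blast
    then show "l (x, t) \<in> ball a r" by (simp add: V_def)
  qed
  have eq: "f x = f a + g (x - a) x" if x: "x \<in> ball a r" for x
  proof -
    have "((\<lambda>t. frechet_derivative f (at (l (x, t))) (x - a)) has_integral f (l (x, 1)) - f (l (x, 0))) {0..1}"
    proof (rule fundamental_theorem_of_calculus)
      fix t :: real assume t: "t \<in> {0..1}"
      have "((\<lambda>t. f (l (x, t))) has_derivative (\<lambda>h. frechet_derivative f (at (l (x, t))) (h *\<^sub>R (x - a)))) (at t)"
        by (rule has_derivative_compose[of "\<lambda>t. l (x, t)" "\<lambda>h. h *\<^sub>R (x - a)" t UNIV f])
           (use df[OF x t] in \<open>auto intro!: frechet_derivative_has_derivative derivative_eq_intros simp: l_def\<close>)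
      then have "((\<lambda>t. f (l (x, t))) has_vector_derivative frechet_derivative f (at (l (x, t))) (x - a)) (at t)"
        using linear_scale[OF linear_frechet_derivative[OF df[OF x t]]]
        by (simp add: has_vector_derivative_def)
      then show "((\<lambda>t. f (l (x, t))) has_vector_derivative frechet_derivative f (at (l (x, t))) (x - a)) (at t within {0..1})"
        by (rule has_vector_derivative_at_within)
    qed simp
    then show ?thesis by (simp add: g_def integral_unique l_def)
  qed
  have int: "(\<lambda>t. frechet_derivative f (at (l (x, t))) v) integrable_on {0..1}" if x: "x \<in> ball a r" for x v
  proof -
    have "continuous_on V (\<lambda>z. frechet_derivative f (at (l z)) v)"
      by (rule Cinf_on_continuous) fact
    then have "continuous_on {0..1} (\<lambda>t. frechet_derivative f (at (l (x, t))) v)"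
      by (rule continuous_on_compose2[of V _ _ "\<lambda>t. (x, t)"]) (use x UV in \<open>auto intro!: continuous_intros\<close>)
    then show ?thesis by (rule integrable_continuous_interval)
  qed
  have lin: "linear (\<lambda>v. g v x)" if x: "x \<in> ball a r" for x
  proof
    fix v w and c :: real
    have "g (v + w) x = integral {0..1} (\<lambda>t. frechet_derivative f (at (l (x, t))) v + frechet_derivative f (at (l (x, t))) w)"
      unfolding g_def by (rule integral_cong) (metis df[OF x] linear_add linear_frechet_derivative)
    then show "g (v + w) x = g v x + g w x"
      using int[OF x] by (simp add: g_def integral_add)
    have "g (c *\<^sub>R v) x = integral {0..1} (\<lambda>t. c *\<^sub>R frechet_derivative f (at (l (x, t))) v)"
      unfolding g_def by (rule integral_cong) (metis df[OF x] linear_scale linear_frechet_derivative)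
    then show "g (c *\<^sub>R v) x = c *\<^sub>R g v x"
      by (simp add: g_def)
  qed
  have "g v a = frechet_derivative f (at a) v" for v
    by (simp add: g_def l_def)
  with Cg eq lin show thesis by (rule that)
qed

section \<open>Derivations, connections and curvature\<close>

text \<open>Only spanning is asked, in the form that the \<open>E i\<close> recover a vector from
  its values on the functions \<open>x i\<close>. A fibre inherits the functions and the vertically
  projected fields of \<open>M\<close>, in general more of them than its dimension.\<close>

definition local_frame ::
    "('a, 'z) rspace_scheme \<Rightarrow> nat \<Rightarrow> (nat \<Rightarrow> 'a \<Rightarrow> real) \<Rightarrow> (nat \<Rightarrow> 'a vfield) \<Rightarrow> 'a set \<Rightarrow> bool" where
  "local_frame N n x E G \<longleftrightarrow> openin (rtop N) G \<and> (\<forall>i<n. x i \<in> smf N \<and> vector_field N (E i)) \<and>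
     (\<forall>q\<in>G. \<forall>v\<in>tangent_space N q. \<forall>f. v f = (\<Sum>i<n. v (x i) * E i q f))"

text \<open>What calculus with derivations rests on: smoothness is local, and bump functions exist.
  Fibres qualify without charts. Locality tests points of the space only, so values elsewhere are
  free.\<close>

locale smooth_algebra =
  fixes N :: "('a, 'z) rspace_scheme"
  assumes smf_const: "(\<lambda>x. c) \<in> smf N"
    and smf_add: "\<lbrakk>f \<in> smf N; h \<in> smf N\<rbrakk> \<Longrightarrow> (\<lambda>x. f x + h x) \<in> smf N"
    and smf_mult: "\<lbrakk>f \<in> smf N; h \<in> smf N\<rbrakk> \<Longrightarrow> (\<lambda>x. f x * h x) \<in> smf N"
    and smf_local: "(\<And>p. p \<in> pts N \<Longrightarrow> \<exists>G h. openin (rtop N) G \<and> p \<in> G \<and> h \<in> smf N \<and> (\<forall>q\<in>G. f q = h q)) \<Longrightarrow> f \<in> smf N"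
    and bump: "\<lbrakk>openin (rtop N) G; p \<in> G\<rbrakk> \<Longrightarrow>
      \<exists>\<eta>\<in>smf N. \<exists>H. openin (rtop N) H \<and> p \<in> H \<and> H \<subseteq> G \<and> (\<forall>q\<in>H. \<eta> q = 1) \<and> (\<forall>q. q \<notin> G \<longrightarrow> \<eta> q = 0)"
begin

abbreviation T :: "'a \<Rightarrow> 'a tvec set" where "T \<equiv> tangent_space N"
abbreviation VF :: "'a vfield \<Rightarrow> bool" where "VF \<equiv> vector_field N"

lemma smf_cong: "f \<in> smf N \<Longrightarrow> (\<And>q. q \<in> pts N \<Longrightarrow> f q = h q) \<Longrightarrow> h \<in> smf N"
  by (rule smf_local) (metis openin_topspace)

lemma smf_cmult: "f \<in> smf N \<Longrightarrow> (\<lambda>x. c * f x) \<in> smf N"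
  using smf_mult[OF smf_const] .

lemma smf_minus: "f \<in> smf N \<Longrightarrow> (\<lambda>x. - f x) \<in> smf N"
  using smf_cmult[of f "- 1"] by simp

lemma smf_diff: "f \<in> smf N \<Longrightarrow> h \<in> smf N \<Longrightarrow> (\<lambda>x. f x - h x) \<in> smf N"
  using smf_add[OF _ smf_minus, of f h] by simp

lemma smf_sum: "(\<And>i. i \<in> I \<Longrightarrow> f i \<in> smf N) \<Longrightarrow> (\<lambda>x. \<Sum>i\<in>I. f i x) \<in> smf N"
  by (induction I rule: infinite_finite_induct) (auto intro: smf_add smf_const)

lemma tv_add: "v \<in> T p \<Longrightarrow> f \<in> smf N \<Longrightarrow> h \<in> smf N \<Longrightarrow> v (\<lambda>x. f x + h x) = v f + v h"
  and tv_cmult: "v \<in> T p \<Longrightarrow> f \<in> smf N \<Longrightarrow> v (\<lambda>x. c * f x) = c * v f"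
  and tv_mult: "v \<in> T p \<Longrightarrow> f \<in> smf N \<Longrightarrow> h \<in> smf N \<Longrightarrow> v (\<lambda>x. f x * h x) = f p * v h + h p * v f"
  and tv_nonsmooth: "v \<in> T p \<Longrightarrow> f \<notin> smf N \<Longrightarrow> v f = 0"
  by (simp_all add: tangent_space_def)

lemma tv_minus: "v \<in> T p \<Longrightarrow> f \<in> smf N \<Longrightarrow> v (\<lambda>x. - f x) = - v f"
  using tv_cmult[of v p f "- 1"] by simp

lemma tv_diff: "v \<in> T p \<Longrightarrow> f \<in> smf N \<Longrightarrow> h \<in> smf N \<Longrightarrow> v (\<lambda>x. f x - h x) = v f - v h"
  using tv_add[of v p f "\<lambda>x. - h x"] smf_minus tv_minus by simp

lemma tv_const: "v \<in> T p \<Longrightarrow> v (\<lambda>x. c) = 0"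
  using tv_mult[of v p "\<lambda>x. 1" "\<lambda>x. 1"] tv_cmult[of v p "\<lambda>x. 1" c] by (simp add: smf_const)

lemma tv_sum:
  assumes v: "v \<in> T p" and f: "\<And>i. i \<in> I \<Longrightarrow> f i \<in> smf N"
  shows "v (\<lambda>x. \<Sum>i\<in>I. f i x) = (\<Sum>i\<in>I. v (f i))"
  using f by (induction I rule: infinite_finite_induct) (simp_all add: tv_const[OF v] tv_add[OF v] smf_sum)

text \<open>For a bump function \<eta> at \<open>p\<close> vanishing outside \<open>G\<close> the
  product (f - h) \<eta> is zero. Leibniz at \<open>p\<close>, where f - h is 0 and \<eta> is 1,
  turns this into v f - v h = 0.\<close>

lemma tv_local:
  assumes v: "v \<in> T p" and G: "openin (rtop N) G" "p \<in> G" and f: "f \<in> smf N" "h \<in> smf N"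
    and eq: "\<And>q. q \<in> G \<Longrightarrow> f q = h q"
  shows "v f = v h"
proof -
  obtain \<eta> where \<eta>: "\<eta> \<in> smf N" "\<eta> p = 1" "\<And>q. q \<notin> G \<Longrightarrow> \<eta> q = 0"
    using bump[OF G] by blast
  have "(\<lambda>x. (f x - h x) * \<eta> x) = (\<lambda>x. 0)"
    using eq \<eta>(3) by (metis cancel_comm_monoid_add_class.diff_cancel mult_zero_left mult_zero_right)
  then have "v (\<lambda>x. (f x - h x) * \<eta> x) = 0"
    using tv_const[OF v] by simp
  then show ?thesis
    using \<eta>(2) eq[OF G(2)] by (simp add: tv_mult[OF v] tv_diff[OF v] smf_diff f \<eta>(1))
qed

lemma tv_cong:
  assumes "v \<in> T p" "p \<in> pts N" "\<And>q. q \<in> pts N \<Longrightarrow> f q = h q"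
  shows "v f = v h"
proof (cases "f \<in> smf N")
  case True
  then show ?thesis
    using tv_local[OF assms(1) openin_topspace assms(2) True smf_cong[OF True]] assms(3) by blast
next
  case False
  then have "h \<notin> smf N" using smf_cong[of h f] assms(3) by metis
  then show ?thesis using False tv_nonsmooth[OF assms(1)] by simp
qed

lemma tv_lin: "u \<in> T p \<Longrightarrow> v \<in> T p \<Longrightarrow> (\<lambda>f. a * u f + b * v f) \<in> T p"
  by (auto simp: tangent_space_def algebra_simps)

lemma tv_zero: "(\<lambda>f. 0) \<in> T p"
  by (auto simp: tangent_space_def)

lemma tv_plus: "u \<in> T p \<Longrightarrow> v \<in> T p \<Longrightarrow> (\<lambda>f. u f + v f) \<in> T p"
  using tv_lin[of u p v 1 1] by simp

lemma tv_minus': "u \<in> T p \<Longrightarrow> v \<in> T p \<Longrightarrow> (\<lambda>f. u f - v f) \<in> T p"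
  using tv_lin[of u p v 1 "- 1"] by simp

lemma tv_scale: "u \<in> T p \<Longrightarrow> (\<lambda>f. a * u f) \<in> T p"
  using tv_lin[of u p u a 0] by simp

lemma tv_lincomb: "(\<And>i. i \<in> I \<Longrightarrow> u i \<in> T p) \<Longrightarrow> (\<lambda>f. \<Sum>i\<in>I. c i * u i f) \<in> T p"
proof (induction I rule: infinite_finite_induct)
  case (insert i I)
  then have "(\<lambda>f. c i * u i f + (\<Sum>i\<in>I. c i * u i f)) \<in> T p"
    by (intro tv_plus[OF tv_scale]) simp_all
  then show ?case using insert.hyps by simp
qed (simp_all add: tv_zero)

lemma vf_tan: "VF V \<Longrightarrow> p \<in> pts N \<Longrightarrow> V p \<in> T p"
  by (simp add: vector_field_def)

lemma vf_smf: "VF V \<Longrightarrow> (\<lambda>p. V p f) \<in> smf N"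
proof (cases "f \<in> smf N")
  case False
  assume "VF V"
  then show ?thesis
    using False by (intro smf_cong[OF smf_const[of 0]]) (metis vf_tan tv_nonsmooth)
qed (simp add: vector_field_def)

lemma vfI: "(\<And>p. p \<in> pts N \<Longrightarrow> V p \<in> T p) \<Longrightarrow> (\<And>f. f \<in> smf N \<Longrightarrow> (\<lambda>p. V p f) \<in> smf N) \<Longrightarrow> VF V"
  by (simp add: vector_field_def)

lemma vf_cong: "VF U \<Longrightarrow> (\<And>p. p \<in> pts N \<Longrightarrow> V p = U p) \<Longrightarrow> VF V"
  by (rule vfI) (auto simp: vf_tan intro: smf_cong[OF vf_smf])

lemma vf_local:
  assumes "\<And>p. p \<in> pts N \<Longrightarrow> \<exists>G W. openin (rtop N) G \<and> p \<in> G \<and> VF W \<and> (\<forall>q\<in>G. V q = W q)"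
  shows "VF V"
proof (rule vfI)
  show "V p \<in> T p" if "p \<in> pts N" for p
    using assms[OF that] vf_tan that by metis
  show "(\<lambda>p. V p f) \<in> smf N" if "f \<in> smf N" for f
    using assms vf_smf by (intro smf_local) metis
qed

lemma vf_add:
  assumes U: "VF U" and V: "VF V"
  shows "VF (\<lambda>q h. U q h + V q h)"
proof (rule vfI)
  show "(\<lambda>h. U p h + V p h) \<in> T p" if "p \<in> pts N" for p
    by (rule tv_plus[OF vf_tan[OF U that] vf_tan[OF V that]])
  show "(\<lambda>p. U p f + V p f) \<in> smf N" for f
    by (rule smf_add[OF vf_smf[OF U] vf_smf[OF V]])
qed

lemma vf_scale:
  assumes a: "a \<in> smf N" and U: "VF U"
  shows "VF (\<lambda>q h. a q * U q h)"
proof (rule vfI)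
  show "(\<lambda>h. a p * U p h) \<in> T p" if "p \<in> pts N" for p
    by (rule tv_scale[OF vf_tan[OF U that]])
  show "(\<lambda>p. a p * U p f) \<in> smf N" for f
    by (rule smf_mult[OF a vf_smf[OF U]])
qed

lemma vf_diff: "VF U \<Longrightarrow> VF V \<Longrightarrow> VF (\<lambda>q h. U q h - V q h)"
  using vf_add[OF _ vf_scale[OF smf_const[of "- 1"]], of U V] by simp

lemma vf_lincomb:
  assumes "\<And>i. i \<in> I \<Longrightarrow> a i \<in> smf N \<and> VF (E i)"
  shows "VF (\<lambda>q h. \<Sum>i\<in>I. a i q * E i q h)"
proof (rule vfI)
  show "(\<lambda>h. \<Sum>i\<in>I. a i p * E i p h) \<in> T p" if "p \<in> pts N" for p
    using assms vf_tan that by (intro tv_lincomb) blast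
  show "(\<lambda>p. \<Sum>i\<in>I. a i p * E i p f) \<in> smf N" for f
    using assms by (intro smf_sum smf_mult) (simp_all add: vf_smf)
qed

lemma vf_bracket:
  assumes U: "VF U" and V: "VF V"
  shows "VF (lie_bracket U V)"
proof (rule vfI)
  fix p assume p: "p \<in> pts N"
  have u: "U p \<in> T p" and v: "V p \<in> T p" using U V p by (simp_all add: vf_tan)
  \<comment> \<open>The pointwise rules for \<open>V q\<close> hold at points of the space only, so
    rewriting below \<open>U p\<close> has to go through \<open>tv_cong\<close>.\<close>
  have cU: "U p (\<lambda>q. V q k) = U p h" if "\<And>q. q \<in> pts N \<Longrightarrow> V q k = h q" for k h
    by (rule tv_cong[OF u p that])
  have cV: "V p (\<lambda>q. U q k) = V p h" if "\<And>q. q \<in> pts N \<Longrightarrow> U q k = h q" for k h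
    by (rule tv_cong[OF v p that])
  note sm = smf_add smf_mult smf_cmult vf_smf[OF U] vf_smf[OF V]
  show "lie_bracket U V p \<in> T p"
    unfolding tangent_space_def lie_bracket_def
  proof (intro CollectI conjI ballI allI impI)
    fix f h and c :: real assume f: "f \<in> smf N" and h: "h \<in> smf N"
    have "U p (\<lambda>q. V q (\<lambda>x. f x + h x)) = U p (\<lambda>q. V q f + V q h)"
      by (rule cU) (simp add: tv_add[OF vf_tan[OF V]] f h)
    moreover have "V p (\<lambda>q. U q (\<lambda>x. f x + h x)) = V p (\<lambda>q. U q f + U q h)"
      by (rule cV) (simp add: tv_add[OF vf_tan[OF U]] f h)
    ultimately show "U p (\<lambda>q. V q (\<lambda>x. f x + h x)) - V p (\<lambda>q. U q (\<lambda>x. f x + h x)) =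
      U p (\<lambda>q. V q f) - V p (\<lambda>q. U q f) + (U p (\<lambda>q. V q h) - V p (\<lambda>q. U q h))"
      by (simp add: tv_add[OF u] tv_add[OF v] sm)
    have "U p (\<lambda>q. V q (\<lambda>x. f x * h x)) = U p (\<lambda>q. f q * V q h + h q * V q f)"
      by (rule cU) (simp add: tv_mult[OF vf_tan[OF V]] f h)
    moreover have "V p (\<lambda>q. U q (\<lambda>x. f x * h x)) = V p (\<lambda>q. f q * U q h + h q * U q f)"
      by (rule cV) (simp add: tv_mult[OF vf_tan[OF U]] f h)
    ultimately show "U p (\<lambda>q. V q (\<lambda>x. f x * h x)) - V p (\<lambda>q. U q (\<lambda>x. f x * h x)) =
      f p * (U p (\<lambda>q. V q h) - V p (\<lambda>q. U q h)) + h p * (U p (\<lambda>q. V q f) - V p (\<lambda>q. U q f))"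
      by (simp add: tv_add[OF u] tv_add[OF v] tv_mult[OF u] tv_mult[OF v] sm f h algebra_simps)
  next
    fix f and c :: real assume f: "f \<in> smf N"
    have "U p (\<lambda>q. V q (\<lambda>x. c * f x)) = U p (\<lambda>q. c * V q f)"
      by (rule cU) (simp add: tv_cmult[OF vf_tan[OF V]] f)
    moreover have "V p (\<lambda>q. U q (\<lambda>x. c * f x)) = V p (\<lambda>q. c * U q f)"
      by (rule cV) (simp add: tv_cmult[OF vf_tan[OF U]] f)
    ultimately show "U p (\<lambda>q. V q (\<lambda>x. c * f x)) - V p (\<lambda>q. U q (\<lambda>x. c * f x)) =
      c * (U p (\<lambda>q. V q f) - V p (\<lambda>q. U q f))"
      by (simp add: tv_cmult[OF u] tv_cmult[OF v] sm algebra_simps)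
  next
    fix f assume f: "f \<notin> smf N"
    have "U p (\<lambda>q. V q f) = U p (\<lambda>q. 0)"
      by (rule cU) (simp add: tv_nonsmooth[OF vf_tan[OF V]] f)
    moreover have "V p (\<lambda>q. U q f) = V p (\<lambda>q. 0)"
      by (rule cV) (simp add: tv_nonsmooth[OF vf_tan[OF U]] f)
    ultimately show "U p (\<lambda>q. V q f) - V p (\<lambda>q. U q f) = 0"
      by (simp add: tv_const[OF u] tv_const[OF v])
  qed
next
  show "(\<lambda>p. lie_bracket U V p f) \<in> smf N" for f
    unfolding lie_bracket_def by (rule smf_diff[OF vf_smf[OF U] vf_smf[OF V]])
qed

lemma extension_field:
  assumes "VF V"
  shows "VF (extension N p (V p))" "extension N p (V p) p = V p"
  unfolding extension_def using someI[of "\<lambda>W. VF W \<and> W p = V p" V] assms by auto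

end

section \<open>Fields through given vectors and tensoriality\<close>

locale smooth_space = smooth_algebra +
  assumes frame: "p \<in> pts N \<Longrightarrow> \<exists>n x E G. local_frame N n x E G \<and> p \<in> G"
begin

lemma extension_exists:
  assumes p: "p \<in> pts N" and v: "v \<in> T p"
  obtains V where "VF V" "V p = v"
proof -
  obtain n x E G where F: "local_frame N n x E G" "p \<in> G" using frame[OF p] by blast
  show thesis
  proof (rule that)
    show "VF (\<lambda>q h. \<Sum>i\<in>{..<n}. v (x i) * E i q h)"
      using F by (intro vf_lincomb) (auto simp: local_frame_def smf_const)
    show "(\<lambda>h. \<Sum>i<n. v (x i) * E i p h) = v"
      using F v by (auto simp: local_frame_def)
  qed
qed

text \<open>The hypotheses say that \<open>\<Phi>\<close> is \<open>C\<^sup>\<infinity>\<close>-linear up to evaluation at \<open>p\<close>. The indicator function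
  of the complement of the space is smooth, which takes care of the junk values there.\<close>

lemma tensorial:
  assumes p: "p \<in> pts N"
    and add: "\<And>U V. VF U \<Longrightarrow> VF V \<Longrightarrow> \<Phi> (\<lambda>q h. U q h + V q h) = \<Phi> U + \<Phi> V"
    and scale: "\<And>a U. a \<in> smf N \<Longrightarrow> VF U \<Longrightarrow> \<Phi> (\<lambda>q h. a q * U q h) = a p * (\<Phi> U :: real)"
    and U: "VF U" and V: "VF V" and eq: "U p = V p"
  shows "\<Phi> U = \<Phi> V"
proof -
  have lincomb: "\<Phi> (\<lambda>q h. \<Sum>i\<in>I. a i q * E i q h) = (\<Sum>i\<in>I. a i p * \<Phi> (E i))"
    if "\<And>i. i \<in> I \<Longrightarrow> a i \<in> smf N \<and> VF (E i)" "finite I" for a E and I :: "nat set"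
    using that(2,1)
  proof (induction I)
    case empty
    have "\<Phi> (\<lambda>q h. 0 * U q h) = 0" using scale[OF smf_const U, of 0] by simp
    then show ?case by simp
  next
    case (insert i I)
    then show ?case by (simp add: add scale vf_scale vf_lincomb)
  qed
  have zero: "\<Phi> Z = 0" if Z: "VF Z" and Zp: "\<And>q. q \<in> pts N \<Longrightarrow> Z q = (\<lambda>h. 0)" for Z
  proof -
    define e where "e q = (if q \<in> pts N then 0 else 1 :: real)" for q
    have "e \<in> smf N" by (rule smf_cong[OF smf_const[of 0]]) (simp add: e_def)
    moreover have "(\<lambda>q h. e q * Z q h) = Z" using Zp by (auto simp: e_def fun_eq_iff)
    ultimately show ?thesis using scale[OF _ Z, of e] p by (simp add: e_def)
  qed
  define Z where "Z q h = U q h - V q h" for q h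
  have Z: "VF Z" unfolding Z_def by (rule vf_diff[OF U V])
  obtain n x E G where F: "local_frame N n x E G" "p \<in> G" using frame[OF p] by blast
  obtain \<eta> where \<eta>: "\<eta> \<in> smf N" "\<eta> p = 1" "\<And>q. q \<notin> G \<Longrightarrow> \<eta> q = 0"
    using bump[of G p] F by (auto simp: local_frame_def)
  \<comment> \<open>\<open>S\<close> is the frame expansion of \<eta> Z with globally smooth
    coefficients. It equals \<eta> Z on the whole space, since \<eta> vanishes off \<open>G\<close>,
    and its coefficients vanish at \<open>p\<close> because \<open>U p = V p\<close>.\<close>
  define S where "S q h = (\<Sum>i\<in>{..<n}. (\<eta> q * Z q (x i)) * E i q h)" for q h
  have c: "i \<in> {..<n} \<Longrightarrow> (\<lambda>q. \<eta> q * Z q (x i)) \<in> smf N \<and> VF (E i)" for i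
    using F \<eta> Z by (auto simp: local_frame_def intro: smf_mult vf_smf)
  have S: "VF S" unfolding S_def by (rule vf_lincomb) (rule c)
  define Y where "Y q h = \<eta> q * Z q h - S q h" for q h
  have "Y q = (\<lambda>h. 0)" if q: "q \<in> pts N" for q
  proof (cases "q \<in> G")
    case True
    have z: "Z q h = (\<Sum>i<n. Z q (x i) * E i q h)" for h
      using F(1) True vf_tan[OF Z q] unfolding local_frame_def by blast
    have "S q h = \<eta> q * (\<Sum>i<n. Z q (x i) * E i q h)" for h
      by (simp only: S_def sum_distrib_left mult.assoc)
    then have "S q h = \<eta> q * Z q h" for h
      by (simp only: z[of h, symmetric])
    then show ?thesis by (simp add: Y_def fun_eq_iff)
  next
    case False
    then show ?thesis by (simp add: Y_def S_def \<eta> fun_eq_iff)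
  qed
  moreover have Y: "VF Y" unfolding Y_def by (rule vf_diff[OF vf_scale[OF \<eta>(1) Z] S])
  ultimately have "\<Phi> Y = 0" by (intro zero)
  moreover have "\<Phi> S = 0"
    unfolding S_def by (subst lincomb[OF c]) (simp_all add: Z_def eq)
  moreover have "\<Phi> (\<lambda>q h. Y q h + S q h) = \<Phi> Y + \<Phi> S" by (rule add[OF Y S])
  moreover have "(\<lambda>q h. Y q h + S q h) = (\<lambda>q h. \<eta> q * Z q h)" by (simp add: Y_def)
  ultimately have "\<Phi> Z = 0" using scale[OF \<eta>(1) Z] \<eta>(2) by simp
  moreover have "(\<lambda>q h. Z q h + V q h) = U" by (simp add: Z_def)
  ultimately show ?thesis using add[OF Z V] by simp
qed

end

section \<open>Algebra of the metric\<close>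

locale metric_smooth_space = smooth_space +
  assumes met_lin: "\<lbrakk>p \<in> pts N; u \<in> tangent_space N p; v \<in> tangent_space N p; w \<in> tangent_space N p\<rbrakk> \<Longrightarrow>
      met N p (\<lambda>f. a * u f + b * v f) w = a * met N p u w + b * met N p v w"
    and met_sym: "\<lbrakk>p \<in> pts N; u \<in> tangent_space N p; v \<in> tangent_space N p\<rbrakk> \<Longrightarrow> met N p u v = met N p v u"
    and met_pos: "\<lbrakk>p \<in> pts N; v \<in> tangent_space N p; v \<noteq> (\<lambda>f. 0)\<rbrakk> \<Longrightarrow> met N p v v > 0"
begin

abbreviation g :: "'a \<Rightarrow> 'a tvec \<Rightarrow> 'a tvec \<Rightarrow> real" where "g \<equiv> met N"

context
  fixes p assumes p: "p \<in> pts N"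
begin

lemma met_add_left: "u \<in> T p \<Longrightarrow> v \<in> T p \<Longrightarrow> w \<in> T p \<Longrightarrow> g p (\<lambda>f. u f + v f) w = g p u w + g p v w"
  using met_lin[of p u v w 1 1] p by simp

lemma met_diff_left: "u \<in> T p \<Longrightarrow> v \<in> T p \<Longrightarrow> w \<in> T p \<Longrightarrow> g p (\<lambda>f. u f - v f) w = g p u w - g p v w"
  using met_lin[of p u v w 1 "- 1"] p by simp

lemma met_scale_left: "u \<in> T p \<Longrightarrow> w \<in> T p \<Longrightarrow> g p (\<lambda>f. a * u f) w = a * g p u w"
  using met_lin[of p u u w a 0] p by simp

lemma met_zero_left: "w \<in> T p \<Longrightarrow> g p (\<lambda>f. 0) w = 0"
  using met_scale_left[OF tv_zero, of w 0] by simp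

lemma met_add_right: "u \<in> T p \<Longrightarrow> v \<in> T p \<Longrightarrow> w \<in> T p \<Longrightarrow> g p w (\<lambda>f. u f + v f) = g p w u + g p w v"
  by (simp add: met_sym[OF p, of w] tv_plus met_add_left)

lemma met_diff_right: "u \<in> T p \<Longrightarrow> v \<in> T p \<Longrightarrow> w \<in> T p \<Longrightarrow> g p w (\<lambda>f. u f - v f) = g p w u - g p w v"
  by (simp add: met_sym[OF p, of w] tv_minus' met_diff_left)

lemma met_scale_right: "u \<in> T p \<Longrightarrow> w \<in> T p \<Longrightarrow> g p w (\<lambda>f. a * u f) = a * g p w u"
  by (simp add: met_sym[OF p, of w] tv_scale met_scale_left)

lemma met_zero_right: "w \<in> T p \<Longrightarrow> g p w (\<lambda>f. 0) = 0"
  by (simp add: met_sym[OF p, of w] tv_zero met_zero_left)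

lemma met_lincomb_left:
  assumes w: "w \<in> T p" and u: "\<And>i. i \<in> I \<Longrightarrow> u i \<in> T p"
  shows "g p (\<lambda>f. \<Sum>i\<in>I. c i * u i f) w = (\<Sum>i\<in>I. c i * g p (u i) w)"
  using u
  by (induction I rule: infinite_finite_induct)
    (auto simp: met_zero_left met_add_left met_scale_left w tv_scale tv_lincomb)

lemma met_nondegenerate:
  assumes "u \<in> T p" "v \<in> T p" "\<And>w. w \<in> T p \<Longrightarrow> g p u w = g p v w"
  shows "u = v"
proof -
  let ?d = "\<lambda>f. u f - v f"
  have d: "?d \<in> T p" using assms by (simp add: tv_minus')
  then have "g p ?d ?d = 0" using assms by (simp add: met_diff_left)
  then have "?d = (\<lambda>f. 0)" using met_pos[OF p d] by force
  then show ?thesis by (metis eq_iff_diff_eq_0 ext)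
qed

end

end

section \<open>Levi-Civita connections\<close>

locale levi_civita_space = metric_smooth_space +
  fixes D
  assumes lc: "levi_civita N D"
begin

lemma D_vf: "VF U \<Longrightarrow> VF V \<Longrightarrow> VF (D U V)"
  using lc by (simp add: levi_civita_def)

context
  fixes p assumes p: "p \<in> pts N"
begin

lemma D_tan: "VF U \<Longrightarrow> VF V \<Longrightarrow> D U V p \<in> T p"
  using D_vf vf_tan p by blast

lemma D_lin_left: "\<lbrakk>VF U; VF V; VF W; a \<in> smf N; b \<in> smf N\<rbrakk> \<Longrightarrow>
    D (\<lambda>q h. a q * U q h + b q * V q h) W p f = a p * D U W p f + b p * D V W p f"
  using lc p by (simp add: levi_civita_def)

lemma D_add_left: "\<lbrakk>VF U; VF V; VF W\<rbrakk> \<Longrightarrow> D (\<lambda>q h. U q h + V q h) W p f = D U W p f + D V W p f"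
  using D_lin_left[of U V W "\<lambda>q. 1" "\<lambda>q. 1" f] by (simp add: smf_const)

lemma D_scale_left: "\<lbrakk>VF U; VF W; a \<in> smf N\<rbrakk> \<Longrightarrow> D (\<lambda>q h. a q * U q h) W p f = a p * D U W p f"
  using D_lin_left[of U U W a "\<lambda>q. 0" f] by (simp add: smf_const)

lemma D_add_right: "\<lbrakk>VF U; VF V; VF W\<rbrakk> \<Longrightarrow> D U (\<lambda>q h. V q h + W q h) p f = D U V p f + D U W p f"
  using lc p by (simp add: levi_civita_def)

lemma D_scale_right: "\<lbrakk>VF U; VF V; a \<in> smf N\<rbrakk> \<Longrightarrow>
    D U (\<lambda>q h. a q * V q h) p f = U p a * V p f + a p * D U V p f"
  using lc p unfolding levi_civita_def by blast

lemma D_torsion: "VF U \<Longrightarrow> VF V \<Longrightarrow> lie_bracket U V p = (\<lambda>f. D U V p f - D V U p f)"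
  using lc p unfolding levi_civita_def by (intro ext) metis

lemma D_compat: "VF U \<Longrightarrow> VF V \<Longrightarrow> VF W \<Longrightarrow>
    U p (\<lambda>q. g q (V q) (W q)) = g p (D U V p) (W p) + g p (V p) (D U W p)"
  using lc p unfolding levi_civita_def by blast

lemma D_pointwise: "\<lbrakk>VF U; VF V; VF W; U p = V p\<rbrakk> \<Longrightarrow> D U W p = D V W p"
  by (rule ext, rule tensorial[OF p, where \<Phi> = "\<lambda>U. D U W p _"]) (simp_all add: D_add_left D_scale_left)

text \<open>\<open>D\<close> acts on total functions, so values off the space have to be argued
  away: the difference \<open>Z\<close> equals e Z with \<open>e\<close> the smooth indicator of the
  complement, and in the Leibniz rule at \<open>p\<close> every term has a factor \<open>Z p\<close>
  or \<open>e p\<close>.\<close>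

lemma D_cong_right:
  assumes U: "VF U" and V: "VF V" and W: "VF W" and eq: "\<And>q. q \<in> pts N \<Longrightarrow> V q = W q"
  shows "D U V p = D U W p"
proof
  fix f
  define e where "e q = (if q \<in> pts N then 0 else 1 :: real)" for q
  have e: "e \<in> smf N" by (rule smf_cong[OF smf_const[of 0]]) (simp add: e_def)
  define Z where "Z q h = V q h - W q h" for q h
  have Z: "VF Z" unfolding Z_def by (rule vf_diff[OF V W])
  have "(\<lambda>q h. e q * Z q h) = Z" using eq by (auto simp: e_def Z_def fun_eq_iff)
  then have "D U Z p f = 0"
    using D_scale_right[OF U Z e, of f] p eq by (simp add: e_def Z_def)
  moreover have "(\<lambda>q h. Z q h + W q h) = V" by (simp add: Z_def)
  ultimately show "D U V p f = D U W p f" using D_add_right[OF U Z W, of f] by simp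
qed

lemma koszul:
  assumes U: "VF U" and V: "VF V" and W: "VF W"
  shows "2 * g p (D U V p) (W p) =
    U p (\<lambda>q. g q (V q) (W q)) + V p (\<lambda>q. g q (W q) (U q)) - W p (\<lambda>q. g q (U q) (V q))
    + g p (lie_bracket U V p) (W p) - g p (lie_bracket U W p) (V p) - g p (lie_bracket V W p) (U p)"
  using assms vf_tan[OF _ p] D_tan
  by (simp add: D_compat D_torsion met_diff_left[OF p] met_sym[OF p])

lemma curvature_tan: "VF U \<Longrightarrow> VF V \<Longrightarrow> VF W \<Longrightarrow> curvature_field D U V W p \<in> T p"
  unfolding curvature_field_def by (intro tv_minus' D_tan D_vf vf_bracket)

end

section \<open>Tensoriality of the curvature and the weighted forms\<close>

lemma curvature_pointwise1:
  assumes p: "p \<in> pts N" and VW: "VF V" "VF W" and U: "VF U" "VF U'" "U p = U' p"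
  shows "curvature_field D U V W p = curvature_field D U' V W p"
proof (rule ext, rule tensorial[OF p _ _ U, where \<Phi> = "\<lambda>U. curvature_field D U V W p _"])
  note vf = D_vf vf_bracket vf_add vf_scale vf_smf[OF VW(1)] smf_minus VW
  fix f U U' assume U: "VF U" "VF U'"
  have 1: "D V (D (\<lambda>q h. U q h + U' q h) W) p f = D V (\<lambda>q h. D U W q h + D U' W q h) p f"
    by (rule fun_cong[OF D_cong_right[OF p]]) (simp_all add: D_add_left VW vf U fun_eq_iff)
  have 2: "D (lie_bracket (\<lambda>q h. U q h + U' q h) V) W p f
      = D (\<lambda>q h. lie_bracket U V q h + lie_bracket U' V q h) W p f"
  proof (rule fun_cong[OF D_pointwise[OF p]])
    show "lie_bracket (\<lambda>q h. U q h + U' q h) V p = (\<lambda>h. lie_bracket U V p h + lie_bracket U' V p h)"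
      by (simp add: lie_bracket_def fun_eq_iff tv_add[OF vf_tan[OF VW(1) p]] vf_smf U)
  qed (simp_all add: vf U)
  show "curvature_field D (\<lambda>q h. U q h + U' q h) V W p f =
    curvature_field D U V W p f + curvature_field D U' V W p f"
    unfolding curvature_field_def 1 2 using U by (simp add: D_add_left[OF p] D_add_right[OF p] vf)
next
  note vf = D_vf vf_bracket vf_add vf_scale vf_smf[OF VW(1)] smf_minus VW
  fix f U a assume U: "VF U" and a: "a \<in> smf N"
  have 1: "D V (D (\<lambda>q h. a q * U q h) W) p f = D V (\<lambda>q h. a q * D U W q h) p f"
    by (rule fun_cong[OF D_cong_right[OF p]]) (simp_all add: D_scale_left VW vf U a fun_eq_iff)
  \<comment> \<open>From [a U, V] = a [U, V] - V(a) U. The last term cancels the derivative of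
    \<open>a\<close> that comes out of D_V (a D_U W).\<close>
  have 2: "D (lie_bracket (\<lambda>q h. a q * U q h) V) W p f
      = D (\<lambda>q h. a q * lie_bracket U V q h + - V q a * U q h) W p f"
  proof (rule fun_cong[OF D_pointwise[OF p]])
    show "lie_bracket (\<lambda>q h. a q * U q h) V p = (\<lambda>h. a p * lie_bracket U V p h + - V p a * U p h)"
      using a by (simp add: lie_bracket_def fun_eq_iff tv_mult[OF vf_tan[OF VW(1) p]] vf_smf U algebra_simps)
  next
    show "VF (\<lambda>q h. a q * lie_bracket U V q h + - V q a * U q h)"
      by (rule vf_add[OF vf_scale[OF a vf_bracket[OF U VW(1)]] vf_scale[OF smf_minus[OF vf_smf[OF VW(1)]] U]])
  qed (simp_all add: vf U a)
  show "curvature_field D (\<lambda>q h. a q * U q h) V W p f = a p * curvature_field D U V W p f"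
    unfolding curvature_field_def 1 2
      D_lin_left[OF p vf_bracket[OF U VW(1)] U VW(2) a smf_minus[OF vf_smf[OF VW(1)]]]
    using U a by (simp add: D_scale_left[OF p] D_scale_right[OF p] vf algebra_simps)
qed

text \<open>Antisymmetry transfers pointwise dependence from the first argument to the
  second.\<close>

lemma curvature_field_swap:
  assumes p: "p \<in> pts N" and U: "VF U" and V: "VF V" and W: "VF W"
  shows "curvature_field D U V W p = (\<lambda>f. - curvature_field D V U W p f)"
proof
  fix f
  have "VF (\<lambda>q h. - 1 * lie_bracket V U q h)"
    by (rule vf_scale[OF smf_const vf_bracket[OF V U]])
  then have "D (lie_bracket U V) W p f = D (\<lambda>q h. - 1 * lie_bracket V U q h) W p f"
    by (rule fun_cong[OF D_pointwise[OF p vf_bracket[OF U V] _ W]]) (simp add: lie_bracket_def)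
  then show "curvature_field D U V W p f = - curvature_field D V U W p f"
    using D_scale_left[OF p vf_bracket[OF V U] W smf_const, of "- 1" f] by (simp add: curvature_field_def)
qed

lemma curvature_pointwise3:
  assumes p: "p \<in> pts N" and UV: "VF U" "VF V" and W: "VF W" "VF W'" "W p = W' p"
  shows "curvature_field D U V W p = curvature_field D U V W' p"
proof (rule ext, rule tensorial[OF p _ _ W, where \<Phi> = "\<lambda>W. curvature_field D U V W p _"])
  note vf = D_vf vf_bracket vf_add vf_scale vf_smf[OF UV(1)] vf_smf[OF UV(2)] smf_minus UV
  fix f W W' assume W: "VF W" "VF W'"
  have 1: "D U (D V (\<lambda>q h. W q h + W' q h)) p f = D U (\<lambda>q h. D V W q h + D V W' q h) p f" if "VF U" "VF V" for U V
    by (rule fun_cong[OF D_cong_right[OF p]]) (simp_all add: D_add_right vf W that fun_eq_iff)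
  show "curvature_field D U V (\<lambda>q h. W q h + W' q h) p f =
    curvature_field D U V W p f + curvature_field D U V W' p f"
    unfolding curvature_field_def using UV W by (simp add: 1 D_add_right[OF p] vf)
next
  note vf = D_vf vf_bracket vf_add vf_scale vf_smf[OF UV(1)] vf_smf[OF UV(2)] smf_minus UV
  fix f W a assume W: "VF W" and a: "a \<in> smf N"
  \<comment> \<open>The second-order Leibniz rule. On antisymmetrising in \<open>U\<close> and
    \<open>V\<close> the mixed first-order terms cancel, and U(V a) - V(U a) is absorbed by the
    bracket term.\<close>
  have 1: "D U (D V (\<lambda>q h. a q * W q h)) p f =
      U p (\<lambda>q. V q a) * W p f + V p a * D U W p f + (U p a * D V W p f + a p * D U (D V W) p f)"
    if "VF U" "VF V" for U V
  proof -
    have "D U (D V (\<lambda>q h. a q * W q h)) p f = D U (\<lambda>q h. V q a * W q h + a q * D V W q h) p f"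
      by (rule fun_cong[OF D_cong_right[OF p]]) (simp_all add: fun_eq_iff D_scale_right vf vf_smf[OF that(1)] vf_smf[OF that(2)] W a that)
    then show ?thesis by (simp add: D_add_right[OF p] D_scale_right[OF p] vf vf_smf[OF that(1)] vf_smf[OF that(2)] W a that)
  qed
  show "curvature_field D U V (\<lambda>q h. a q * W q h) p f = a p * curvature_field D U V W p f"
    unfolding curvature_field_def D_scale_right[OF p vf_bracket[OF UV] W a]
    by (simp add: 1 UV lie_bracket_def[THEN fun_cong, THEN fun_cong] algebra_simps)
qed

lemma curvature_pointwise2:
  assumes p: "p \<in> pts N" and UW: "VF U" "VF W" and V: "VF V" "VF V'" "V p = V' p"
  shows "curvature_field D U V W p = curvature_field D U V' W p"
  using curvature_field_swap[OF p UW(1) _ UW(2)] curvature_pointwise1[OF p UW V] V by simp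

text \<open>Trading the extensions chosen by \<open>SOME\<close> for fields at hand, one argument at
  a time, allows curvature to be computed on vertical or basic fields.\<close>

lemma curvature_eq:
  assumes p: "p \<in> pts N" and "VF U" "VF V" "VF W"
  shows "curvature N D p (U p) (V p) (W p) = curvature_field D U V W p"
proof -
  let ?E = "\<lambda>V. extension N p (V p)"
  note E = extension_field[of _ p]
  have "curvature_field D (?E U) (?E V) (?E W) p = curvature_field D U (?E V) (?E W) p"
    by (rule curvature_pointwise1[OF p]) (simp_all add: E assms)
  also have "\<dots> = curvature_field D U V (?E W) p"
    by (rule curvature_pointwise2[OF p]) (simp_all add: E assms)
  also have "\<dots> = curvature_field D U V W p"
    by (rule curvature_pointwise3[OF p]) (simp_all add: E assms)
  finally show ?thesis by (simp only: curvature_def)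
qed

text \<open>In X g(E,E) - 2 g([X,E],E) the derivatives D_X E cancel by compatibility and
  torsion-freeness, leaving D_E X.\<close>

lemma lie_metric_eq:
  assumes p: "p \<in> pts N" and X: "VF X" and V: "VF V"
  shows "lie_metric N X p (V p) (V p) = 2 * g p (D V X p) (V p)"
proof -
  define E where "E = extension N p (V p)"
  have E: "VF E" and Ep: "E p = V p" unfolding E_def using extension_field[OF V] by blast+
  have "D E X p = D V X p" by (rule D_pointwise[OF p E V X Ep])
  then show ?thesis
    unfolding lie_metric_def Let_def E_def[symmetric]
    using vf_tan[OF E p] vf_tan[OF V p] D_tan[OF p] E V X Ep
    by (simp add: D_compat[OF p] D_torsion[OF p] met_diff_left[OF p] met_diff_right[OF p] met_sym[OF p])
qed

lemma wcurv_form_eq: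
  assumes p: "p \<in> pts N" and X: "VF X" and U: "VF U" and V: "VF V"
  shows "wcurv_form N D X p (V p) (U p) (U p) =
    g p (curvature_field D U V V p) (U p) + g p (D V X p) (V p) * g p (U p) (U p)"
  unfolding wcurv_form_def wdir_curv_def dir_curv_def
  using curvature_tan[OF p U V V] vf_tan[OF U p]
  by (simp add: curvature_eq[OF p] lie_metric_eq[OF p] U V X met_add_left[OF p] met_scale_left[OF p] tv_scale)

lemma swcurv_form_eq:
  assumes p: "p \<in> pts N" and X: "VF X" and U: "VF U" and V: "VF V"
  shows "swcurv_form N D X p (V p) (U p) (U p) =
    wcurv_form N D X p (V p) (U p) (U p) + (g p (X p) (V p))\<^sup>2 * g p (U p) (U p)"
proof -
  have "wdir_curv N D X p (V p) (U p) \<in> T p"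
    unfolding wdir_curv_def dir_curv_def curvature_eq[OF p U V V]
    by (rule tv_plus[OF curvature_tan[OF p U V V] tv_scale[OF vf_tan[OF U p]]])
  then show ?thesis
    unfolding swcurv_form_def swdir_curv_def wcurv_form_def
    using vf_tan[OF U p] by (simp add: met_add_left[OF p] met_scale_left[OF p] tv_scale)
qed

end

section \<open>Charts\<close>

text \<open>The model is a subspace, so an orthonormal basis \<open>e\<close> of it is fixed as a
  parameter and coordinates are inner products with it; a 0-dimensional manifold is the case
  \<open>n = 0\<close>.\<close>

locale mfd =
  fixes M :: "('a, 'm::euclidean_space) rmanifold" and e :: "nat \<Rightarrow> 'm" and n :: nat
  assumes smooth_mfd: "smooth_manifold M"
    and e_orth: "i < n \<Longrightarrow> j < n \<Longrightarrow> e i \<bullet> e j = (if i = j then 1 else 0)"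
    and e_span: "span (e ` {..<n}) = model M"

lemma mfd_exists:
  assumes "smooth_manifold M"
  obtains e n where "mfd M e n"
proof -
  have "subspace (model M)" using assms by (simp add: smooth_manifold_def)
  then obtain B where B: "B \<subseteq> model M" "pairwise orthogonal B"
    "\<And>x. x \<in> B \<Longrightarrow> norm x = 1" "independent B" "card B = dim (model M)" "span B = model M"
    by (rule orthonormal_basis_subspace) blast
  obtain e where e: "bij_betw e {0..<card B} B"
    using ex_bij_betw_nat_finite[OF independent_imp_finite[OF B(4)]] by blast
  have "mfd M e (card B)"
  proof
    show "span (e ` {..<card B}) = model M"
      using e B(6) by (simp add: bij_betw_def atLeast0LessThan)
    fix i j assume ij: "i < card B" "j < card B"
    then have m: "e i \<in> B" "e j \<in> B" using e by (auto simp: bij_betw_def)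
    show "e i \<bullet> e j = (if i = j then 1 else 0)"
    proof (cases "i = j")
      case True
      then show ?thesis using B(3)[OF m(1)] by (simp add: norm_eq_1)
    next
      case False
      then have "e i \<noteq> e j" using e ij by (auto simp: bij_betw_def inj_on_def)
      then show ?thesis using B(2) m \<open>e i \<noteq> e j\<close> False by (simp add: pairwise_def orthogonal_def)
    qed
  qed fact
  then show thesis by (rule that)
qed

context mfd begin

abbreviation ch :: "'a set \<Rightarrow> ('a \<Rightarrow> 'm) \<Rightarrow> bool" where "ch U \<phi> \<equiv> (U, \<phi>) \<in> atlas M"

definition P :: "'m \<Rightarrow> 'm" where "P x = (\<Sum>i<n. (x \<bullet> e i) *\<^sub>R e i)"

text \<open>The chart expression of \<open>f\<close>, extended constantly along the orthogonal
  complement of the model. It lives on an open subset of the full Euclidean space, where Frechet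
  derivatives make sense.\<close>

definition rep :: "'a set \<Rightarrow> ('a \<Rightarrow> 'm) \<Rightarrow> ('a \<Rightarrow> 'k) \<Rightarrow> 'm \<Rightarrow> 'k" where
  "rep U \<phi> f x = f (inv_into U \<phi> (P x))"

lemma linear_P: "linear P"
  by (rule linearI) (simp_all add: P_def inner_add_left scaleR_add_left sum.distrib scaleR_sum_right)

lemma bounded_linear_P: "bounded_linear P"
  using linear_P by (simp add: linear_conv_bounded_linear)

lemma e_in_model: "i < n \<Longrightarrow> e i \<in> model M"
  using e_span span_base[of "e i" "e ` {..<n}"] by simp

lemma subspace_model: "subspace (model M)"
  using e_span subspace_span by metis

lemma P_in_model: "P x \<in> model M"
  unfolding P_def by (intro subspace_sum subspace_scale subspace_model) (simp add: e_in_model)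

lemma P_inner: "j < n \<Longrightarrow> P x \<bullet> e j = x \<bullet> e j"
  by (simp add: P_def inner_sum_left e_orth if_distrib sum.delta cong: if_cong)

lemma P_id:
  assumes "x \<in> model M"
  shows "P x = x"
proof -
  have "x \<in> span (e ` {..<n})" using assms e_span by simp
  moreover have "subspace {x. P x = x}"
    unfolding subspace_def by (auto simp: linear_0[OF linear_P] linear_add[OF linear_P] linear_scale[OF linear_P])
  moreover have "P (e j) = e j" if "j < n" for j
    using that by (simp add: P_def e_orth if_distrib[of "\<lambda>c. c *\<^sub>R _"] sum.delta cong: if_cong)
  ultimately show ?thesis
    using span_minimal[of "e ` {..<n}" "{x. P x = x}"] by blast
qed

lemma Cinf_on_P: "Cinf_on P S"
  by (rule Cinf_on_linear[OF bounded_linear_P])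

lemma open_P_vimage:
  assumes "openin (top_of_set (model M)) W"
  shows "open {x. P x \<in> W}"
proof -
  obtain O' where O': "open O'" "W = model M \<inter> O'" using assms by (auto simp: openin_open)
  have "{x. P x \<in> W} = P -` O'" using O' P_in_model by auto
  then show ?thesis
    using O'(1) linear_continuous_on[OF bounded_linear_P] by (simp add: open_vimage)
qed

text \<open>Composition with the projection \<open>P\<close> is one canonical extension, and it
  inherits smoothness from any local one. It replaces the extensions chosen point by point in
  \<open>smooth_on\<close>.\<close>

lemma smooth_on_iff:
  assumes W: "openin (top_of_set (model M)) W"
  shows "smooth_on W f \<longleftrightarrow> Cinf_on (\<lambda>x. f (P x)) {x. P x \<in> W}"
proof
  assume f: "smooth_on W f"
  show "Cinf_on (\<lambda>x. f (P x)) {x. P x \<in> W}"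
  proof (rule Cinf_on_local)
    fix x assume x: "x \<in> {x. P x \<in> W}"
    then obtain G F where G: "open G" "P x \<in> G" "\<forall>k. Ck_on k F G" "\<forall>y\<in>G \<inter> W. F y = f y"
      using f unfolding smooth_on_def by blast
    have o: "open (P -` G)"
      using G(1) linear_continuous_on[OF bounded_linear_P] by (simp add: open_vimage)
    have "Cinf_on (\<lambda>x. F (P x)) (P -` G)"
      by (rule Cinf_on_compose[OF o G(1) _ Cinf_on_P]) (use G(3) in \<open>auto simp: Cinf_on_def\<close>)
    then have "Cinf_on (\<lambda>x. F (P x)) (P -` G \<inter> {x. P x \<in> W})"
      by (rule Cinf_on_subset) simp
    then have "Cinf_on (\<lambda>x. f (P x)) (P -` G \<inter> {x. P x \<in> W})"
      using G(4) by (subst Cinf_on_cong[of _ _ "\<lambda>x. F (P x)"]) (auto intro: open_Int o open_P_vimage[OF W])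
    then show "\<exists>T. open T \<and> x \<in> T \<and> Cinf_on (\<lambda>x. f (P x)) T"
      using x G(2) o open_P_vimage[OF W] by (intro exI[of _ "P -` G \<inter> {x. P x \<in> W}"]) auto
  qed
next
  assume f: "Cinf_on (\<lambda>x. f (P x)) {x. P x \<in> W}"
  have "W \<subseteq> model M" using W by (auto simp: openin_open)
  then have "\<forall>x\<in>W. P x = x" using P_id by blast
  then show "smooth_on W f"
    unfolding smooth_on_def using f open_P_vimage[OF W]
    by (intro ballI exI[of _ "{x. P x \<in> W}"] exI[of _ "\<lambda>x. f (P x)"]) (auto simp: Cinf_on_def)
qed

lemma atlasD:
  assumes "ch U \<phi>"
  shows chart_open: "openin (rtop M) U"
    and chart_image: "openin (top_of_set (model M)) (\<phi> ` U)"
    and chart_homeo: "homeomorphic_map (subtopology (rtop M) U) (top_of_set (\<phi> ` U)) \<phi>"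
    and transition: "ch V \<psi> \<Longrightarrow> smooth_on (\<phi> ` (U \<inter> V)) (\<psi> \<circ> inv_into U \<phi>)"
  using smooth_mfd assms unfolding smooth_manifold_def by blast+

lemma Hausdorff: "Hausdorff_space (rtop M)"
  and smf_eq: "smf M = {f. \<forall>(U, \<phi>)\<in>atlas M. smooth_on (\<phi> ` U) (f \<circ> inv_into U \<phi>)}"
  using smooth_mfd by (simp_all add: smooth_manifold_def)

lemma chart_at: "p \<in> pts M \<Longrightarrow> \<exists>U \<phi>. ch U \<phi> \<and> p \<in> U"
  using smooth_mfd unfolding smooth_manifold_def by force

lemma chart_subset: "ch U \<phi> \<Longrightarrow> U \<subseteq> pts M"
  using chart_open openin_subset by blast

lemma chart_inj: "ch U \<phi> \<Longrightarrow> inj_on \<phi> U"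
  using homeomorphic_imp_injective_map[OF chart_homeo] chart_subset by (simp add: Int_absorb1)

lemma inv_chart: "ch U \<phi> \<Longrightarrow> q \<in> U \<Longrightarrow> inv_into U \<phi> (\<phi> q) = q"
  by (simp add: chart_inj)

lemma chart_in_model: "ch U \<phi> \<Longrightarrow> q \<in> U \<Longrightarrow> \<phi> q \<in> model M"
  using chart_image by (auto simp: openin_open)

lemma P_chart: "ch U \<phi> \<Longrightarrow> q \<in> U \<Longrightarrow> P (\<phi> q) = \<phi> q"
  using chart_in_model P_id by blast

lemma rep_chart: "ch U \<phi> \<Longrightarrow> q \<in> U \<Longrightarrow> rep U \<phi> f (\<phi> q) = f q"
  by (simp add: rep_def P_chart inv_chart)

lemma chart_image_open:
  assumes c: "ch U \<phi>" and G: "openin (rtop M) G"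
  shows "openin (top_of_set (model M)) (\<phi> ` (U \<inter> G))"
proof -
  have "openin (subtopology (rtop M) U) (U \<inter> G)"
    using G by (simp add: openin_subtopology_Int2)
  then have "openin (top_of_set (\<phi> ` U)) (\<phi> ` (U \<inter> G))"
    using homeomorphic_imp_open_map[OF chart_homeo[OF c]] by (simp add: open_map_def)
  then show ?thesis using chart_image[OF c] openin_trans by blast
qed

lemma open_chart_dom:
  assumes "ch U \<phi>" "openin (rtop M) G"
  shows "open {x. P x \<in> \<phi> ` (U \<inter> G)}"
  by (rule open_P_vimage[OF chart_image_open[OF assms]])

lemma open_dom: "ch U \<phi> \<Longrightarrow> open {x. P x \<in> \<phi> ` U}"
  by (rule open_P_vimage[OF chart_image])

lemma chart_vimage_open:
  assumes c: "ch U \<phi>" and O': "open O'"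
  shows "openin (rtop M) {q \<in> U. \<phi> q \<in> O'}"
proof -
  have "continuous_map (subtopology (rtop M) U) (top_of_set (\<phi> ` U)) \<phi>"
    using homeomorphic_imp_continuous_map[OF chart_homeo[OF c]] .
  moreover have "openin (top_of_set (\<phi> ` U)) (\<phi> ` U \<inter> O')" using O' by blast
  ultimately have "openin (subtopology (rtop M) U) {q \<in> topspace (subtopology (rtop M) U). \<phi> q \<in> \<phi> ` U \<inter> O'}"
    by (rule openin_continuous_map_preimage)
  moreover have "{q \<in> topspace (subtopology (rtop M) U). \<phi> q \<in> \<phi> ` U \<inter> O'} = {q \<in> U. \<phi> q \<in> O'}"
    using chart_subset[OF c] by auto
  ultimately show ?thesis
    using openin_open_subtopology[OF chart_open[OF c]] by simp
qed

section \<open>Smooth functions and cut-offs in charts\<close>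

lemma smf_iff: "f \<in> smf M \<longleftrightarrow> (\<forall>U \<phi>. ch U \<phi> \<longrightarrow> Cinf_on (rep U \<phi> f) {x. P x \<in> \<phi> ` U})"
proof -
  have "smooth_on (\<phi> ` U) (f \<circ> inv_into U \<phi>) \<longleftrightarrow> Cinf_on (rep U \<phi> f) {x. P x \<in> \<phi> ` U}" if "ch U \<phi>" for U \<phi>
    by (simp add: smooth_on_iff[OF chart_image[OF that]] rep_def[abs_def])
  then show ?thesis by (auto simp: smf_eq)
qed

lemma Cinf_on_rep: "f \<in> smf M \<Longrightarrow> ch U \<phi> \<Longrightarrow> Cinf_on (rep U \<phi> f) {x. P x \<in> \<phi> ` U}"
  by (simp add: smf_iff)

text \<open>One chart around each point is enough: in another chart the expression of
  \<open>f\<close> gets composed with a transition map, which is smooth.\<close>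

lemma smfI:
  assumes f: "\<And>p. p \<in> pts M \<Longrightarrow> \<exists>U \<phi> O'. ch U \<phi> \<and> p \<in> U \<and> open O' \<and> \<phi> p \<in> O' \<and>
      O' \<subseteq> {x. P x \<in> \<phi> ` U} \<and> Cinf_on (rep U \<phi> f) O'"
  shows "f \<in> smf M"
  unfolding smf_iff
proof (intro allI impI, rule Cinf_on_local)
  fix V \<psi> x assume c: "ch V \<psi>" and x: "x \<in> {x. P x \<in> \<psi> ` V}"
  define p where "p = inv_into V \<psi> (P x)"
  have p: "p \<in> V" "\<psi> p = P x" using x by (auto simp: p_def inv_into_into f_inv_into_f)
  then have "p \<in> pts M" using chart_subset[OF c] by blast
  from f[OF this] obtain U \<phi> O' where U: "ch U \<phi>" "p \<in> U" "open O'" "\<phi> p \<in> O'"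
    "O' \<subseteq> {x. P x \<in> \<phi> ` U}" "Cinf_on (rep U \<phi> f) O'" by metis
  define W where "W = {x. P x \<in> \<psi> ` (V \<inter> U)}"
  define \<tau> where "\<tau> x = \<phi> (inv_into V \<psi> (P x))" for x
  have oW: "open W" unfolding W_def by (rule open_chart_dom[OF c chart_open[OF U(1)]])
  have t: "Cinf_on \<tau> W"
    using transition[OF c U(1)]
    by (simp add: smooth_on_iff[OF chart_image_open[OF c chart_open[OF U(1)]]] \<tau>_def[abs_def] W_def)
  define A where "A = W \<inter> \<tau> -` O'"
  have oA: "open A" unfolding A_def
    by (rule continuous_open_preimage[OF Cinf_on_continuous[OF t] oW U(3)])
  have "Cinf_on (\<lambda>x. rep U \<phi> f (\<tau> x)) A"
    by (rule Cinf_on_compose[OF oA U(3) _ Cinf_on_subset[OF t] U(6)]) (auto simp: A_def)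
  moreover have "rep U \<phi> f (\<tau> y) = rep V \<psi> f y" if "y \<in> A" for y
  proof -
    have "P y \<in> \<psi> ` (V \<inter> U)" using that by (simp add: A_def W_def)
    then obtain q where q: "q \<in> V" "q \<in> U" "P y = \<psi> q" by blast
    then have "\<tau> y = \<phi> q" using c by (simp add: \<tau>_def inv_chart)
    then show ?thesis using q c by (simp add: rep_chart[OF U(1)]) (simp add: rep_def inv_chart)
  qed
  ultimately have "Cinf_on (rep V \<psi> f) A"
    using Cinf_on_cong[OF oA] by metis
  moreover have "x \<in> A"
    using p U by (auto simp: A_def W_def \<tau>_def p(2)[symmetric] inv_chart[OF c])
  ultimately show "\<exists>T. open T \<and> x \<in> T \<and> Cinf_on (rep V \<psi> f) T"
    using oA by blast
qed

text \<open>The last property is the purpose: a function smooth only in the chart over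
  \<open>U \<inter> G\<close> becomes a global element of \<open>smf M\<close>, unchanged near
  \<open>p\<close>. Coordinate functions and coordinate fields are globalised in this way.\<close>

lemma cutoff:
  assumes c: "ch U \<phi>" and p: "p \<in> U" and G: "openin (rtop M) G" "p \<in> G"
  obtains \<eta> H where "\<eta> \<in> smf M" "openin (rtop M) H" "p \<in> H" "H \<subseteq> U \<inter> G" "\<And>q. q \<in> H \<Longrightarrow> \<eta> q = 1"
    "\<And>q. q \<notin> U \<inter> G \<Longrightarrow> \<eta> q = 0"
    "\<And>k. Cinf_on (rep U \<phi> k) {x. P x \<in> \<phi> ` (U \<inter> G)} \<Longrightarrow> (\<lambda>q. \<eta> q * k q) \<in> smf M"
proof -
  have "\<phi> p \<in> \<phi> ` (U \<inter> G)" using p G by blast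
  then obtain r where r: "r > 0" "cball (\<phi> p) r \<inter> model M \<subseteq> \<phi> ` (U \<inter> G)"
    using chart_image_open[OF c G(1)] by (meson openin_contains_cball)
  obtain \<beta> :: "'m \<Rightarrow> real" where \<beta>: "Cinf_on \<beta> UNIV" "\<And>x. x \<in> ball (\<phi> p) (r / 2) \<Longrightarrow> \<beta> x = 1" "\<And>x. x \<notin> ball (\<phi> p) r \<Longrightarrow> \<beta> x = 0"
    using smooth_bump[OF r(1), of "\<phi> p"] by blast
  define \<eta> where "\<eta> q = (if q \<in> U then \<beta> (\<phi> q) else 0)" for q
  define K where "K = {q \<in> U. \<phi> q \<in> cball (\<phi> p) r}"
  have KG: "K \<subseteq> U \<inter> G"
  proof
    fix q assume q: "q \<in> K"
    then have "\<phi> q \<in> \<phi> ` (U \<inter> G)" using r(2) chart_in_model[OF c] by (auto simp: K_def)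
    then obtain q' where "\<phi> q = \<phi> q'" "q' \<in> U \<inter> G" by blast
    then show "q \<in> U \<inter> G" using q chart_inj[OF c] by (auto simp: K_def inj_on_def)
  qed
  have \<eta>K: "\<eta> q = 0" if "q \<notin> K" for q
    using that \<beta>(3)[of "\<phi> q"] by (auto simp: \<eta>_def K_def)
  \<comment> \<open>\<open>K\<close> corresponds to a compact ball of the model, hence is compact,
    and closed because the space is Hausdorff. Points outside \<open>U \<inter> G\<close> then have
    an open neighbourhood where \<eta> vanishes, which makes extension by zero smooth.\<close>
  have closedK: "closedin (rtop M) K"
  proof -
    obtain h where h: "homeomorphic_maps (subtopology (rtop M) U) (top_of_set (\<phi> ` U)) \<phi> h"
      using chart_homeo[OF c] homeomorphic_map_maps by blast
    have "compactin (top_of_set (\<phi> ` U)) (cball (\<phi> p) r \<inter> model M)"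
      using r(2) by (auto simp: compactin_subtopology compact_Int_closed closed_subspace[OF subspace_model])
    then have "compactin (subtopology (rtop M) U) (h ` (cball (\<phi> p) r \<inter> model M))"
      using h image_compactin unfolding homeomorphic_maps_def by blast
    moreover have "h ` (cball (\<phi> p) r \<inter> model M) = K"
    proof -
      have hU: "h (\<phi> q) = q" if "q \<in> U" for q
        using h that chart_subset[OF c] by (auto simp: homeomorphic_maps_def)
      show ?thesis
      proof (intro equalityI subsetI)
        fix q assume "q \<in> h ` (cball (\<phi> p) r \<inter> model M)"
        then obtain x where x: "x \<in> cball (\<phi> p) r" "x \<in> model M" "q = h x" by blast
        then obtain q' where "x = \<phi> q'" "q' \<in> U" using r(2) by blast
        then show "q \<in> K" using x hU by (simp add: K_def)
      next
        fix q assume q: "q \<in> K"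
        then have "q = h (\<phi> q)" "\<phi> q \<in> cball (\<phi> p) r \<inter> model M"
          using hU chart_in_model[OF c] by (auto simp: K_def)
        then show "q \<in> h ` (cball (\<phi> p) r \<inter> model M)" by blast
      qed
    qed
    ultimately have "compactin (rtop M) K" by (simp add: compactin_subtopology)
    then show ?thesis using Hausdorff compactin_imp_closedin by blast
  qed
  have main: "(\<lambda>q. \<eta> q * k q) \<in> smf M"
    if k: "Cinf_on (rep U \<phi> k) {x. P x \<in> \<phi> ` (U \<inter> G)}" for k
  proof (rule smfI)
    fix p' assume p': "p' \<in> pts M"
    show "\<exists>U \<phi> O'. ch U \<phi> \<and> p' \<in> U \<and> open O' \<and> \<phi> p' \<in> O' \<and> O' \<subseteq> {x. P x \<in> \<phi> ` U} \<and>
      Cinf_on (rep U \<phi> (\<lambda>q. \<eta> q * k q)) O'"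
    proof (cases "p' \<in> U \<inter> G")
      case True
      let ?O = "{x. P x \<in> \<phi> ` (U \<inter> G)}"
      have o: "open ?O" by (rule open_chart_dom[OF c G(1)])
      have "Cinf_on (\<lambda>x. \<beta> (P x)) ?O"
        by (rule Cinf_on_compose[OF o open_UNIV _ Cinf_on_P \<beta>(1)]) simp
      then have "Cinf_on (\<lambda>x. \<beta> (P x) * rep U \<phi> k x) ?O"
        by (rule Cinf_on_mult[OF o _ k])
      then have "Cinf_on (rep U \<phi> (\<lambda>q. \<eta> q * k q)) ?O"
        by (subst Cinf_on_cong[OF o]) (auto simp: rep_def inv_chart[OF c] \<eta>_def)
      then show ?thesis
        using True c o by (intro exI[of _ U] exI[of _ \<phi>] exI[of _ ?O]) (auto simp: P_chart)
    next
      case False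
      then have p'': "p' \<in> pts M - K" using KG p' by blast
      have oK: "openin (rtop M) (pts M - K)" using closedK by blast
      obtain V \<psi> where V: "ch V \<psi>" "p' \<in> V" using chart_at[OF p'] by blast
      let ?O = "{x. P x \<in> \<psi> ` (V \<inter> (pts M - K))}"
      have o: "open ?O" by (rule open_chart_dom[OF V(1) oK])
      have "Cinf_on (rep V \<psi> (\<lambda>q. \<eta> q * k q)) ?O"
        by (subst Cinf_on_cong[OF o, of _ "\<lambda>x. 0"]) (auto simp: rep_def inv_chart[OF V(1)] \<eta>K)
      then show ?thesis
        using p'' V o by (intro exI[of _ V] exI[of _ \<psi>] exI[of _ ?O]) (auto simp: P_chart)
    qed
  qed
  have \<eta>_smf: "\<eta> \<in> smf M" using main[of "\<lambda>q. 1"] by (simp add: rep_def[abs_def])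
  define H where "H = {q \<in> U. \<phi> q \<in> ball (\<phi> p) (r / 2)}"
  show thesis
  proof (rule that[OF \<eta>_smf _ _ _ _ _ main])
    show "openin (rtop M) H" unfolding H_def by (rule chart_vimage_open[OF c open_ball])
    show "p \<in> H" using p r by (simp add: H_def)
    have "H \<subseteq> K" using r(1) by (auto simp: H_def K_def)
    then show "H \<subseteq> U \<inter> G" using KG by blast
    show "q \<in> H \<Longrightarrow> \<eta> q = 1" for q using \<beta>(2) by (simp add: H_def \<eta>_def)
    show "q \<notin> U \<inter> G \<Longrightarrow> \<eta> q = 0" for q using KG \<eta>K by blast
  qed
qed

sublocale smooth_algebra M
proof
  show "(\<lambda>x. c) \<in> smf M" for c by (simp add: smf_iff rep_def[abs_def])
  show "(\<lambda>x. f x + h x) \<in> smf M" if "f \<in> smf M" "h \<in> smf M" for f h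
    using that by (auto simp: smf_iff rep_def[abs_def] intro: Cinf_on_add[OF open_dom])
  show "(\<lambda>x. f x * h x) \<in> smf M" if "f \<in> smf M" "h \<in> smf M" for f h
    using that by (auto simp: smf_iff rep_def[abs_def] intro: Cinf_on_mult[OF open_dom])
  show "f \<in> smf M"
    if f: "\<And>p. p \<in> pts M \<Longrightarrow> \<exists>G h. openin (rtop M) G \<and> p \<in> G \<and> h \<in> smf M \<and> (\<forall>q\<in>G. f q = h q)" for f
  proof (rule smfI)
    fix p assume p: "p \<in> pts M"
    obtain G h where G: "openin (rtop M) G" "p \<in> G" "h \<in> smf M" "\<forall>q\<in>G. f q = h q" using f[OF p] by blast
    obtain U \<phi> where U: "ch U \<phi>" "p \<in> U" using chart_at[OF p] by blast
    let ?O = "{x. P x \<in> \<phi> ` (U \<inter> G)}"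
    have o: "open ?O" by (rule open_chart_dom[OF U(1) G(1)])
    have "Cinf_on (rep U \<phi> h) ?O"
      by (rule Cinf_on_subset[OF Cinf_on_rep[OF G(3) U(1)]]) auto
    then have "Cinf_on (rep U \<phi> f) ?O"
      by (subst Cinf_on_cong[OF o, of _ "rep U \<phi> h"]) (use G(4) in \<open>auto simp: rep_def inv_chart[OF U(1)]\<close>)
    then show "\<exists>U \<phi> O'. ch U \<phi> \<and> p \<in> U \<and> open O' \<and> \<phi> p \<in> O' \<and> O' \<subseteq> {x. P x \<in> \<phi> ` U} \<and> Cinf_on (rep U \<phi> f) O'"
      using U G(2) o by (intro exI[of _ U] exI[of _ \<phi>] exI[of _ ?O]) (auto simp: P_chart)
  qed
  show "\<exists>\<eta>\<in>smf M. \<exists>H. openin (rtop M) H \<and> p \<in> H \<and> H \<subseteq> G \<and> (\<forall>q\<in>H. \<eta> q = 1) \<and> (\<forall>q. q \<notin> G \<longrightarrow> \<eta> q = 0)"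
    if G: "openin (rtop M) G" "p \<in> G" for G p
  proof -
    obtain U \<phi> where U: "ch U \<phi>" "p \<in> U" using chart_at openin_subset[OF G(1)] G(2) by blast
    obtain \<eta> H where "\<eta> \<in> smf M" "openin (rtop M) H" "p \<in> H" "H \<subseteq> U \<inter> G"
      "\<And>q. q \<in> H \<Longrightarrow> \<eta> q = 1" "\<And>q. q \<notin> U \<inter> G \<Longrightarrow> \<eta> q = 0" by (rule cutoff[OF U G]) blast
    then show ?thesis by (intro bexI[of _ \<eta>] exI[of _ H]) auto
  qed
qed

end

section \<open>Reciprocals, coordinate vectors and coordinate frames\<close>

context mfd begin

lemma open_nonzero:
  assumes f: "f \<in> smf M"
  shows "openin (rtop M) {q \<in> pts M. f q \<noteq> 0}"
proof (subst openin_subopen, intro ballI)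
  fix q assume q: "q \<in> {q \<in> pts M. f q \<noteq> 0}"
  then obtain U \<phi> where U: "ch U \<phi>" "q \<in> U" using chart_at by blast
  let ?d = "{x. P x \<in> \<phi> ` U}"
  define O' where "O' = ?d \<inter> rep U \<phi> f -` (- {0})"
  have "open O'" unfolding O'_def
    by (rule continuous_open_preimage[OF Cinf_on_continuous[OF Cinf_on_rep[OF f U(1)]] open_dom[OF U(1)]]) auto
  then have "openin (rtop M) {q \<in> U. \<phi> q \<in> O'}" by (rule chart_vimage_open[OF U(1)])
  moreover have "{q \<in> U. \<phi> q \<in> O'} \<subseteq> {q \<in> pts M. f q \<noteq> 0}"
    using chart_subset[OF U(1)] by (auto simp: O'_def rep_chart[OF U(1)])
  moreover have "q \<in> {q \<in> U. \<phi> q \<in> O'}"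
    using q U by (auto simp: O'_def rep_chart P_chart)
  ultimately show "\<exists>T. openin (rtop M) T \<and> q \<in> T \<and> T \<subseteq> {q \<in> pts M. f q \<noteq> 0}" by blast
qed

text \<open>Gram-Schmidt has to divide by the squared length of a field; the reciprocal exists near
  \<open>p\<close> and is cut off to stay in \<open>smf M\<close>.\<close>

lemma local_inverse:
  assumes f: "f \<in> smf M" and p: "p \<in> pts M" "f p \<noteq> 0"
  shows "\<exists>h\<in>smf M. \<exists>G. openin (rtop M) G \<and> p \<in> G \<and> (\<forall>q\<in>G. f q * h q = 1)"
proof -
  obtain U \<phi> where U: "ch U \<phi>" "p \<in> U" using chart_at p by blast
  let ?G = "{q \<in> pts M. f q \<noteq> 0}"
  have G: "openin (rtop M) ?G" "p \<in> ?G" using open_nonzero[OF f] p by auto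
  obtain \<eta> H where \<eta>: "\<eta> \<in> smf M" "openin (rtop M) H" "p \<in> H" "H \<subseteq> U \<inter> ?G" "\<And>q. q \<in> H \<Longrightarrow> \<eta> q = 1"
    "\<And>k. Cinf_on (rep U \<phi> k) {x. P x \<in> \<phi> ` (U \<inter> ?G)} \<Longrightarrow> (\<lambda>q. \<eta> q * k q) \<in> smf M"
    by (rule cutoff[OF U G]) blast
  let ?O = "{x. P x \<in> \<phi> ` (U \<inter> ?G)}"
  have "Cinf_on (\<lambda>x. inverse (rep U \<phi> f x)) ?O"
  proof (rule Cinf_on_inverse[OF open_chart_dom[OF U(1) G(1)]])
    show "Cinf_on (rep U \<phi> f) ?O" by (rule Cinf_on_subset[OF Cinf_on_rep[OF f U(1)]]) auto
    show "rep U \<phi> f x \<noteq> 0" if "x \<in> ?O" for x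
      using that by (auto simp: rep_def inv_chart[OF U(1)])
  qed
  then have "(\<lambda>q. \<eta> q * inverse (f q)) \<in> smf M"
    by (intro \<eta>(6)) (simp add: rep_def[abs_def])
  moreover have "\<forall>q\<in>H. f q * (\<eta> q * inverse (f q)) = 1"
    using \<eta>(4,5) by auto
  ultimately show ?thesis
    using \<eta>(2,3) by (intro bexI[of _ "\<lambda>q. \<eta> q * inverse (f q)"] exI[of _ H] conjI)
qed

text \<open>The derivation with direction \<xi> in chart coordinates. As \<open>rep\<close> is
  constant along the orthogonal complement of the model, that component of \<xi> contributes 0, and
  \<xi> is determined by the derivation only within the model.\<close>

definition cv :: "'a set \<Rightarrow> ('a \<Rightarrow> 'm) \<Rightarrow> 'a \<Rightarrow> 'm \<Rightarrow> 'a tvec" where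
  "cv U \<phi> q \<xi> f = (if f \<in> smf M then frechet_derivative (rep U \<phi> f) (at (\<phi> q)) \<xi> else 0)"

lemma rep_has_derivative:
  assumes c: "ch U \<phi>" and q: "q \<in> U" and f: "f \<in> smf M"
  shows "(rep U \<phi> f has_derivative (\<lambda>\<xi>. cv U \<phi> q \<xi> f)) (at (\<phi> q))"
proof -
  have "(\<lambda>\<xi>. cv U \<phi> q \<xi> f) = frechet_derivative (rep U \<phi> f) (at (\<phi> q))"
    using f by (simp add: cv_def fun_eq_iff)
  moreover have "rep U \<phi> f differentiable (at (\<phi> q))"
    by (rule Cinf_on_differentiable[OF Cinf_on_rep[OF f c]]) (use q P_chart[OF c q] in auto)
  ultimately show ?thesis by (simp only: frechet_derivative_has_derivative)
qed

lemma cv_unique: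
  assumes c: "ch U \<phi>" and q: "q \<in> U" and f: "f \<in> smf M"
    and "(rep U \<phi> f has_derivative F) (at (\<phi> q))"
  shows "cv U \<phi> q \<xi> f = F \<xi>"
  using has_derivative_unique[OF rep_has_derivative[OF c q f] assms(4)] by (rule fun_cong)

lemma cv_tangent:
  assumes c: "ch U \<phi>" and q: "q \<in> U"
  shows "cv U \<phi> q \<xi> \<in> tangent_space M q"
  unfolding tangent_space_def
proof (intro CollectI conjI ballI allI impI)
  fix f h assume f: "f \<in> smf M" and h: "h \<in> smf M"
  note d = rep_has_derivative[OF c q f] rep_has_derivative[OF c q h]
  show "cv U \<phi> q \<xi> (\<lambda>x. f x + h x) = cv U \<phi> q \<xi> f + cv U \<phi> q \<xi> h"
    by (rule cv_unique[OF c q smf_add[OF f h]])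
       (use has_derivative_add[OF d] in \<open>simp add: rep_def[abs_def]\<close>)
  show "cv U \<phi> q \<xi> (\<lambda>x. f x * h x) = f q * cv U \<phi> q \<xi> h + h q * cv U \<phi> q \<xi> f"
    by (rule cv_unique[OF c q smf_mult[OF f h], THEN trans])
       (use has_derivative_mult[OF d] in \<open>simp add: rep_def[abs_def] inv_chart[OF c q] P_chart[OF c q]\<close>)+
next
  fix f and a :: real assume f: "f \<in> smf M"
  show "cv U \<phi> q \<xi> (\<lambda>x. a * f x) = a * cv U \<phi> q \<xi> f"
    by (rule cv_unique[OF c q smf_cmult[OF f]])
       (use has_derivative_mult_right[OF rep_has_derivative[OF c q f], of a] in \<open>simp add: rep_def[abs_def]\<close>)
next
  fix f assume "f \<notin> smf M"
  then show "cv U \<phi> q \<xi> f = 0" by (simp add: cv_def)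
qed

lemma cv_lincomb:
  assumes c: "ch U \<phi>" and q: "q \<in> U"
  shows "cv U \<phi> q (\<Sum>i\<in>I. a i *\<^sub>R w i) f = (\<Sum>i\<in>I. a i * cv U \<phi> q (w i) f)"
proof (cases "f \<in> smf M")
  case True
  have l: "linear (\<lambda>\<xi>. cv U \<phi> q \<xi> f)"
    using rep_has_derivative[OF c q True] has_derivative_linear by blast
  show ?thesis
    using linear_sum[OF l, of "\<lambda>i. a i *\<^sub>R w i" I] linear_scale[OF l] by simp
qed (simp add: cv_def)

lemma cv_smooth:
  assumes c: "ch U \<phi>" and f: "f \<in> smf M"
  shows "Cinf_on (rep U \<phi> (\<lambda>q. cv U \<phi> q \<xi> f)) {x. P x \<in> \<phi> ` U}"
proof -
  let ?d = "{x. P x \<in> \<phi> ` U}"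
  have "Cinf_on (\<lambda>x. frechet_derivative (rep U \<phi> f) (at (P x)) \<xi>) ?d"
  proof (rule Cinf_on_compose[OF open_dom[OF c] open_dom[OF c] _ Cinf_on_P Cinf_on_derivative[OF Cinf_on_rep[OF f c]]])
    show "P ` ?d \<subseteq> ?d" by (auto simp: P_chart[OF c])
  qed
  then show ?thesis
    by (subst Cinf_on_cong[OF open_dom[OF c]]) (auto simp: rep_def[abs_def] inv_chart[OF c] cv_def f)
qed

text \<open>Coordinates and coordinate fields times a cut-off, so both are global; on
  \<open>H\<close>, where the cut-off is 1, they are the genuine ones. Hadamard's lemma expands an
  arbitrary derivation in them.\<close>

lemma coordinate_frame:
  assumes c: "ch U \<phi>" and p: "p \<in> U" and G: "openin (rtop M) G" "p \<in> G"
  obtains x E H where "local_frame M n x E H" "p \<in> H" "H \<subseteq> U \<inter> G"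
    "\<And>q i. q \<in> H \<Longrightarrow> i < n \<Longrightarrow> x i q = \<phi> q \<bullet> e i"
    "\<And>q i. q \<in> H \<Longrightarrow> i < n \<Longrightarrow> E i q = cv U \<phi> q (e i)"
    "\<And>q i j. q \<in> H \<Longrightarrow> i < n \<Longrightarrow> j < n \<Longrightarrow> E i q (x j) = (if i = j then 1 else 0)"
proof -
  obtain \<eta> H where \<eta>: "\<eta> \<in> smf M" "openin (rtop M) H" "p \<in> H" "H \<subseteq> U \<inter> G" "\<And>q. q \<in> H \<Longrightarrow> \<eta> q = 1"
    "\<And>q. q \<notin> U \<inter> G \<Longrightarrow> \<eta> q = 0"
    "\<And>k. Cinf_on (rep U \<phi> k) {x. P x \<in> \<phi> ` (U \<inter> G)} \<Longrightarrow> (\<lambda>q. \<eta> q * k q) \<in> smf M"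
    by (rule cutoff[OF c p G]) blast
  have sub: "{x. P x \<in> \<phi> ` (U \<inter> G)} \<subseteq> {x. P x \<in> \<phi> ` U}" by auto
  define x where "x i q = \<eta> q * (\<phi> q \<bullet> e i)" for i q
  define E where "E i q f = \<eta> q * cv U \<phi> q (e i) f" for i q f
  have x: "x i \<in> smf M" if "i < n" for i
  proof -
    have o: "open {x. P x \<in> \<phi> ` (U \<inter> G)}" by (rule open_chart_dom[OF c G(1)])
    have "Cinf_on (\<lambda>y. P y \<bullet> e i) {x. P x \<in> \<phi> ` (U \<inter> G)}"
      by (intro Cinf_on_inner o Cinf_on_P Cinf_on_const)
    then have "Cinf_on (rep U \<phi> (\<lambda>q. \<phi> q \<bullet> e i)) {x. P x \<in> \<phi> ` (U \<inter> G)}"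
      by (subst Cinf_on_cong[OF o]) (auto simp: rep_def inv_chart[OF c])
    then show ?thesis using \<eta>(7) by (simp add: x_def[abs_def])
  qed
  have E: "VF (E i)" if "i < n" for i
  proof (rule vfI)
    fix q assume q: "q \<in> pts M"
    show "E i q \<in> T q"
    proof (cases "q \<in> U")
      case True
      then show ?thesis using tv_scale[OF cv_tangent[OF c True]] by (simp add: E_def[abs_def])
    next
      case False
      then show ?thesis using tv_zero \<eta>(6) by (simp add: E_def[abs_def])
    qed
  next
    fix f assume "f \<in> smf M"
    then show "(\<lambda>q. E i q f) \<in> smf M"
      unfolding E_def by (intro \<eta>(7) Cinf_on_subset[OF cv_smooth[OF c] sub])
  qed
  have EH: "E i q = cv U \<phi> q (e i)" if "q \<in> H" for i q
    using \<eta>(5)[OF that] by (simp add: E_def fun_eq_iff)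
  have xH: "x i q = \<phi> q \<bullet> e i" if "q \<in> H" for i q
    using \<eta>(5)[OF that] by (simp add: x_def)
  let ?O = "{x. P x \<in> \<phi> ` (U \<inter> H)}"
  have oO: "open ?O" by (rule open_chart_dom[OF c \<eta>(2)])
  have qO: "\<phi> q \<in> ?O" "q \<in> U" if "q \<in> H" for q
    using that \<eta>(4) P_chart[OF c] by auto
  have delta: "E i q (x j) = (if i = j then 1 else 0)" if q: "q \<in> H" and ij: "i < n" "j < n" for q i j
  proof -
    have "((\<lambda>y. y \<bullet> e j) has_derivative (\<lambda>y. y \<bullet> e j)) (at (\<phi> q))"
      by (intro derivative_eq_intros) auto
    then have "(rep U \<phi> (x j) has_derivative (\<lambda>y. y \<bullet> e j)) (at (\<phi> q))"
    proof (rule has_derivative_transform_within_open[OF _ oO qO(1)[OF q]])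
      fix y assume y: "y \<in> ?O"
      then obtain q' where q': "q' \<in> U" "q' \<in> H" "P y = \<phi> q'" by blast
      then have "rep U \<phi> (x j) y = P y \<bullet> e j" by (simp add: rep_def inv_chart[OF c] xH)
      then show "y \<bullet> e j = rep U \<phi> (x j) y" using ij by (simp add: P_inner)
    qed
    then show ?thesis
      using cv_unique[OF c qO(2)[OF q] x[OF ij(2)]] EH[OF q] ij by (simp add: e_orth)
  qed
  have expand: "v f = (\<Sum>i<n. v (x i) * E i q f)" if q: "q \<in> H" and v: "v \<in> T q" for q v f
  proof (cases "f \<in> smf M")
    case False
    then show ?thesis using tv_nonsmooth[OF v] by (simp add: EH[OF q] cv_def)
  next
    case f: True
    have qU: "q \<in> U" by (rule qO(2)[OF q])
    obtain r where r: "r > 0" "ball (\<phi> q) r \<subseteq> ?O"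
      using oO qO(1)[OF q] open_contains_ball by blast
    have "Cinf_on (rep U \<phi> f) (ball (\<phi> q) r)"
      by (rule Cinf_on_subset[OF Cinf_on_rep[OF f c]]) (use r(2) in auto)
    then obtain g where g: "\<And>v. Cinf_on (g v) (ball (\<phi> q) r)"
      "\<And>x. x \<in> ball (\<phi> q) r \<Longrightarrow> rep U \<phi> f x = rep U \<phi> f (\<phi> q) + g (x - \<phi> q) x"
      "\<And>x. x \<in> ball (\<phi> q) r \<Longrightarrow> linear (\<lambda>v. g v x)"
      "\<And>v. g v (\<phi> q) = frechet_derivative (rep U \<phi> f) (at (\<phi> q)) v"
      using r(1) by (rule hadamard) blast
    define G' where "G' = {q' \<in> U. \<phi> q' \<in> ball (\<phi> q) r}"
    have G': "openin (rtop M) G'" "q \<in> G'"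
      using chart_vimage_open[OF c open_ball] qU r(1) by (auto simp: G'_def)
    obtain \<eta>' H' where \<eta>': "\<eta>' \<in> smf M" "openin (rtop M) H'" "q \<in> H'" "H' \<subseteq> U \<inter> G'"
      "\<And>q. q \<in> H' \<Longrightarrow> \<eta>' q = 1"
      "\<And>k. Cinf_on (rep U \<phi> k) {x. P x \<in> \<phi> ` (U \<inter> G')} \<Longrightarrow> (\<lambda>q. \<eta>' q * k q) \<in> smf M"
      by (rule cutoff[OF c qU G']) blast
    define h where "h i q' = \<eta>' q' * g (e i) (\<phi> q')" for i q'
    have h: "h i \<in> smf M" for i
    proof -
      have o: "open {x. P x \<in> \<phi> ` (U \<inter> G')}" by (rule open_chart_dom[OF c G'(1)])
      have "Cinf_on (\<lambda>y. g (e i) (P y)) {x. P x \<in> \<phi> ` (U \<inter> G')}"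
        by (rule Cinf_on_compose[OF o open_ball _ Cinf_on_P g(1)]) (auto simp: G'_def)
      then have "Cinf_on (rep U \<phi> (\<lambda>q. g (e i) (\<phi> q))) {x. P x \<in> \<phi> ` (U \<inter> G')}"
        by (subst Cinf_on_cong[OF o]) (auto simp: rep_def inv_chart[OF c])
      then show ?thesis unfolding h_def by (rule \<eta>'(6))
    qed
    define b where "b i = \<phi> q \<bullet> e i" for i
    have xb: "(\<lambda>q'. x i q' - b i) \<in> smf M" if "i < n" for i
      by (rule smf_diff[OF x[OF that] smf_const])
    \<comment> \<open>Near \<open>q\<close> the function is f(q) + sum (x_i - b_i) h_i with b_i =
      x_i(q) and global smooth h_i. Leibniz at \<open>q\<close> removes v(h_i), and h_i(q) is the
      i-th partial derivative of \<open>f\<close>.\<close>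
    have "v f = v (\<lambda>q'. f q + (\<Sum>i\<in>{..<n}. (x i q' - b i) * h i q'))"
    proof (rule tv_local[OF v \<eta>'(2,3) f])
      show "(\<lambda>q'. f q + (\<Sum>i\<in>{..<n}. (x i q' - b i) * h i q')) \<in> smf M"
        by (intro smf_add smf_const smf_sum smf_mult h) (use xb in auto)
      fix q' assume q': "q' \<in> H'"
      then have q'U: "q' \<in> U" and q'b: "\<phi> q' \<in> ball (\<phi> q) r" using \<eta>'(4) by (auto simp: G'_def)
      then obtain q'' where "q'' \<in> U" "q'' \<in> H" "\<phi> q' = \<phi> q''" using r(2) P_chart[OF c q'U] by auto
      then have q'H: "q' \<in> H" using chart_inj[OF c] q'U by (auto simp: inj_on_def)
      \<comment> \<open>Differences of chart values lie in the model, so they expand in the basis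
        \<open>e\<close>.\<close>
      have "\<phi> q' - \<phi> q = P (\<phi> q' - \<phi> q)"
        using P_id[OF subspace_diff[OF subspace_model chart_in_model[OF c q'U] chart_in_model[OF c qU]]] by simp
      also have "\<dots> = (\<Sum>i<n. (x i q' - b i) *\<^sub>R e i)"
        by (simp add: P_def b_def xH[OF q'H] inner_diff_left)
      finally have "g (\<phi> q' - \<phi> q) (\<phi> q') = (\<Sum>i<n. (x i q' - b i) * h i q')"
        using linear_sum[OF g(3)[OF q'b], of "\<lambda>i. (x i q' - b i) *\<^sub>R e i" "{..<n}"]
          linear_scale[OF g(3)[OF q'b]] \<eta>'(5)[OF q'] by (simp add: h_def)
      then show "f q' = f q + (\<Sum>i<n. (x i q' - b i) * h i q')"
        using g(2)[OF q'b] by (simp add: rep_chart[OF c] qU q'U)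
    qed
    also have "\<dots> = (\<Sum>i\<in>{..<n}. v (\<lambda>q'. (x i q' - b i) * h i q'))"
    proof (subst tv_add[OF v smf_const])
      show "(\<lambda>q'. \<Sum>i\<in>{..<n}. (x i q' - b i) * h i q') \<in> smf M"
        by (intro smf_sum smf_mult h) (use xb in auto)
      show "v (\<lambda>q'. f q) + v (\<lambda>q'. \<Sum>i\<in>{..<n}. (x i q' - b i) * h i q') =
          (\<Sum>i\<in>{..<n}. v (\<lambda>q'. (x i q' - b i) * h i q'))"
        using tv_sum[OF v, of "{..<n}" "\<lambda>i q'. (x i q' - b i) * h i q'"] smf_mult[OF xb h]
        by (simp add: tv_const[OF v])
    qed
    also have "\<dots> = (\<Sum>i<n. v (x i) * E i q f)"
    proof (rule sum.cong[OF refl])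
      fix i assume "i \<in> {..<n}"
      then have i: "i < n" by simp
      have "v (\<lambda>q'. (x i q' - b i) * h i q') = (x i q - b i) * v (h i) + h i q * v (x i)"
        by (simp add: tv_mult[OF v xb[OF i] h] tv_diff[OF v x[OF i] smf_const] tv_const[OF v])
      also have "\<dots> = v (x i) * E i q f"
        using g(4) \<eta>'(3,5) by (simp add: xH[OF q] b_def h_def EH[OF q] cv_def f)
      finally show "v (\<lambda>q'. (x i q' - b i) * h i q') = v (x i) * E i q f" .
    qed
    finally show ?thesis .
  qed
  show thesis
  proof (rule that)
    show "local_frame M n x E H"
      unfolding local_frame_def using \<eta>(2) x E expand by blast
  qed (use \<eta>(3,4) xH EH delta in auto)
qed

sublocale smooth_space M
proof
  fix p assume "p \<in> pts M"
  then obtain U \<phi> where U: "ch U \<phi>" "p \<in> U" using chart_at by blast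
  from coordinate_frame[OF U chart_open[OF U(1)] U(2)]
  show "\<exists>n x E G. local_frame M n x E G \<and> p \<in> G" by metis
qed

lemma tangent_cv:
  assumes c: "ch U \<phi>" and q: "q \<in> U" and v: "v \<in> T q"
  obtains \<xi> where "\<xi> \<in> model M" "v = cv U \<phi> q \<xi>"
proof -
  obtain x E H where F: "local_frame M n x E H" "q \<in> H" "\<And>q i. q \<in> H \<Longrightarrow> i < n \<Longrightarrow> E i q = cv U \<phi> q (e i)"
    by (rule coordinate_frame[OF c q chart_open[OF c] q]) blast
  have "v f = cv U \<phi> q (\<Sum>i<n. v (x i) *\<^sub>R e i) f" for f
    unfolding cv_lincomb[OF c q] using F v unfolding local_frame_def by simp
  moreover have "(\<Sum>i<n. v (x i) *\<^sub>R e i) \<in> model M"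
    by (intro subspace_sum subspace_scale subspace_model) (simp add: e_in_model)
  ultimately show thesis using that by blast
qed

end

section \<open>Horizontal lifts\<close>

locale riemannian_mfd = mfd +
  assumes metric: "riemannian_metric M"

sublocale riemannian_mfd \<subseteq> metric_smooth_space M
proof
  fix p u v w and a b :: real
  assume "p \<in> pts M" "u \<in> T p" "v \<in> T p" "w \<in> T p"
  then show "met M p (\<lambda>f. a * u f + b * v f) w = a * met M p u w + b * met M p v w"
    using metric unfolding riemannian_metric_def by blast
next
  fix p u v assume "p \<in> pts M" "u \<in> T p" "v \<in> T p"
  then show "met M p u v = met M p v u"
    using metric unfolding riemannian_metric_def by blast
next
  fix p v assume "p \<in> pts M" "v \<in> T p" "v \<noteq> (\<lambda>f. 0)"
  then show "met M p v v > 0"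
    using metric unfolding riemannian_metric_def by blast
qed

section \<open>Smooth Riesz representation of one-forms\<close>

context riemannian_mfd begin

lemma met_smooth: "VF V \<Longrightarrow> VF W \<Longrightarrow> (\<lambda>p. g p (V p) (W p)) \<in> smf M"
  using metric unfolding riemannian_metric_def by blast

definition one_form :: "('a \<Rightarrow> 'a tvec \<Rightarrow> real) \<Rightarrow> bool" where
  "one_form \<omega> \<longleftrightarrow> (\<forall>p\<in>pts M. \<forall>u\<in>T p. \<forall>v\<in>T p. \<forall>a b. \<omega> p (\<lambda>f. a * u f + b * v f) = a * \<omega> p u + b * \<omega> p v) \<and>
     (\<forall>W. VF W \<longrightarrow> (\<lambda>p. \<omega> p (W p)) \<in> smf M)"

lemma one_form_lincomb:
  assumes \<omega>: "one_form \<omega>" and p: "p \<in> pts M" and u: "\<And>i. i < (k :: nat) \<Longrightarrow> u i \<in> T p"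
  shows "\<omega> p (\<lambda>f. \<Sum>i<k. c i * u i f) = (\<Sum>i<k. c i * \<omega> p (u i))"
proof -
  have lin: "\<omega> p (\<lambda>f. a * u f + b * v f) = a * \<omega> p u + b * \<omega> p v" if "u \<in> T p" "v \<in> T p" for u v a b
    using \<omega> p that by (simp add: one_form_def)
  show ?thesis
    using u
  proof (induction k)
    case 0
    show ?case using lin[OF tv_zero tv_zero, of 0 0] by simp
  next
    case (Suc k)
    have "(\<lambda>f. \<Sum>i\<in>{..<k}. c i * u i f) \<in> T p" using Suc.prems by (intro tv_lincomb) simp
    from lin[OF this Suc.prems[of k], of 1 "c k"] Suc show ?case by simp
  qed
qed

text \<open>Gram-Schmidt: in step \<open>k\<close> the form is solved on \<open>E 0, \<dots>, E k\<close> by correcting with the part of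
  \<open>E k\<close> orthogonal to the earlier fields.\<close>

lemma riesz_step:
  assumes F: "local_frame M n x E H" and p: "p \<in> H"
    and delta: "\<And>q i j. q \<in> H \<Longrightarrow> i < n \<Longrightarrow> j < n \<Longrightarrow> E i q (x j) = (if i = j then 1 else 0)"
    and "k \<le> n" "one_form \<omega>"
  shows "\<exists>V G. VF V \<and> openin (rtop M) G \<and> p \<in> G \<and> G \<subseteq> H \<and>
    (\<forall>q\<in>G. (\<forall>i<k. g q (V q) (E i q) = \<omega> q (E i q)) \<and> (\<forall>j<n. k \<le> j \<longrightarrow> V q (x j) = 0))"
  using assms(4,5)
proof (induction k arbitrary: \<omega>)
  case 0
  have "VF (\<lambda>q f. 0)" by (rule vfI) (simp_all add: tv_zero smf_const)
  then show ?case using F p by (intro exI[of _ "\<lambda>q f. 0"] exI[of _ H]) (simp add: local_frame_def)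
next
  case (Suc k)
  then have k: "k < n" "k \<le> n" by auto
  have oH: "openin (rtop M) H" and E: "\<And>i. i < n \<Longrightarrow> VF (E i)" and
    ex: "\<And>q v. q \<in> H \<Longrightarrow> v \<in> T q \<Longrightarrow> v = (\<lambda>f. \<Sum>i<n. v (x i) * E i q f)"
    using F unfolding local_frame_def by (auto simp: fun_eq_iff)
  have Hp: "q \<in> pts M" if "q \<in> H" for q using oH openin_subset that by blast
  from Suc.IH[OF k(2) Suc.prems(2)] obtain V G0 where V: "VF V" "openin (rtop M) G0" "p \<in> G0" "G0 \<subseteq> H"
    "\<And>q i. q \<in> G0 \<Longrightarrow> i < k \<Longrightarrow> g q (V q) (E i q) = \<omega> q (E i q)"
    "\<And>q j. q \<in> G0 \<Longrightarrow> j < n \<Longrightarrow> k \<le> j \<Longrightarrow> V q (x j) = 0" by metis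
  \<comment> \<open>The induction hypothesis for the form g(E_k, -) yields the projection
    \<open>Q\<close> of E_k to the span of the earlier fields. That \<open>Q\<close> lies in this
    span is recorded by the vanishing of \<open>Q q (x j)\<close> for j \<ge> k.\<close>
  have "one_form (\<lambda>q. g q (E k q))"
    unfolding one_form_def
    using met_lin vf_tan[OF E[OF k(1)]] met_sym tv_lin met_smooth[OF E[OF k(1)]] by simp
  from Suc.IH[OF k(2) this] obtain Q G1 where Q: "VF Q" "openin (rtop M) G1" "p \<in> G1" "G1 \<subseteq> H"
    "\<And>q i. q \<in> G1 \<Longrightarrow> i < k \<Longrightarrow> g q (Q q) (E i q) = g q (E k q) (E i q)"
    "\<And>q j. q \<in> G1 \<Longrightarrow> j < n \<Longrightarrow> k \<le> j \<Longrightarrow> Q q (x j) = 0" by metis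
  define N where "N = (\<lambda>q f. E k q f - Q q f)"
  have N: "VF N" unfolding N_def by (rule vf_diff[OF E[OF k(1)] Q(1)])
  have NE: "g q (N q) (E i q) = 0" if "q \<in> G1" "i < k" for q i
    using that Q(4,5) Hp vf_tan[OF E] vf_tan[OF Q(1)] k by (auto simp: N_def met_diff_left)
  have Nx: "N q (x j) = (if j = k then 1 else 0)" if "q \<in> G1" "j < n" "k \<le> j" for q j
    using that Q(4,6) delta k by (auto simp: N_def)
  \<comment> \<open>\<open>N\<close> is orthogonal to \<open>Q\<close>, so g(N, E_k) = g(N, N); and
    \<open>N\<close> is nonzero because its coefficient at x_k is 1.\<close>
  have NN: "g q (N q) (E k q) > 0" if q: "q \<in> G1" for q
  proof -
    have qH: "q \<in> H" "q \<in> pts M" using q Q(4) Hp by auto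
    note t = vf_tan[OF N qH(2)] vf_tan[OF Q(1) qH(2)] vf_tan[OF E qH(2)]
    have "g q (N q) (Q q) = g q (\<lambda>f. \<Sum>i\<in>{..<n}. Q q (x i) * E i q f) (N q)"
      using ex[OF qH(1) t(2)] met_sym[OF qH(2) t(1,2)] by simp
    also have "\<dots> = (\<Sum>i\<in>{..<n}. Q q (x i) * g q (E i q) (N q))"
      by (rule met_lincomb_left[OF qH(2) t(1)]) (simp add: t)
    also have "\<dots> = 0"
    proof (rule sum.neutral, intro ballI)
      fix i assume i: "i \<in> {..<n}"
      show "Q q (x i) * g q (E i q) (N q) = 0"
        using NE[OF q, of i] Q(6)[OF q, of i] met_sym[OF qH(2) t(1) t(3)[of i]] i by (cases "i < k") auto
    qed
    finally have NQ: "g q (N q) (Q q) = 0" .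
    have "g q (N q) (N q) > 0"
    proof (rule met_pos[OF qH(2) t(1)])
      show "N q \<noteq> (\<lambda>f. 0)" using Nx[OF q k(1)] by auto
    qed
    moreover have "g q (N q) (N q) = g q (N q) (E k q) - g q (N q) (Q q)"
      using met_diff_right[OF qH(2) t(3)[OF k(1)] t(2) t(1)] by (simp add: N_def)
    ultimately show ?thesis using NQ by simp
  qed
  have "(\<lambda>q. g q (N q) (E k q)) \<in> smf M" by (rule met_smooth[OF N E[OF k(1)]])
  from local_inverse[OF this, of p] NN[OF Q(3)] Hp[OF p] obtain h G2 where h: "h \<in> smf M"
    "openin (rtop M) G2" "p \<in> G2" "\<And>q. q \<in> G2 \<Longrightarrow> g q (N q) (E k q) * h q = 1" by force
  \<comment> \<open>\<open>N\<close> is orthogonal to the earlier fields, so adding a multiple of it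
    repairs equation \<open>k\<close> and leaves the earlier equations intact.\<close>
  define c where "c = (\<lambda>q. (\<omega> q (E k q) - g q (V q) (E k q)) * h q)"
  have c: "c \<in> smf M"
    unfolding c_def using Suc.prems(2) E[OF k(1)] V(1) h(1)
    by (intro smf_mult smf_diff met_smooth) (auto simp: one_form_def)
  define W where "W = (\<lambda>q f. V q f + c q * N q f)"
  have W: "VF W" unfolding W_def by (rule vf_add[OF V(1) vf_scale[OF c N]])
  let ?G = "G0 \<inter> G1 \<inter> G2"
  have "g q (W q) (E i q) = \<omega> q (E i q)" if q: "q \<in> ?G" and i: "i < Suc k" for q i
  proof -
    have qp: "q \<in> pts M" using q V(4) Hp by auto
    note t = vf_tan[OF N qp] vf_tan[OF V(1) qp] vf_tan[OF E qp, of i]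
    have "g q (W q) (E i q) = g q (V q) (E i q) + c q * g q (N q) (E i q)"
      using t i k by (simp add: W_def met_add_left[OF qp] met_scale_left[OF qp] tv_scale)
    moreover have "c q * g q (N q) (E k q) = \<omega> q (E k q) - g q (V q) (E k q)"
      using h(4)[of q] q by (simp add: c_def mult.assoc mult.commute[of "h q"])
    ultimately show ?thesis
      using i V(5)[of q i] NE[of q i] q by (cases "i = k") auto
  qed
  moreover have "W q (x j) = 0" if "q \<in> ?G" "j < n" "Suc k \<le> j" for q j
    using that V(6)[of q j] Nx[of q j] by (simp add: W_def)
  ultimately show ?case
    using W V(2,3,4) Q(2,3) h(2,3) by (intro exI[of _ W] exI[of _ ?G]) auto
qed

text \<open>Gram-Schmidt solves the problem locally; the local solutions glue because the
  representing vector at a point is unique.\<close>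

lemma riesz:
  assumes \<omega>: "one_form \<omega>"
  obtains V where "VF V" "\<And>q w. q \<in> pts M \<Longrightarrow> w \<in> T q \<Longrightarrow> g q (V q) w = \<omega> q w"
proof -
  have loc: "\<exists>G V. openin (rtop M) G \<and> p \<in> G \<and> VF V \<and> (\<forall>q\<in>G. \<forall>w\<in>T q. g q (V q) w = \<omega> q w)"
    if p: "p \<in> pts M" for p
  proof -
    obtain U \<phi> where U: "ch U \<phi>" "p \<in> U" using chart_at p by blast
    obtain x E H where F: "local_frame M n x E H" "p \<in> H"
      "\<And>q i j. q \<in> H \<Longrightarrow> i < n \<Longrightarrow> j < n \<Longrightarrow> E i q (x j) = (if i = j then 1 else 0)"
      by (rule coordinate_frame[OF U chart_open[OF U(1)] U(2)]) blast
    have "\<exists>V G. VF V \<and> openin (rtop M) G \<and> p \<in> G \<and> G \<subseteq> H \<and>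
      (\<forall>q\<in>G. (\<forall>i<n. g q (V q) (E i q) = \<omega> q (E i q)) \<and> (\<forall>j<n. n \<le> j \<longrightarrow> V q (x j) = 0))"
      by (rule riesz_step[OF F(1,2) _ order.refl \<omega>]) (rule F(3))
    then obtain V G where V: "VF V" "openin (rtop M) G" "p \<in> G" "G \<subseteq> H"
      "\<And>q i. q \<in> G \<Longrightarrow> i < n \<Longrightarrow> g q (V q) (E i q) = \<omega> q (E i q)" by metis
    have "g q (V q) w = \<omega> q w" if q: "q \<in> G" and w: "w \<in> T q" for q w
    proof -
      have qp: "q \<in> pts M" using V(2) openin_subset q by blast
      have E: "E i q \<in> T q" if "i < n" for i
        using F(1) vf_tan qp that by (auto simp: local_frame_def)
      have "w f = (\<Sum>i<n. w (x i) * E i q f)" for f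
        using F(1) V(4) q w unfolding local_frame_def by blast
      then have w': "w = (\<lambda>f. \<Sum>i<n. w (x i) * E i q f)" by blast
      have "g q (V q) w = g q (\<lambda>f. \<Sum>i\<in>{..<n}. w (x i) * E i q f) (V q)"
        using w' met_sym[OF qp vf_tan[OF V(1) qp] w] by simp
      also have "\<dots> = (\<Sum>i\<in>{..<n}. w (x i) * g q (E i q) (V q))"
        by (rule met_lincomb_left[OF qp vf_tan[OF V(1) qp]]) (simp add: E)
      also have "\<dots> = (\<Sum>i<n. w (x i) * \<omega> q (E i q))"
        using V(5)[OF q] met_sym[OF qp vf_tan[OF V(1) qp] E] by simp
      also have "\<dots> = \<omega> q (\<lambda>f. \<Sum>i<n. w (x i) * E i q f)"
        by (rule one_form_lincomb[OF \<omega> qp E, symmetric])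
      finally show ?thesis using w' by simp
    qed
    then show ?thesis using V(1-3) by blast
  qed
  define R where "R q = (SOME v. v \<in> T q \<and> (\<forall>w\<in>T q. g q v w = \<omega> q w))" for q
  have R: "R q = V q" if "VF V" "q \<in> pts M" "\<forall>w\<in>T q. g q (V q) w = \<omega> q w" for V q
  proof -
    have "R q \<in> T q \<and> (\<forall>w\<in>T q. g q (R q) w = \<omega> q w)"
      unfolding R_def by (rule someI[of _ "V q"]) (use that vf_tan in auto)
    then show ?thesis
      using that vf_tan by (intro met_nondegenerate[OF that(2)]) auto
  qed
  have RV: "\<exists>G W. openin (rtop M) G \<and> p \<in> G \<and> VF W \<and> (\<forall>q\<in>G. R q = W q \<and> (\<forall>w\<in>T q. g q (W q) w = \<omega> q w))"
    if "p \<in> pts M" for p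
  proof -
    obtain G V where V: "openin (rtop M) G" "p \<in> G" "VF V" "\<forall>q\<in>G. \<forall>w\<in>T q. g q (V q) w = \<omega> q w"
      using loc[OF \<open>p \<in> pts M\<close>] by blast
    then show ?thesis using R[OF V(3)] openin_subset[OF V(1)] by (intro exI[of _ G] exI[of _ V]) auto
  qed
  show thesis
  proof (rule that)
    show "VF R" using RV by (intro vf_local) metis
    show "g q (R q) w = \<omega> q w" if "q \<in> pts M" "w \<in> T q" for q w
      using RV[OF that(1)] that(2) by metis
  qed
qed

end

section \<open>The adjoint of the differential and the orthogonal splitting\<close>

locale riem_submersion = M: riemannian_mfd M e n + B: riemannian_mfd B d m
  for M :: "('a, 'm::euclidean_space) rmanifold" and e n
    and B :: "('b, 'n::euclidean_space) rmanifold" and d m +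
  fixes \<pi> :: "'a \<Rightarrow> 'b"
  assumes submersion: "riemannian_submersion M B \<pi>"
begin

abbreviation pf :: "'a tvec \<Rightarrow> 'b tvec" where "pf \<equiv> pushforward B \<pi>"
abbreviation Ver :: "'a \<Rightarrow> 'a tvec set" where "Ver \<equiv> vertical_space M B \<pi>"
abbreviation Hor :: "'a \<Rightarrow> 'a tvec set" where "Hor \<equiv> horizontal_space M B \<pi>"
abbreviation ver :: "'a \<Rightarrow> 'a tvec \<Rightarrow> 'a tvec" where "ver \<equiv> vertical_part M B \<pi>"
abbreviation hor :: "'a \<Rightarrow> 'a tvec \<Rightarrow> 'a tvec" where "hor \<equiv> horizontal_part M B \<pi>"

lemma continuous: "continuous_map (rtop M) (rtop B) \<pi>"
  and surj: "\<pi> ` pts M = pts B"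
  using submersion by (simp_all add: riemannian_submersion_def smooth_map_def)

lemma smooth: "M.ch U \<phi> \<Longrightarrow> B.ch V \<psi> \<Longrightarrow> smooth_on (\<phi> ` {p \<in> U. \<pi> p \<in> V}) (\<psi> \<circ> \<pi> \<circ> inv_into U \<phi>)"
proof -
  assume c: "M.ch U \<phi>" "B.ch V \<psi>"
  have "\<forall>(U, \<phi>)\<in>atlas M. \<forall>(V, \<psi>)\<in>atlas B. smooth_on (\<phi> ` {p \<in> U. \<pi> p \<in> V}) (\<psi> \<circ> \<pi> \<circ> inv_into U \<phi>)"
    using submersion by (simp add: riemannian_submersion_def smooth_map_def)
  from bspec[OF bspec[OF this c(1), unfolded prod.case] c(2)] show ?thesis by simp
qed

lemma pf_surj: "p \<in> pts M \<Longrightarrow> pf ` M.T p = B.T (\<pi> p)"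
  and isometry: "p \<in> pts M \<Longrightarrow> v \<in> Hor p \<Longrightarrow> w \<in> Hor p \<Longrightarrow> B.g (\<pi> p) (pf v) (pf w) = M.g p v w"
  using submersion by (simp_all add: riemannian_submersion_def)

lemma pi_pts: "p \<in> pts M \<Longrightarrow> \<pi> p \<in> pts B"
  using surj by blast

lemma open_preimage: "openin (rtop B) G \<Longrightarrow> openin (rtop M) {q \<in> pts M. \<pi> q \<in> G}"
  using continuous by (rule openin_continuous_map_preimage)

lemma chart_preimage:
  assumes "M.ch U \<phi>" "B.ch V \<psi>"
  shows "openin (rtop M) {q \<in> pts M. \<pi> q \<in> V}" "{q \<in> U. \<pi> q \<in> V} = U \<inter> {q \<in> pts M. \<pi> q \<in> V}"
  using open_preimage[OF B.chart_open[OF assms(2)]] M.chart_subset[OF assms(1)] by auto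

lemma Cinf_on_pi:
  assumes c: "M.ch U \<phi>" "B.ch V \<psi>"
  shows "Cinf_on (\<lambda>x. \<psi> (\<pi> (inv_into U \<phi> (M.P x)))) {x. M.P x \<in> \<phi> ` {q \<in> U. \<pi> q \<in> V}}"
proof -
  have "openin (top_of_set (model M)) (\<phi> ` {q \<in> U. \<pi> q \<in> V})"
    unfolding chart_preimage(2)[OF c] by (rule M.chart_image_open[OF c(1) chart_preimage(1)[OF c]])
  then show ?thesis using smooth[OF c] by (simp add: M.smooth_on_iff)
qed

lemma comp_smf:
  assumes f: "f \<in> smf B"
  shows "f \<circ> \<pi> \<in> smf M"
proof (rule M.smfI)
  fix p assume p: "p \<in> pts M"
  obtain U \<phi> where U: "M.ch U \<phi>" "p \<in> U" using M.chart_at p by blast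
  obtain V \<psi> where V: "B.ch V \<psi>" "\<pi> p \<in> V" using B.chart_at pi_pts[OF p] by blast
  let ?O = "{x. M.P x \<in> \<phi> ` {q \<in> U. \<pi> q \<in> V}}"
  have o: "open ?O"
    unfolding chart_preimage(2)[OF U(1) V(1)]
    by (rule M.open_chart_dom[OF U(1) chart_preimage(1)[OF U(1) V(1)]])
  have "Cinf_on (\<lambda>x. B.rep V \<psi> f (\<psi> (\<pi> (inv_into U \<phi> (M.P x))))) ?O"
    by (rule Cinf_on_compose[OF o B.open_dom[OF V(1)] _ Cinf_on_pi[OF U(1) V(1)] B.Cinf_on_rep[OF f V(1)]])
       (auto simp: M.inv_chart[OF U(1)] B.P_chart[OF V(1)])
  then have "Cinf_on (M.rep U \<phi> (f \<circ> \<pi>)) ?O"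
    by (subst Cinf_on_cong[OF o]) (auto simp: M.rep_def M.inv_chart[OF U(1)] B.rep_chart[OF V(1)])
  then show "\<exists>U \<phi> O'. M.ch U \<phi> \<and> p \<in> U \<and> open O' \<and> \<phi> p \<in> O' \<and> O' \<subseteq> {x. M.P x \<in> \<phi> ` U} \<and>
      Cinf_on (M.rep U \<phi> (f \<circ> \<pi>)) O'"
    using U V o by (intro exI[of _ U] exI[of _ \<phi>] exI[of _ ?O]) (auto simp: M.P_chart)
qed

lemma pf_tan: "p \<in> pts M \<Longrightarrow> v \<in> M.T p \<Longrightarrow> pf v \<in> B.T (\<pi> p)"
  using pf_surj by blast

lemma pf_apply: "f \<in> smf B \<Longrightarrow> pf v f = v (f \<circ> \<pi>)"
  by (simp add: pushforward_def)

lemma pf_lin: "pf (\<lambda>f. a * u f + b * v f) = (\<lambda>f. a * pf u f + b * pf v f)"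
  and pf_diff: "pf (\<lambda>f. u f - v f) = (\<lambda>f. pf u f - pf v f)"
  and pf_zero: "pf (\<lambda>f. 0) = (\<lambda>f. 0)"
  by (auto simp: pushforward_def fun_eq_iff)

lemma Ver_iff: "v \<in> Ver p \<longleftrightarrow> v \<in> M.T p \<and> pf v = (\<lambda>f. 0)"
  by (simp add: vertical_space_def)

lemma Hor_iff: "w \<in> Hor p \<longleftrightarrow> w \<in> M.T p \<and> (\<forall>v\<in>Ver p. M.g p v w = 0)"
  by (simp add: horizontal_space_def)

lemma Ver_Hor: "v \<in> Ver p \<Longrightarrow> w \<in> Hor p \<Longrightarrow> M.g p v w = 0"
  by (simp add: Hor_iff)

lemma Ver_tan: "v \<in> Ver p \<Longrightarrow> v \<in> M.T p"
  and Hor_tan: "w \<in> Hor p \<Longrightarrow> w \<in> M.T p"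
  by (simp_all add: Ver_iff Hor_iff)

lemma Hor_Ver: "p \<in> pts M \<Longrightarrow> v \<in> Ver p \<Longrightarrow> w \<in> Hor p \<Longrightarrow> M.g p w v = 0"
  using Ver_Hor M.met_sym Ver_tan Hor_tan by metis

lemma Ver_Int_Hor:
  assumes p: "p \<in> pts M" and v: "v \<in> Ver p" "v \<in> Hor p"
  shows "v = (\<lambda>f. 0)"
proof (rule ccontr)
  assume "v \<noteq> (\<lambda>f. 0)"
  then show False using M.met_pos[OF p Ver_tan[OF v(1)]] Ver_Hor[OF v] by simp
qed

lemma Ver_lin: "u \<in> Ver p \<Longrightarrow> v \<in> Ver p \<Longrightarrow> (\<lambda>f. a * u f + b * v f) \<in> Ver p"
  by (simp add: Ver_iff M.tv_lin pf_lin)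

lemma Ver_diff: "u \<in> Ver p \<Longrightarrow> v \<in> Ver p \<Longrightarrow> (\<lambda>f. u f - v f) \<in> Ver p"
  by (simp add: Ver_iff M.tv_minus' pf_diff)

lemma Ver_zero: "(\<lambda>f. 0) \<in> Ver p"
  by (simp add: Ver_iff M.tv_zero pf_zero)

lemma Hor_zero: "p \<in> pts M \<Longrightarrow> (\<lambda>f. 0) \<in> Hor p"
  by (simp add: Hor_iff M.tv_zero M.met_zero_right Ver_tan)

lemma Hor_diff: "p \<in> pts M \<Longrightarrow> u \<in> Hor p \<Longrightarrow> v \<in> Hor p \<Longrightarrow> (\<lambda>f. u f - v f) \<in> Hor p"
  by (simp add: Hor_iff M.tv_minus' M.met_diff_right Ver_tan)

text \<open>\<open>Y\<close> is a field along \<pi>, whose smoothness is expressed through pairings.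
  Pairings with pulled-back base fields suffice, since d\<pi>(E) is locally a combination of such
  fields with coefficients \<open>E q (x i \<circ> \<pi>)\<close>.\<close>

lemma pull_form_smooth:
  assumes E: "M.VF E" and Y: "\<And>p. p \<in> pts M \<Longrightarrow> Y p \<in> B.T (\<pi> p)"
    and sm: "\<And>Z. B.VF Z \<Longrightarrow> (\<lambda>p. B.g (\<pi> p) (Z (\<pi> p)) (Y p)) \<in> smf M"
  shows "(\<lambda>p. B.g (\<pi> p) (Y p) (pf (E p))) \<in> smf M"
proof (rule M.smf_local)
  fix p assume p: "p \<in> pts M"
  obtain k x F G where F: "local_frame B k x F G" "\<pi> p \<in> G" using B.frame[OF pi_pts[OF p]] by blast
  then have oG: "openin (rtop B) G" and x: "\<And>i. i < k \<Longrightarrow> x i \<in> smf B" and FV: "\<And>i. i < k \<Longrightarrow> B.VF (F i)"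
    and ex: "\<And>b v. b \<in> G \<Longrightarrow> v \<in> B.T b \<Longrightarrow> v = (\<lambda>f. \<Sum>i<k. v (x i) * F i b f)"
    unfolding local_frame_def by (auto simp: fun_eq_iff)
  define h where "h q = (\<Sum>i\<in>{..<k}. E q (x i \<circ> \<pi>) * B.g (\<pi> q) (F i (\<pi> q)) (Y q))" for q
  have h: "h \<in> smf M"
    unfolding h_def by (intro M.smf_sum M.smf_mult M.vf_smf[OF E] sm) (simp add: FV)
  have eq: "B.g (\<pi> q) (Y q) (pf (E q)) = h q" if q: "q \<in> pts M" "\<pi> q \<in> G" for q
  proof -
    note bp = pi_pts[OF q(1)]
    have w: "pf (E q) \<in> B.T (\<pi> q)" by (rule pf_tan[OF q(1) M.vf_tan[OF E q(1)]])
    have "B.g (\<pi> q) (Y q) (pf (E q)) = B.g (\<pi> q) (\<lambda>f. \<Sum>i\<in>{..<k}. pf (E q) (x i) * F i (\<pi> q) f) (Y q)"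
      using ex[OF q(2) w] B.met_sym[OF bp w Y[OF q(1)]] by simp
    also have "\<dots> = (\<Sum>i\<in>{..<k}. pf (E q) (x i) * B.g (\<pi> q) (F i (\<pi> q)) (Y q))"
      by (rule B.met_lincomb_left[OF bp Y[OF q(1)]]) (simp add: B.vf_tan[OF FV bp])
    also have "\<dots> = h q" by (simp add: h_def pf_apply x)
    finally show ?thesis .
  qed
  show "\<exists>G h. openin (rtop M) G \<and> p \<in> G \<and> h \<in> smf M \<and> (\<forall>q\<in>G. B.g (\<pi> q) (Y q) (pf (E q)) = h q)"
    using open_preimage[OF oG] p F(2) h eq by (intro exI[of _ "{q \<in> pts M. \<pi> q \<in> G}"] exI[of _ h]) auto
qed

text \<open>The adjoint of d\<pi> applied to a field along \<pi>, obtained as the Riesz vector of w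
  \<mapsto> g(Y, d\<pi> w). \<open>Y\<close> may vary along the fibres, so that d\<pi>(E) is
  included besides fields pulled back from \<open>B\<close>.\<close>

lemma adjoint_field:
  assumes Y: "\<And>p. p \<in> pts M \<Longrightarrow> Y p \<in> B.T (\<pi> p)"
    and sm: "\<And>Z. B.VF Z \<Longrightarrow> (\<lambda>p. B.g (\<pi> p) (Z (\<pi> p)) (Y p)) \<in> smf M"
  obtains V where "M.VF V" "\<And>p w. p \<in> pts M \<Longrightarrow> w \<in> M.T p \<Longrightarrow> M.g p (V p) w = B.g (\<pi> p) (Y p) (pf w)"
proof -
  have "M.one_form (\<lambda>p w. B.g (\<pi> p) (Y p) (pf w))"
    unfolding M.one_form_def
  proof (intro conjI ballI allI impI)
    show "(\<lambda>p. B.g (\<pi> p) (Y p) (pf (W p))) \<in> smf M" if "M.VF W" for W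
      by (rule pull_form_smooth[OF that Y sm])
    fix p u v and a b :: real assume p: "p \<in> pts M" and u: "u \<in> M.T p" and v: "v \<in> M.T p"
    note t = pf_tan[OF p u] pf_tan[OF p v] Y[OF p]
    show "B.g (\<pi> p) (Y p) (pf (\<lambda>f. a * u f + b * v f)) =
      a * B.g (\<pi> p) (Y p) (pf u) + b * B.g (\<pi> p) (Y p) (pf v)"
      by (simp add: pf_lin B.met_add_right[OF pi_pts[OF p]] B.met_scale_right[OF pi_pts[OF p]] B.tv_scale t)
  qed
  then show thesis by (rule M.riesz) (rule that)
qed

lemma adjoint_vector:
  assumes p: "p \<in> pts M" and u: "u \<in> B.T (\<pi> p)"
  shows "\<exists>a\<in>M.T p. \<forall>w\<in>M.T p. M.g p a w = B.g (\<pi> p) u (pf w)"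
proof -
  obtain Y where Y: "B.VF Y" "Y (\<pi> p) = u" using B.extension_exists[OF pi_pts[OF p] u] by blast
  obtain V where V: "M.VF V" "\<And>p w. p \<in> pts M \<Longrightarrow> w \<in> M.T p \<Longrightarrow> M.g p (V p) w = B.g (\<pi> p) (Y (\<pi> p)) (pf w)"
  proof (rule adjoint_field[of "\<lambda>p. Y (\<pi> p)"])
    show "Y (\<pi> p) \<in> B.T (\<pi> p)" if "p \<in> pts M" for p using B.vf_tan[OF Y(1) pi_pts[OF that]] .
    show "(\<lambda>p. B.g (\<pi> p) (Z (\<pi> p)) (Y (\<pi> p))) \<in> smf M" if "B.VF Z" for Z
      using comp_smf[OF B.met_smooth[OF that Y(1)]] by (simp add: o_def)
  qed blast
  then show ?thesis using M.vf_tan p Y(2) by blast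
qed

text \<open>Write \<open>A\<close> for the adjoint of the differential \<open>d\<pi>\<close>. Its values are horizontal, so that
  \<open>\<langle>d\<pi> A u, d\<pi> A v\<rangle> = \<langle>A u, A v\<rangle> = \<langle>u, d\<pi> A v\<rangle>\<close>; hence \<open>\<langle>A c, A v\<rangle> = 0\<close> for
  \<open>c = d\<pi> A u - u\<close> and all \<open>v\<close>, and \<open>A\<close> is injective.\<close>

lemma adjoint_lift:
  assumes p: "p \<in> pts M" and a: "a \<in> M.T p" and u: "u \<in> B.T (\<pi> p)"
    and adj: "\<forall>w\<in>M.T p. M.g p a w = B.g (\<pi> p) u (pf w)"
  shows "a \<in> Hor p" "pf a = u"
proof -
  note bp = pi_pts[OF p]
  have H: "a \<in> Hor p" if "a \<in> M.T p" "u \<in> B.T (\<pi> p)" "\<forall>w\<in>M.T p. M.g p a w = B.g (\<pi> p) u (pf w)" for a u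
    unfolding Hor_iff
  proof (intro conjI ballI)
    fix v assume v: "v \<in> Ver p"
    have "M.g p v a = M.g p a v" by (rule M.met_sym[OF p Ver_tan[OF v] that(1)])
    also have "\<dots> = B.g (\<pi> p) u (\<lambda>f. 0)" using v that(3) by (simp add: Ver_iff)
    also have "\<dots> = 0" by (rule B.met_zero_right[OF bp that(2)])
    finally show "M.g p v a = 0" .
  qed fact
  show aH: "a \<in> Hor p" by (rule H[OF a u adj])
  define c where "c = (\<lambda>f. pf a f - u f)"
  have pa: "pf a \<in> B.T (\<pi> p)" by (rule pf_tan[OF p a])
  have c: "c \<in> B.T (\<pi> p)" unfolding c_def by (rule B.tv_minus'[OF pa u])
  obtain k where k: "k \<in> M.T p" "\<forall>w\<in>M.T p. M.g p k w = B.g (\<pi> p) c (pf w)"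
    using adjoint_vector[OF p c] by blast
  have kH: "k \<in> Hor p" by (rule H[OF k(1) c k(2)])
  have "M.g p k k = B.g (\<pi> p) c (pf k)" using k by blast
  also have "\<dots> = B.g (\<pi> p) (pf a) (pf k) - B.g (\<pi> p) u (pf k)"
    unfolding c_def by (rule B.met_diff_left[OF bp pa u pf_tan[OF p k(1)]])
  also have "\<dots> = 0" using isometry[OF p aH kH] adj k(1) by simp
  finally have k0: "k = (\<lambda>f. 0)" using M.met_pos[OF p k(1)] by force
  have "c = (\<lambda>f. 0)"
  proof (rule ccontr)
    assume "c \<noteq> (\<lambda>f. 0)"
    then have "B.g (\<pi> p) c c > 0" by (rule B.met_pos[OF bp c])
    moreover obtain w where "w \<in> M.T p" "c = pf w" using pf_surj[OF p] c by blast
    ultimately show False using k(2) k0 M.met_zero_left[OF p] by force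
  qed
  then show "pf a = u" by (simp add: c_def fun_eq_iff)
qed

text \<open>The adjoint of d\<pi> applied to d\<pi> w is a horizontal vector with the same image as
  \<open>w\<close>, so the difference is vertical.\<close>

lemma hor_exists:
  assumes p: "p \<in> pts M" and w: "w \<in> M.T p"
  obtains h where "h \<in> Hor p" "pf h = pf w" "(\<lambda>f. w f - h f) \<in> Ver p"
proof -
  obtain a where "a \<in> M.T p" "\<forall>w'\<in>M.T p. M.g p a w' = B.g (\<pi> p) (pf w) (pf w')"
    using adjoint_vector[OF p pf_tan[OF p w]] by blast
  from adjoint_lift[OF p this(1) pf_tan[OF p w] this(2)] show thesis
    using w by (intro that[of a]) (auto simp: Ver_iff pf_diff Hor_tan M.tv_minus')
qed

text \<open>Two candidates for the horizontal part differ by a vector that is both horizontal and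
  vertical; this uniqueness resolves the definite descriptions.\<close>

lemma hor_eqI:
  assumes p: "p \<in> pts M" and h: "h \<in> Hor p" and v: "(\<lambda>f. w f - h f) \<in> Ver p"
  shows "hor p w = h" "ver p w = (\<lambda>f. w f - h f)"
proof -
  have uniq: "h' = h" if "h' \<in> Hor p" "(\<lambda>f. w f - h' f) \<in> Ver p" for h'
  proof -
    have "(\<lambda>f. h' f - h f) \<in> Hor p" by (rule Hor_diff[OF p that(1) h])
    moreover have "(\<lambda>f. h' f - h f) \<in> Ver p" using Ver_diff[OF v that(2)] by simp
    ultimately have "(\<lambda>f. h' f - h f) = (\<lambda>f. 0)" using Ver_Int_Hor[OF p] by blast
    then show ?thesis by (simp add: fun_eq_iff)
  qed
  show "hor p w = h"
    unfolding horizontal_part_def using h v uniq by blast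
  show "ver p w = (\<lambda>f. w f - h f)"
    unfolding vertical_part_def
  proof (rule the_equality)
    show "(\<lambda>f. w f - h f) \<in> Ver p \<and> (\<lambda>f. w f - (w f - h f)) \<in> Hor p" using h v by simp
    fix v' assume "v' \<in> Ver p \<and> (\<lambda>f. w f - v' f) \<in> Hor p"
    then have "(\<lambda>f. w f - v' f) = h" by (intro uniq) simp_all
    then show "v' = (\<lambda>f. w f - h f)" by auto
  qed
qed

lemma hor_ver:
  assumes p: "p \<in> pts M" and w: "w \<in> M.T p"
  shows hor_Hor: "hor p w \<in> Hor p" and ver_Ver: "ver p w \<in> Ver p"
    and pf_hor: "pf (hor p w) = pf w" and ver_eq: "ver p w = (\<lambda>f. w f - hor p w f)"
proof -
  obtain h where "h \<in> Hor p" "pf h = pf w" "(\<lambda>f. w f - h f) \<in> Ver p" by (rule hor_exists[OF p w])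
  with hor_eqI[OF p this(1,3)]
  show "hor p w \<in> Hor p" "ver p w \<in> Ver p" "pf (hor p w) = pf w" "ver p w = (\<lambda>f. w f - hor p w f)"
    by simp_all
qed

lemma hor_of_Hor: "p \<in> pts M \<Longrightarrow> w \<in> Hor p \<Longrightarrow> hor p w = w"
  and ver_of_Hor: "p \<in> pts M \<Longrightarrow> w \<in> Hor p \<Longrightarrow> ver p w = (\<lambda>f. 0)"
  using hor_eqI[of p w w] Ver_zero by simp_all

lemma hor_of_Ver: "p \<in> pts M \<Longrightarrow> v \<in> Ver p \<Longrightarrow> hor p v = (\<lambda>f. 0)"
  and ver_of_Ver: "p \<in> pts M \<Longrightarrow> v \<in> Ver p \<Longrightarrow> ver p v = v"
  using hor_eqI[of p "\<lambda>f. 0" v] Hor_zero by simp_all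

lemma met_ver:
  assumes p: "p \<in> pts M" and w: "w \<in> M.T p" and v: "v \<in> Ver p"
  shows "M.g p (ver p w) v = M.g p w v"
  using hor_ver[OF p w] Hor_Ver[OF p v] w v
  by (simp add: M.met_diff_left[OF p] Hor_tan Ver_tan)

lemma met_hor:
  assumes p: "p \<in> pts M" and w: "w \<in> M.T p" and v: "v \<in> Hor p"
  shows "M.g p (hor p w) v = M.g p w v"
proof -
  have "M.g p (ver p w) v = 0" using Ver_Hor[OF ver_Ver[OF p w] v] .
  then show ?thesis
    using hor_ver[OF p w] w v by (simp add: M.met_diff_left[OF p] Hor_tan)
qed

text \<open>The horizontal part is the adjoint of d\<pi> applied to d\<pi>(E), a field along \<pi>,
  and adjoints of such fields are smooth.\<close>

lemma vf_hor:
  assumes E: "M.VF E"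
  shows "M.VF (\<lambda>p. hor p (E p))"
proof -
  obtain V where V: "M.VF V" "\<And>p w. p \<in> pts M \<Longrightarrow> w \<in> M.T p \<Longrightarrow> M.g p (V p) w = B.g (\<pi> p) (pf (E p)) (pf w)"
  proof (rule adjoint_field[of "\<lambda>p. pf (E p)"])
    show "pf (E p) \<in> B.T (\<pi> p)" if "p \<in> pts M" for p using pf_tan[OF that M.vf_tan[OF E that]] .
    show "(\<lambda>p. B.g (\<pi> p) (Z (\<pi> p)) (pf (E p))) \<in> smf M" if Z: "B.VF Z" for Z
    proof (rule pull_form_smooth[OF E])
      show "Z (\<pi> p) \<in> B.T (\<pi> p)" if "p \<in> pts M" for p using B.vf_tan[OF Z pi_pts[OF that]] .
      show "(\<lambda>p. B.g (\<pi> p) (Z' (\<pi> p)) (Z (\<pi> p))) \<in> smf M" if "B.VF Z'" for Z'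
        using comp_smf[OF B.met_smooth[OF that Z]] by (simp add: o_def)
    qed
  qed blast
  have "hor p (E p) = V p" if p: "p \<in> pts M" for p
  proof -
    note Et = M.vf_tan[OF E p] and Vt = M.vf_tan[OF V(1) p]
    have "\<forall>w\<in>M.T p. M.g p (V p) w = B.g (\<pi> p) (pf (E p)) (pf w)" using V(2)[OF p] by blast
    note l = adjoint_lift[OF p Vt pf_tan[OF p Et] this]
    show ?thesis
      using l Et Vt by (intro hor_eqI[OF p]) (auto simp: Ver_iff pf_diff M.tv_minus')
  qed
  then show ?thesis by (rule M.vf_cong[OF V(1)])
qed

lemma vf_ver:
  assumes E: "M.VF E"
  shows "M.VF (\<lambda>p. ver p (E p))"
  by (rule M.vf_cong[OF M.vf_diff[OF E vf_hor[OF E]]]) (simp add: ver_eq M.vf_tan[OF E])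

text \<open>The lift is the adjoint of d\<pi> applied to Y \<circ> \<pi>; it covers \<open>Y\<close>
  because the adjoint is a right inverse of d\<pi>.\<close>

lemma lift_exists:
  assumes Y: "B.VF Y"
  obtains V where "M.VF V" "\<And>p. p \<in> pts M \<Longrightarrow> V p \<in> Hor p" "\<And>p. p \<in> pts M \<Longrightarrow> pf (V p) = Y (\<pi> p)"
proof -
  obtain V where V: "M.VF V" "\<And>p w. p \<in> pts M \<Longrightarrow> w \<in> M.T p \<Longrightarrow> M.g p (V p) w = B.g (\<pi> p) (Y (\<pi> p)) (pf w)"
  proof (rule adjoint_field[of "\<lambda>p. Y (\<pi> p)"])
    show "Y (\<pi> p) \<in> B.T (\<pi> p)" if "p \<in> pts M" for p using B.vf_tan[OF Y pi_pts[OF that]] .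
    show "(\<lambda>p. B.g (\<pi> p) (Z (\<pi> p)) (Y (\<pi> p))) \<in> smf M" if "B.VF Z" for Z
      using comp_smf[OF B.met_smooth[OF that Y]] by (simp add: o_def)
  qed blast
  show thesis
  proof (rule that[OF V(1)])
    fix p assume p: "p \<in> pts M"
    have "\<forall>w\<in>M.T p. M.g p (V p) w = B.g (\<pi> p) (Y (\<pi> p)) (pf w)" using V(2)[OF p] by blast
    note l = adjoint_lift[OF p M.vf_tan[OF V(1) p] B.vf_tan[OF Y pi_pts[OF p]] this]
    show "V p \<in> Hor p" "pf (V p) = Y (\<pi> p)" by (rule l)+
  qed
qed

lemma Hor_pf_inj:
  assumes p: "p \<in> pts M" and "v \<in> Hor p" "w \<in> Hor p" "pf v = pf w"
  shows "v = w"
proof -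
  have "(\<lambda>f. v f - w f) \<in> Ver p"
    using assms by (simp add: Ver_iff Hor_tan M.tv_minus' pf_diff)
  from Ver_Int_Hor[OF p this Hor_diff[OF p assms(2,3)]] show ?thesis by (simp add: fun_eq_iff)
qed

end

section \<open>Functions and vectors along a submersion\<close>

context mfd begin

lemma linear_cv:
  assumes "ch U \<phi>" "q \<in> U" "f \<in> smf M"
  shows "linear (\<lambda>\<xi>. cv U \<phi> q \<xi> f)"
  using rep_has_derivative[OF assms] has_derivative_linear by blast

text \<open>Evaluating on the coordinate functions of a frame around \<open>q\<close> reads off the
  components of the direction.\<close>

lemma cv_inj:
  assumes c: "ch U \<phi>" and q: "q \<in> U" and \<xi>: "\<xi> \<in> model M" "\<zeta> \<in> model M"
    and eq: "cv U \<phi> q \<xi> = cv U \<phi> q \<zeta>"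
  shows "\<xi> = \<zeta>"
proof -
  obtain x E H where F: "q \<in> H" "\<And>q i. q \<in> H \<Longrightarrow> i < n \<Longrightarrow> E i q = cv U \<phi> q (e i)"
    "\<And>q i j. q \<in> H \<Longrightarrow> i < n \<Longrightarrow> j < n \<Longrightarrow> E i q (x j) = (if i = j then 1 else 0)"
    by (rule coordinate_frame[OF c q chart_open[OF c] q]) blast
  have *: "cv U \<phi> q \<xi> (x j) = \<xi> \<bullet> e j" if "\<xi> \<in> model M" "j < n" for \<xi> j
  proof -
    have "cv U \<phi> q \<xi> (x j) = cv U \<phi> q (\<Sum>i<n. (\<xi> \<bullet> e i) *\<^sub>R e i) (x j)"
      using P_id[OF that(1)] by (simp add: P_def)
    also have "\<dots> = (\<Sum>i<n. (\<xi> \<bullet> e i) * E i q (x j))"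
      unfolding cv_lincomb[OF c q] by (rule sum.cong) (simp_all add: F(2)[OF F(1)])
    also have "\<dots> = (\<Sum>i<n. if i = j then \<xi> \<bullet> e i else 0)"
      by (rule sum.cong) (simp_all add: F(3)[OF F(1)] that(2))
    also have "\<dots> = \<xi> \<bullet> e j" using that(2) by simp
    finally show ?thesis .
  qed
  have "\<xi> \<bullet> e j = \<zeta> \<bullet> e j" if "j < n" for j
    using *[OF \<xi>(1) that] *[OF \<xi>(2) that] eq by simp
  then have "P \<xi> = P \<zeta>" by (simp add: P_def)
  then show ?thesis using P_id \<xi> by simp
qed

lemma P_P: "P (P x) = P x"
  by (rule P_id[OF P_in_model])

lemma rep_P: "rep U \<phi> f (P x) = rep U \<phi> f x"
  by (simp add: rep_def P_P)

end

section \<open>The submersion in coordinates\<close>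

context riem_submersion begin

lemma pi_onto: "b \<in> pts B \<Longrightarrow> \<exists>p. p \<in> pts M \<and> \<pi> p = b"
  using surj by (metis imageE)

text \<open>\<pi> in charts, precomposed with \<open>M.P\<close> so that it is defined on the open
  set \<open>cdom\<close>; there its values lie in the model of \<open>B\<close>.\<close>

definition cpi :: "'a set \<Rightarrow> ('a \<Rightarrow> 'm) \<Rightarrow> ('b \<Rightarrow> 'n) \<Rightarrow> 'm \<Rightarrow> 'n" where
  "cpi U \<phi> \<psi> x = \<psi> (\<pi> (inv_into U \<phi> (M.P x)))"

definition cdom :: "'a set \<Rightarrow> ('a \<Rightarrow> 'm) \<Rightarrow> 'b set \<Rightarrow> 'm set" where
  "cdom U \<phi> V = {x. M.P x \<in> \<phi> ` {q \<in> U. \<pi> q \<in> V}}"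

definition dcpi :: "'a set \<Rightarrow> ('a \<Rightarrow> 'm) \<Rightarrow> ('b \<Rightarrow> 'n) \<Rightarrow> 'a \<Rightarrow> 'm \<Rightarrow> 'n" where
  "dcpi U \<phi> \<psi> p = frechet_derivative (cpi U \<phi> \<psi>) (at (\<phi> p))"

context
  fixes U \<phi> V \<psi>
  assumes c: "M.ch U \<phi>" and c': "B.ch V \<psi>"
begin

lemma open_cdom: "open (cdom U \<phi> V)"
  unfolding cdom_def chart_preimage(2)[OF c c'] by (rule M.open_chart_dom[OF c chart_preimage(1)[OF c c']])

lemma Cinf_on_cpi: "Cinf_on (cpi U \<phi> \<psi>) (cdom U \<phi> V)"
  using Cinf_on_pi[OF c c'] by (simp add: cpi_def[abs_def] cdom_def)

lemma cdomD:
  assumes "x \<in> cdom U \<phi> V"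
  obtains q where "q \<in> U" "\<pi> q \<in> V" "M.P x = \<phi> q" "cpi U \<phi> \<psi> x = \<psi> (\<pi> q)" "\<And>k. M.rep U \<phi> k x = k q"
  using assms by (auto simp: cdom_def cpi_def M.rep_def M.inv_chart[OF c])

lemma P_cpi: "x \<in> cdom U \<phi> V \<Longrightarrow> B.P (cpi U \<phi> \<psi> x) = cpi U \<phi> \<psi> x"
  by (erule cdomD) (simp add: B.P_chart[OF c'])

lemma rep_comp: "x \<in> cdom U \<phi> V \<Longrightarrow> B.rep V \<psi> f (cpi U \<phi> \<psi> x) = M.rep U \<phi> (f \<circ> \<pi>) x"
  by (auto simp: cdom_def cpi_def M.rep_def B.rep_def M.inv_chart[OF c] B.inv_chart[OF c'] B.P_chart[OF c'])

context
  fixes p assumes p: "p \<in> U" and p': "\<pi> p \<in> V"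
begin

lemma in_cdom: "\<phi> p \<in> cdom U \<phi> V"
  and cpi_at: "cpi U \<phi> \<psi> (\<phi> p) = \<psi> (\<pi> p)"
  using p p' M.P_chart[OF c p] by (auto simp: cdom_def cpi_def M.inv_chart[OF c])

lemma cpi_has_derivative: "(cpi U \<phi> \<psi> has_derivative dcpi U \<phi> \<psi> p) (at (\<phi> p))"
  unfolding dcpi_def
  by (rule frechet_derivative_has_derivative[OF Cinf_on_differentiable[OF Cinf_on_cpi in_cdom]])

lemma linear_dcpi: "linear (dcpi U \<phi> \<psi> p)"
  using cpi_has_derivative has_derivative_linear by blast

text \<open>On \<open>cdom\<close> the map is fixed by composition with the linear projection
  \<open>B.P\<close>, hence so is its derivative.\<close>

lemma dcpi_in_model: "dcpi U \<phi> \<psi> p \<xi> \<in> model B"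
proof -
  have "((\<lambda>x. B.P (cpi U \<phi> \<psi> x)) has_derivative (\<lambda>\<xi>. B.P (dcpi U \<phi> \<psi> p \<xi>))) (at (\<phi> p))"
    by (rule bounded_linear.has_derivative[OF B.bounded_linear_P cpi_has_derivative])
  then have "(cpi U \<phi> \<psi> has_derivative (\<lambda>\<xi>. B.P (dcpi U \<phi> \<psi> p \<xi>))) (at (\<phi> p))"
    by (rule has_derivative_transform_within_open[OF _ open_cdom in_cdom]) (rule P_cpi)
  from has_derivative_unique[OF cpi_has_derivative this] show ?thesis
    using B.P_in_model by metis
qed

lemma pf_cv: "pf (M.cv U \<phi> p \<xi>) = B.cv V \<psi> (\<pi> p) (dcpi U \<phi> \<psi> p \<xi>)"
proof
  fix f
  show "pf (M.cv U \<phi> p \<xi>) f = B.cv V \<psi> (\<pi> p) (dcpi U \<phi> \<psi> p \<xi>) f"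
  proof (cases "f \<in> smf B")
    case True
    have "((\<lambda>x. B.rep V \<psi> f (cpi U \<phi> \<psi> x)) has_derivative
        (\<lambda>\<xi>. B.cv V \<psi> (\<pi> p) (dcpi U \<phi> \<psi> p \<xi>) f)) (at (\<phi> p))"
      by (rule has_derivative_compose[OF cpi_has_derivative])
         (simp add: cpi_at B.rep_has_derivative[OF c' p' True])
    then have "(M.rep U \<phi> (f \<circ> \<pi>) has_derivative (\<lambda>\<xi>. B.cv V \<psi> (\<pi> p) (dcpi U \<phi> \<psi> p \<xi>) f)) (at (\<phi> p))"
      by (rule has_derivative_transform_within_open[OF _ open_cdom in_cdom]) (rule rep_comp)
    from M.cv_unique[OF c p comp_smf[OF True] this] show ?thesis by (simp add: pf_apply[OF True])
  qed (simp add: pushforward_def B.cv_def)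
qed

text \<open>Surjectivity of d\<pi> on derivations carries over to chart directions because
  \<open>B.cv\<close> is injective on the model.\<close>

lemma dcpi_onto:
  assumes "\<zeta> \<in> model B"
  obtains \<xi> where "dcpi U \<phi> \<psi> p \<xi> = \<zeta>"
proof -
  have "B.cv V \<psi> (\<pi> p) \<zeta> \<in> pf ` M.T p"
    using pf_surj M.chart_subset[OF c] p B.cv_tangent[OF c' p'] by blast
  then obtain w where w: "w \<in> M.T p" "B.cv V \<psi> (\<pi> p) \<zeta> = pf w" by blast
  obtain \<xi> where "w = M.cv U \<phi> p \<xi>" by (rule M.tangent_cv[OF c p w(1)])
  then show thesis
    using B.cv_inj[OF c' p' dcpi_in_model assms, of \<xi>] w(2) pf_cv that by simp
qed

end
end

text \<open>If v h were nonzero, the pair (\<pi>, h) would have surjective differential at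
  \<open>p\<close>: d\<pi> is onto, and \<open>v\<close> moves \<open>h\<close> alone. Its image
  would then contain a neighbourhood of the image of \<open>p\<close>, so \<open>h\<close> would
  take nonzero values in \<open>G\<close> on the fibre.\<close>

lemma vertical_vanish:
  assumes p: "p \<in> pts M" and v: "v \<in> Ver p" and h: "h \<in> smf M" and G: "openin (rtop M) G" "p \<in> G"
    and h0: "\<And>q. q \<in> G \<Longrightarrow> \<pi> q = \<pi> p \<Longrightarrow> h q = 0"
  shows "v h = 0"
proof (rule ccontr)
  assume vh: "v h \<noteq> 0"
  obtain U \<phi> where U: "M.ch U \<phi>" "p \<in> U" using M.chart_at p by blast
  obtain V \<psi> where V: "B.ch V \<psi>" "\<pi> p \<in> V" using B.chart_at pi_pts[OF p] by blast
  define F where "F = cpi U \<phi> \<psi>"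
  define F' where "F' = dcpi U \<phi> \<psi> p"
  define A where "A = cdom U \<phi> V \<inter> {x. M.P x \<in> \<phi> ` (U \<inter> G)}"
  have oA: "open A"
    unfolding A_def by (intro open_Int open_cdom[OF U(1) V(1)] M.open_chart_dom[OF U(1) G(1)])
  have pA: "\<phi> p \<in> A"
    using in_cdom[OF U(1) V(1) U(2) V(2)] U G M.P_chart[OF U] by (auto simp: A_def)
  have dF: "(F has_derivative F') (at (\<phi> p))"
    unfolding F_def F'_def by (rule cpi_has_derivative[OF U(1) V(1) U(2) V(2)])
  have linF': "linear F'" unfolding F'_def by (rule linear_dcpi[OF U(1) V(1) U(2) V(2)])
  have F'm: "F' \<xi> \<in> model B" for \<xi> unfolding F'_def by (rule dcpi_in_model[OF U(1) V(1) U(2) V(2)])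
  \<comment> \<open>The summand \<open>snd z - B.P (snd z)\<close> fills the orthogonal complement
    of the model of \<open>B\<close>, so that the image can be open in the full space.\<close>
  define \<Phi> where "\<Phi> = (\<lambda>z. (F (fst z) + (snd z - B.P (snd z)), M.rep U \<phi> h (fst z)))"
  define \<Phi>' where "\<Phi>' = (\<lambda>z. (F' (fst z) + (snd z - B.P (snd z)), M.cv U \<phi> p (fst z) h))"
  have dP: "((\<lambda>z. snd z - B.P (snd z)) has_derivative (\<lambda>z. snd z - B.P (snd z))) (at x)" for x :: "'m \<times> 'n"
    by (intro has_derivative_diff bounded_linear.has_derivative[OF B.bounded_linear_P] has_derivative_snd has_derivative_ident)
  have d\<Phi>: "(\<Phi> has_derivative \<Phi>') (at (\<phi> p, 0))"
    unfolding \<Phi>_def \<Phi>'_def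
    by (intro has_derivative_Pair has_derivative_add dP
        has_derivative_compose[OF has_derivative_fst[OF has_derivative_ident]])
      (simp_all add: dF M.rep_has_derivative[OF U h])
  have cont: "continuous_on (A \<times> UNIV) \<Phi>"
  proof -
    have "continuous_on (cdom U \<phi> V) F"
      unfolding F_def by (rule Cinf_on_continuous[OF Cinf_on_cpi[OF U(1) V(1)]])
    then have 1: "continuous_on A F" by (rule continuous_on_subset) (simp add: A_def)
    have 2: "continuous_on A (M.rep U \<phi> h)"
      by (rule continuous_on_subset[OF Cinf_on_continuous[OF M.Cinf_on_rep[OF h U(1)]]]) (auto simp: A_def)
    show ?thesis unfolding \<Phi>_def
      by (intro continuous_on_Pair continuous_on_add continuous_on_diff
          continuous_on_compose2[OF 1] continuous_on_compose2[OF 2]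
          continuous_on_compose2[OF linear_continuous_on[OF B.bounded_linear_P]] continuous_on_fst continuous_on_snd continuous_on_id)
         auto
  qed
  have lin: "linear \<Phi>'" using d\<Phi> has_derivative_linear by blast
  have "surj \<Phi>'"
    unfolding surj_def
  proof
    fix yt :: "'n \<times> real"
    obtain y t where yt: "yt = (y, t)" by (cases yt)
    obtain \<xi> where \<xi>: "F' \<xi> = B.P y"
      unfolding F'_def by (rule dcpi_onto[OF U(1) V(1) U(2) V(2) B.P_in_model])
    obtain \<zeta> where \<zeta>: "v = M.cv U \<phi> p \<zeta>" by (rule M.tangent_cv[OF U Ver_tan[OF v]])
    have "B.cv V \<psi> (\<pi> p) (F' \<zeta>) = (\<lambda>f. 0)"
      using v pf_cv[OF U(1) V(1) U(2) V(2), of \<zeta>] by (simp add: Ver_iff \<zeta> F'_def)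
    also have "\<dots> = B.cv V \<psi> (\<pi> p) 0"
      using B.cv_lincomb[OF V, of "\<lambda>i. 0" "\<lambda>i. 0" "{}"] by auto
    finally have F'\<zeta>: "F' \<zeta> = 0"
      using B.cv_inj[OF V F'm subspace_0[OF B.subspace_model]] by blast
    \<comment> \<open>Moving along \<zeta>, which F' kills, changes only the last component, at rate
      \<open>v h\<close>; this multiple adjusts it to \<open>t\<close>.\<close>
    define s where "s = (t - M.cv U \<phi> p \<xi> h) / v h"
    have "\<Phi>' (\<xi> + s *\<^sub>R \<zeta>, y - B.P y) = (y, t)"
      using vh by (simp add: \<Phi>'_def \<xi> F'\<zeta> linear_add[OF linF'] linear_scale[OF linF']
        linear_diff[OF B.linear_P] B.P_P linear_add[OF M.linear_cv[OF U h]] linear_scale[OF M.linear_cv[OF U h]]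
        s_def \<zeta>)
    then show "\<exists>z. yt = \<Phi>' z" using yt by metis
  qed
  then obtain g' where g': "linear g'" "\<Phi>' \<circ> g' = id"
    using linear_surjective_right_inverse[OF lin] by blast
  have "\<Phi> (\<phi> p, 0) \<in> interior (\<Phi> ` (A \<times> UNIV))"
  proof (rule sussmann_open_mapping[OF _ cont _ d\<Phi> _ g'(2)])
    show "open (A \<times> (UNIV :: 'n set))" by (intro open_Times oA open_UNIV)
    then show "(\<phi> p, 0) \<in> interior (A \<times> (UNIV :: 'n set))" using pA by (simp add: interior_open)
    show "bounded_linear g'" using g'(1) by (simp add: linear_conv_bounded_linear)
  qed (use pA in auto)
  moreover have "\<Phi> (\<phi> p, 0) = (\<psi> (\<pi> p), 0)"
    using cpi_at[OF U(1) V(1) U(2) V(2)] M.rep_chart[OF U, of h] h0[OF G(2)]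
    by (simp add: \<Phi>_def F_def linear_0[OF B.linear_P])
  ultimately obtain \<epsilon> where \<epsilon>: "\<epsilon> > 0" "ball (\<psi> (\<pi> p), 0) \<epsilon> \<subseteq> \<Phi> ` (A \<times> UNIV)"
    by (auto simp: mem_interior)
  \<comment> \<open>A target with the same base point but a nonzero value of
    \<open>h\<close>.\<close>
  have "(\<psi> (\<pi> p), \<epsilon> / 2) \<in> ball (\<psi> (\<pi> p), 0) \<epsilon>"
    using \<epsilon>(1) by (simp add: dist_Pair_Pair)
  then obtain a z where az: "a \<in> A" "\<Phi> (a, z) = (\<psi> (\<pi> p), \<epsilon> / 2)" using \<epsilon>(2) by fastforce
  have ad: "a \<in> cdom U \<phi> V" using az by (simp add: A_def)
  \<comment> \<open>Applying \<open>B.P\<close> removes the auxiliary summand.\<close>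
  have "B.P (F a + (z - B.P z)) = B.P (\<psi> (\<pi> p))" using az(2) by (simp add: \<Phi>_def)
  then have Fa: "F a = \<psi> (\<pi> p)"
    using P_cpi[OF U(1) V(1) ad] B.P_chart[OF V]
    by (simp add: linear_add[OF B.linear_P] linear_diff[OF B.linear_P] B.P_P F_def)
  obtain q where q: "q \<in> U" "\<pi> q \<in> V" "M.P a = \<phi> q" "F a = \<psi> (\<pi> q)" "\<And>k. M.rep U \<phi> k a = (k q :: real)"
    unfolding F_def by (rule cdomD[OF U(1) V(1) ad]) blast
  have "\<pi> q = \<pi> p" using B.chart_inj[OF V(1)] q(2,4) Fa V(2) by (auto simp: inj_on_def)
  moreover have "q \<in> G"
    using az(1) q(1,3) M.chart_inj[OF U(1)] by (auto simp: A_def inj_on_def)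
  ultimately have "h q = 0" by (rule h0[rotated])
  moreover have "h q = \<epsilon> / 2" using az(2) q(5)[of h] by (simp add: \<Phi>_def)
  ultimately show False using \<epsilon>(1) by simp
qed

text \<open>A local section of \<pi>: along an affine slice \<open>K\<close> transversal to the
  fibre \<pi> is a local diffeomorphism by the inverse function theorem, and \<open>h\<close> is the
  composition of its inverse, \<open>K\<close> and h \<circ> \<pi>.\<close>

lemma descend_differentiable:
  assumes h: "h \<circ> \<pi> \<in> smf M" and U: "M.ch U \<phi>" "p \<in> U" and V: "B.ch V \<psi>" "\<pi> p \<in> V"
  shows "B.rep V \<psi> h differentiable (at (\<psi> (\<pi> p)))"
proof -
  define F where "F = cpi U \<phi> \<psi>"
  define F' where "F' = dcpi U \<phi> \<psi> p"
  define A where "A = cdom U \<phi> V"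
  have oA: "open A" unfolding A_def by (rule open_cdom[OF U(1) V(1)])
  have dF: "(F has_derivative F') (at (\<phi> p))"
    unfolding F_def F'_def by (rule cpi_has_derivative[OF U(1) V(1) U(2) V(2)])
  have linF': "linear F'" unfolding F'_def by (rule linear_dcpi[OF U(1) V(1) U(2) V(2)])
  have "\<exists>\<xi>. F' \<xi> = d i" if "i < m" for i
    unfolding F'_def by (rule dcpi_onto[OF U(1) V(1) U(2) V(2) B.e_in_model[OF that]]) blast
  then obtain \<xi> where \<xi>: "\<And>i. i < m \<Longrightarrow> F' (\<xi> i) = d i" by metis
  \<comment> \<open>A right inverse of F' on the model of \<open>B\<close>; on the whole space F'
    after \<open>L\<close> is the projection \<open>B.P\<close>.\<close>
  define L where "L = (\<lambda>z. \<Sum>i<m. (z \<bullet> d i) *\<^sub>R \<xi> i)"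
  have linL: "linear L"
    unfolding L_def by (rule linearI) (simp_all add: inner_add_left scaleR_add_left sum.distrib scaleR_sum_right)
  then have bL: "bounded_linear L" by (simp add: linear_conv_bounded_linear)
  have F'L: "F' (L z) = B.P z" for z
    by (simp add: L_def B.P_def linear_sum[OF linF'] linear_scale[OF linF'] \<xi>)
  define K where "K = (\<lambda>z. \<phi> p + L z)"
  have CK: "Cinf_on K S" for S
    unfolding K_def
    by (rule Cinf_on_subset[of _ UNIV]) (intro Cinf_on_add open_UNIV Cinf_on_const Cinf_on_linear bL subset_UNIV)+
  define Z where "Z = K -` A"
  have oZ: "open Z"
    unfolding Z_def by (rule open_vimage[OF oA Cinf_on_continuous[OF CK]])
  \<comment> \<open>The summand z - P z makes the derivative at 0 the identity of the whole space: P
    z + (z - P z) = z.\<close>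
  define G where "G = (\<lambda>z. F (K z) + (z - B.P z))"
  have CG: "Cinf_on G Z"
    unfolding G_def
    by (intro Cinf_on_add Cinf_on_diff oZ Cinf_on_id B.Cinf_on_P
        Cinf_on_compose[OF oZ oA _ CK Cinf_on_cpi[OF U(1) V(1), folded A_def F_def]]) (auto simp: Z_def)
  have K0: "K 0 = \<phi> p" by (simp add: K_def linear_0[OF linL])
  have Z0: "0 \<in> Z" using in_cdom[OF U(1) V(1) U(2) V(2)] by (simp add: Z_def K0 A_def)
  have G0: "G 0 = \<psi> (\<pi> p)"
    using cpi_at[OF U(1) V(1) U(2) V(2)] by (simp add: G_def K0 F_def linear_0[OF B.linear_P])
  define G' where "G' z = Blinfun (frechet_derivative G (at z))" for z
  have dG: "(G has_derivative blinfun_apply (G' z)) (at z)" and G': "blinfun_apply (G' z) = frechet_derivative G (at z)"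
    if "z \<in> Z" for z
  proof -
    have "(G has_derivative frechet_derivative G (at z)) (at z)"
      by (rule frechet_derivative_has_derivative[OF Cinf_on_differentiable[OF CG that]])
    moreover from this show "blinfun_apply (G' z) = frechet_derivative G (at z)"
      unfolding G'_def by (intro bounded_linear_Blinfun_apply has_derivative_bounded_linear)
    ultimately show "(G has_derivative blinfun_apply (G' z)) (at z)" by simp
  qed
  have contG': "continuous_on Z G'"
  proof (rule continuous_on_blinfun_componentwise)
    fix b :: 'n
    have "continuous_on Z (\<lambda>z. frechet_derivative G (at z) b)"
      by (rule Cinf_on_continuous[OF Cinf_on_derivative[OF CG]])
    then show "continuous_on Z (\<lambda>z. blinfun_apply (G' z) b)"
      by (rule continuous_on_eq) (simp add: G')
  qed
  have "(G has_derivative (\<lambda>z. F' (L z) + (z - B.P z))) (at 0)"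
    unfolding G_def
  proof (intro has_derivative_add has_derivative_diff has_derivative_ident
      bounded_linear_imp_has_derivative[OF B.bounded_linear_P])
    have "(K has_derivative L) (at 0)"
      unfolding K_def by (rule has_derivative_eq_rhs[OF has_derivative_add[OF has_derivative_const bounded_linear_imp_has_derivative[OF bL]]]) simp
    then show "((\<lambda>z. F (K z)) has_derivative (\<lambda>z. F' (L z))) (at 0)"
      by (rule has_derivative_compose) (simp add: K0 dF)
  qed
  then have "blinfun_apply (G' 0) = (\<lambda>z. z)"
    using has_derivative_unique[OF dG[OF Z0]] by (simp add: F'L)
  then have "id_blinfun o\<^sub>L G' 0 = id_blinfun"
    by (intro blinfun_eqI) simp
  then obtain U' V' g g' where g: "0 \<in> U'" "U' \<subseteq> Z" "open V'" "G 0 \<in> V'" "homeomorphism U' V' G g"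
    "\<And>y. y \<in> V' \<Longrightarrow> (g has_derivative (g' y)) (at y)"
    using inverse_function_theorem[OF oZ dG contG' Z0] by metis
  have g0: "g (G 0) = 0" using g(1,5) by (simp add: homeomorphism_def)
  have eq: "M.rep U \<phi> (h \<circ> \<pi>) (K (g y)) = B.rep V \<psi> h y" if y: "y \<in> V'" for y
  proof -
    have gy: "g y \<in> Z" "G (g y) = y" using y g(2,5) by (auto simp: homeomorphism_def)
    then have a: "K (g y) \<in> cdom U \<phi> V" by (simp add: Z_def A_def)
    have "B.P y = B.P (F (K (g y)) + (g y - B.P (g y)))" using gy(2) by (simp add: G_def)
    also have "\<dots> = F (K (g y))"
      using P_cpi[OF U(1) V(1) a] by (simp add: linear_add[OF B.linear_P] linear_diff[OF B.linear_P] B.P_P F_def)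
    finally have "B.rep V \<psi> h y = B.rep V \<psi> h (F (K (g y)))" using B.rep_P[of V \<psi> h y] by simp
    then show ?thesis using rep_comp[OF U(1) V(1) a, of h] by (simp add: F_def)
  qed
  have "((\<lambda>y. M.rep U \<phi> (h \<circ> \<pi>) (K (g y))) has_derivative
      (\<lambda>y. M.cv U \<phi> p (L (g' (G 0) y)) (h \<circ> \<pi>))) (at (G 0))"
  proof (rule has_derivative_compose[of "\<lambda>y. K (g y)"])
    show "((\<lambda>y. K (g y)) has_derivative (\<lambda>y. L (g' (G 0) y))) (at (G 0))"
      unfolding K_def
      by (rule has_derivative_eq_rhs[OF has_derivative_add[OF has_derivative_const
            bounded_linear.has_derivative[OF bL g(6)[OF g(4)]]]]) simp
    show "(M.rep U \<phi> (h \<circ> \<pi>) has_derivative (\<lambda>\<xi>. M.cv U \<phi> p \<xi> (h \<circ> \<pi>))) (at (K (g (G 0))))"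
      by (simp add: g0 K0 M.rep_has_derivative[OF U h])
  qed
  then have "(B.rep V \<psi> h has_derivative (\<lambda>y. M.cv U \<phi> p (L (g' (G 0) y)) (h \<circ> \<pi>))) (at (G 0))"
    by (rule has_derivative_transform_within_open[OF _ g(3,4) eq])
  then show ?thesis unfolding G0 by (auto simp: differentiable_def)
qed

text \<open>As \<open>h\<close> is not yet known to be smooth, the pushforward says nothing about
  \<open>h\<close> itself; the chain rule at one point does. In consequence
  \<open>w (h \<circ> \<pi>)\<close> depends only on d\<pi> w.\<close>

lemma descend_derivative:
  assumes h: "h \<circ> \<pi> \<in> smf M" and p: "p \<in> pts M" and V: "B.ch V \<psi>" "\<pi> p \<in> V" and w: "w \<in> M.T p"
    and pw: "pf w = B.cv V \<psi> (\<pi> p) \<zeta>" and \<zeta>: "\<zeta> \<in> model B"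
  shows "w (h \<circ> \<pi>) = frechet_derivative (B.rep V \<psi> h) (at (\<psi> (\<pi> p))) \<zeta>"
proof -
  obtain U \<phi> where U: "M.ch U \<phi>" "p \<in> U" using M.chart_at p by blast
  obtain \<xi> where \<xi>: "w = M.cv U \<phi> p \<xi>" by (rule M.tangent_cv[OF U w])
  have "dcpi U \<phi> \<psi> p \<xi> = \<zeta>"
    using pw pf_cv[OF U(1) V(1) U(2) V(2), of \<xi>] B.cv_inj[OF V dcpi_in_model[OF U(1) V(1) U(2) V(2)] \<zeta>] \<xi> by simp
  moreover have "((\<lambda>x. B.rep V \<psi> h (cpi U \<phi> \<psi> x)) has_derivative
      (\<lambda>\<xi>. frechet_derivative (B.rep V \<psi> h) (at (\<psi> (\<pi> p))) (dcpi U \<phi> \<psi> p \<xi>))) (at (\<phi> p))"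
    by (rule has_derivative_compose[OF cpi_has_derivative[OF U(1) V(1) U(2) V(2)]])
       (simp add: cpi_at[OF U(1) V(1) U(2) V(2)] frechet_derivative_has_derivative descend_differentiable[OF h U V])
  then have "(M.rep U \<phi> (h \<circ> \<pi>) has_derivative
      (\<lambda>\<xi>. frechet_derivative (B.rep V \<psi> h) (at (\<psi> (\<pi> p))) (dcpi U \<phi> \<psi> p \<xi>))) (at (\<phi> p))"
    by (rule has_derivative_transform_within_open[OF _ open_cdom[OF U(1) V(1)] in_cdom[OF U(1) V(1) U(2) V(2)]])
       (rule rep_comp[OF U(1) V(1)])
  ultimately show ?thesis using M.cv_unique[OF U h] \<xi> by metis
qed

text \<open>Directional derivatives of \<open>h\<close> pull back to derivatives of \<open>h \<circ> \<pi>\<close> along horizontal lifts,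
  which are smooth again; so the differentiability class of \<open>h\<close> can be raised step by step.\<close>

lemma descend_Ck:
  assumes "h \<circ> \<pi> \<in> smf M" "B.ch V \<psi>"
  shows "Ck_on k (B.rep V \<psi> h) {y. B.P y \<in> \<psi> ` V}"
  using assms
proof (induction k arbitrary: h V \<psi>)
  case (0 h V \<psi>)
  note h = 0(1) and V = 0(2)
  show ?case
    unfolding Ck_on.simps
  proof (intro continuous_at_imp_continuous_on ballI)
    fix y assume "y \<in> {y. B.P y \<in> \<psi> ` V}"
    then obtain b where b: "b \<in> V" "B.P y = \<psi> b" by auto
    then obtain p where p: "p \<in> pts M" "\<pi> p = b" using pi_onto B.chart_subset[OF V] by blast
    obtain U \<phi> where U: "M.ch U \<phi>" "p \<in> U" using M.chart_at p by blast
    have "B.rep V \<psi> h differentiable (at (B.P y))"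
      using descend_differentiable[OF h U V] b p by simp
    then have "isCont (B.rep V \<psi> h) (B.P y)" by (rule differentiable_imp_continuous_within)
    then have "isCont (\<lambda>y. B.rep V \<psi> h (B.P y)) y"
      by (rule isCont_o2[OF linear_continuous_at[OF B.bounded_linear_P]])
    then show "isCont (B.rep V \<psi> h) y" by (simp add: B.rep_P)
  qed
next
  case (Suc k h V \<psi>)
  note h = Suc.prems(1) and V = Suc.prems(2)
  let ?d = "{y. B.P y \<in> \<psi> ` V}"
  have d: "(B.rep V \<psi> h has_derivative (\<lambda>v. frechet_derivative (B.rep V \<psi> h) (at (B.P y)) (B.P v))) (at y)"
    if "y \<in> ?d" for y
  proof -
    from that obtain b where b: "b \<in> V" "B.P y = \<psi> b" by auto
    then obtain p where p: "p \<in> pts M" "\<pi> p = b" using pi_onto B.chart_subset[OF V] by blast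
    obtain U \<phi> where U: "M.ch U \<phi>" "p \<in> U" using M.chart_at p by blast
    have "B.rep V \<psi> h differentiable (at (B.P y))"
      using descend_differentiable[OF h U V] b p by simp
    then have "((\<lambda>y. B.rep V \<psi> h (B.P y)) has_derivative (\<lambda>v. frechet_derivative (B.rep V \<psi> h) (at (B.P y)) (B.P v))) (at y)"
      by (intro has_derivative_compose[OF bounded_linear_imp_has_derivative[OF B.bounded_linear_P]] frechet_derivative_has_derivative)
    then show ?thesis by (simp add: B.rep_P)
  qed
  have "Ck_on k (\<lambda>y. frechet_derivative (B.rep V \<psi> h) (at y) v) ?d" for v
  proof (rule Ck_on_local)
    fix y0 assume "y0 \<in> ?d"
    then obtain b where b: "b \<in> V" "B.P y0 = \<psi> b" by auto
    obtain x E H where F: "local_frame B m x E H" "b \<in> H" "H \<subseteq> V \<inter> V"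
      "\<And>q i. q \<in> H \<Longrightarrow> i < m \<Longrightarrow> E i q = B.cv V \<psi> q (d i)"
      by (rule B.coordinate_frame[OF V b(1) B.chart_open[OF V] b(1)]) blast
    \<comment> \<open>A global field with the constant direction \<open>P v\<close> in the chart
      near \<open>b\<close>; its lift \<open>W\<close> computes the directional derivative of
      \<open>h\<close> upstairs.\<close>
    define Y where "Y = (\<lambda>q f. \<Sum>i\<in>{..<m}. (v \<bullet> d i) * E i q f)"
    have Y: "B.VF Y" unfolding Y_def
      using F(1) by (intro B.vf_lincomb) (simp add: B.smf_const local_frame_def)
    have YH: "Y q = B.cv V \<psi> q (B.P v)" if "q \<in> H" for q
      using F(3,4) that B.cv_lincomb[OF V, of q "\<lambda>i. v \<bullet> d i" d "{..<m}"]
      by (auto simp: Y_def B.P_def fun_eq_iff)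
    obtain W where W: "M.VF W" "\<And>p. p \<in> pts M \<Longrightarrow> pf (W p) = Y (\<pi> p)"
      by (rule lift_exists[OF Y]) blast
    have WT: "W p \<in> M.T p" if "p \<in> pts M" for p by (rule M.vf_tan[OF W(1) that])
    \<comment> \<open>Two lifts of the same vector of \<open>B\<close> give h \<circ> \<pi> the same
      derivative, so this derivative descends to a function \<open>l\<close> on
      \<open>B\<close>.\<close>
    have WH: "W p (h \<circ> \<pi>) = W q (h \<circ> \<pi>)" if p: "p \<in> pts M" and q: "q \<in> pts M" and pq: "\<pi> p = \<pi> q" for p q
    proof -
      obtain V' \<psi>' where V': "B.ch V' \<psi>'" "\<pi> p \<in> V'" using B.chart_at pi_pts[OF p] by blast
      obtain \<zeta> where \<zeta>: "\<zeta> \<in> model B" "Y (\<pi> p) = B.cv V' \<psi>' (\<pi> p) \<zeta>"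
        by (rule B.tangent_cv[OF V' B.vf_tan[OF Y pi_pts[OF p]]])
      have "W p (h \<circ> \<pi>) = frechet_derivative (B.rep V' \<psi>' h) (at (\<psi>' (\<pi> p))) \<zeta>"
        by (rule descend_derivative[OF h p V' WT[OF p] _ \<zeta>(1)]) (simp add: W(2)[OF p] \<zeta>(2))
      moreover have "W q (h \<circ> \<pi>) = frechet_derivative (B.rep V' \<psi>' h) (at (\<psi>' (\<pi> q))) \<zeta>"
        by (rule descend_derivative[OF h q V'(1) _ WT[OF q] _ \<zeta>(1)]) (use W(2)[OF q] \<zeta>(2) pq V'(2) in auto)
      ultimately show ?thesis using pq by simp
    qed
    define l where "l b = W (SOME p. p \<in> pts M \<and> \<pi> p = b) (h \<circ> \<pi>)" for b
    have l: "l (\<pi> p) = W p (h \<circ> \<pi>)" if p: "p \<in> pts M" for p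
    proof -
      have "(SOME q. q \<in> pts M \<and> \<pi> q = \<pi> p) \<in> pts M \<and> \<pi> (SOME q. q \<in> pts M \<and> \<pi> q = \<pi> p) = \<pi> p"
        by (rule someI[of _ p]) (use p in simp)
      then show ?thesis unfolding l_def by (intro WH) (use p in auto)
    qed
    have "l \<circ> \<pi> \<in> smf M"
      by (rule M.smf_cong[OF M.vf_smf[OF W(1), of "h \<circ> \<pi>"]]) (simp add: l)
    from Suc.IH[OF this V] have Cl: "Ck_on k (B.rep V \<psi> l) ?d" .
    let ?O = "{y. B.P y \<in> \<psi> ` (V \<inter> H)}"
    have oH: "openin (rtop B) H" using F(1) by (simp add: local_frame_def)
    have oO: "open ?O" by (rule B.open_chart_dom[OF V oH])
    have eq: "frechet_derivative (B.rep V \<psi> h) (at y) v = B.rep V \<psi> l y" if "y \<in> ?O" for y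
    proof -
      from that obtain c where c: "c \<in> V" "c \<in> H" "B.P y = \<psi> c" by auto
      then obtain p where p: "p \<in> pts M" "\<pi> p = c" using pi_onto B.chart_subset[OF V] by blast
      have yd: "y \<in> ?d" using c by auto
      have "B.rep V \<psi> l y = l c" using c by (simp add: B.rep_def B.inv_chart[OF V])
      also have "\<dots> = W p (h \<circ> \<pi>)" using l[OF p(1)] p(2) by simp
      also have "\<dots> = frechet_derivative (B.rep V \<psi> h) (at (\<psi> (\<pi> p))) (B.P v)"
        by (rule descend_derivative[OF h p(1) V _ WT[OF p(1)] _ B.P_in_model]) (use c p W(2) YH in simp_all)
      also have "\<dots> = frechet_derivative (B.rep V \<psi> h) (at y) v"
        using frechet_derivative_at[OF d[OF yd]] c(3) p(2) by metis
      finally show ?thesis by simp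
    qed
    have "Ck_on k (B.rep V \<psi> l) ?O" by (rule Ck_on_subset[OF Cl]) auto
    then have "Ck_on k (\<lambda>y. frechet_derivative (B.rep V \<psi> h) (at y) v) ?O"
      by (rule Ck_on_cong[THEN iffD2, OF oO eq, rotated])
    moreover have "y0 \<in> ?O" using b F(2) by auto
    ultimately show "\<exists>T. open T \<and> y0 \<in> T \<and> Ck_on k (\<lambda>y. frechet_derivative (B.rep V \<psi> h) (at y) v) T"
      using oO by blast
  qed
  then show ?case
    using d by (auto simp: differentiable_def)
qed

lemma descend: "h \<circ> \<pi> \<in> smf M \<Longrightarrow> h \<in> smf B"
  using descend_Ck by (simp add: B.smf_iff Cinf_on_def)

end

section \<open>The fibres\<close>

context riem_submersion begin

section \<open>Smooth functions on a fibre\<close>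

abbreviation Fb :: "'b \<Rightarrow> 'a rspace" where "Fb \<equiv> fibre M \<pi>"
abbreviation inc :: "'a tvec \<Rightarrow> 'a tvec" where "inc \<equiv> pushforward M (\<lambda>x. x)"
abbreviation tf :: "'a \<Rightarrow> 'a tvec \<Rightarrow> 'a tvec" where "tf \<equiv> to_fibre M \<pi>"

lemma pts_fibre: "pts (Fb b) = {p \<in> pts M. \<pi> p = b}"
  by (auto simp: fibre_def)

lemma openin_fibre: "openin (rtop (Fb b)) G \<longleftrightarrow> (\<exists>G'. openin (rtop M) G' \<and> G = G' \<inter> {p. \<pi> p = b})"
  by (simp add: fibre_def openin_subtopology)

lemma smf_fibre_iff: "f \<in> smf (Fb b) \<longleftrightarrow> (\<forall>p\<in>pts (Fb b). \<exists>G h. openin (rtop M) G \<and> p \<in> G \<and> h \<in> smf M \<and>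
    (\<forall>q\<in>G. \<pi> q = b \<longrightarrow> f q = h q))"
  unfolding pts_fibre by (simp add: fibre_def)

lemma smf_fibreI:
  assumes "\<And>p. p \<in> pts (Fb b) \<Longrightarrow> \<exists>G h. openin (rtop M) G \<and> p \<in> G \<and> h \<in> smf M \<and> (\<forall>q\<in>G. \<pi> q = b \<longrightarrow> f q = h q)"
  shows "f \<in> smf (Fb b)"
  using assms by (simp add: smf_fibre_iff)

lemma smf_fibreE:
  assumes "f \<in> smf (Fb b)" "p \<in> pts (Fb b)"
  obtains G h where "openin (rtop M) G" "p \<in> G" "h \<in> smf M" "\<And>q. q \<in> G \<Longrightarrow> \<pi> q = b \<Longrightarrow> f q = h q"
proof -
  have "\<exists>G h. openin (rtop M) G \<and> p \<in> G \<and> h \<in> smf M \<and> (\<forall>q\<in>G. \<pi> q = b \<longrightarrow> f q = h q)"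
    using assms by (simp add: smf_fibre_iff)
  then show thesis using that by blast
qed

lemma smf_restrict:
  assumes h: "h \<in> smf M" and eq: "\<And>q. q \<in> pts M \<Longrightarrow> \<pi> q = b \<Longrightarrow> f q = h q"
  shows "f \<in> smf (Fb b)"
proof (rule smf_fibreI)
  fix p assume "p \<in> pts (Fb b)"
  then show "\<exists>G h. openin (rtop M) G \<and> p \<in> G \<and> h \<in> smf M \<and> (\<forall>q\<in>G. \<pi> q = b \<longrightarrow> f q = h q)"
    using h eq by (intro exI[of _ "pts M"] exI[of _ h]) (simp add: pts_fibre)
qed

lemma fibre_algebra: "smooth_algebra (Fb b)"
proof
  show "(\<lambda>x. c) \<in> smf (Fb b)" for c by (rule smf_restrict[OF M.smf_const]) simp
  fix f k assume f: "f \<in> smf (Fb b)" and k: "k \<in> smf (Fb b)"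
  have *: "\<exists>G h h'. openin (rtop M) G \<and> p \<in> G \<and> h \<in> smf M \<and> h' \<in> smf M \<and>
     (\<forall>q\<in>G. \<pi> q = b \<longrightarrow> f q = h q \<and> k q = h' q)" if p: "p \<in> pts (Fb b)" for p
  proof -
    obtain G h where 1: "openin (rtop M) G" "p \<in> G" "h \<in> smf M" "\<And>q. q \<in> G \<Longrightarrow> \<pi> q = b \<Longrightarrow> f q = h q"
      by (rule smf_fibreE[OF f p]) blast
    obtain G' h' where 2: "openin (rtop M) G'" "p \<in> G'" "h' \<in> smf M" "\<And>q. q \<in> G' \<Longrightarrow> \<pi> q = b \<Longrightarrow> k q = h' q"
      by (rule smf_fibreE[OF k p]) blast
    show ?thesis using 1 2 by (intro exI[of _ "G \<inter> G'"] exI[of _ h] exI[of _ h']) auto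
  qed
  show "(\<lambda>x. f x + k x) \<in> smf (Fb b)"
  proof (rule smf_fibreI)
    fix p assume "p \<in> pts (Fb b)"
    from *[OF this] obtain G h h' where "openin (rtop M) G" "p \<in> G" "h \<in> smf M" "h' \<in> smf M"
      "\<forall>q\<in>G. \<pi> q = b \<longrightarrow> f q = h q \<and> k q = h' q" by blast
    then show "\<exists>G h. openin (rtop M) G \<and> p \<in> G \<and> h \<in> smf M \<and> (\<forall>q\<in>G. \<pi> q = b \<longrightarrow> f q + k q = h q)"
      by (intro exI[of _ G] exI[of _ "\<lambda>x. h x + h' x"]) (simp add: M.smf_add)
  qed
  show "(\<lambda>x. f x * k x) \<in> smf (Fb b)"
  proof (rule smf_fibreI)
    fix p assume "p \<in> pts (Fb b)"
    from *[OF this] obtain G h h' where "openin (rtop M) G" "p \<in> G" "h \<in> smf M" "h' \<in> smf M"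
      "\<forall>q\<in>G. \<pi> q = b \<longrightarrow> f q = h q \<and> k q = h' q" by blast
    then show "\<exists>G h. openin (rtop M) G \<and> p \<in> G \<and> h \<in> smf M \<and> (\<forall>q\<in>G. \<pi> q = b \<longrightarrow> f q * k q = h q)"
      by (intro exI[of _ G] exI[of _ "\<lambda>x. h x * h' x"]) (simp add: M.smf_mult)
  qed
next
  fix f assume f: "\<And>p. p \<in> pts (Fb b) \<Longrightarrow> \<exists>G h. openin (rtop (Fb b)) G \<and> p \<in> G \<and> h \<in> smf (Fb b) \<and> (\<forall>q\<in>G. f q = h q)"
  show "f \<in> smf (Fb b)"
  proof (rule smf_fibreI)
    fix p assume p: "p \<in> pts (Fb b)"
    obtain G h where G: "openin (rtop (Fb b)) G" "p \<in> G" "h \<in> smf (Fb b)" "\<And>q. q \<in> G \<Longrightarrow> f q = h q"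
      using f[OF p] by blast
    obtain G0 where G0: "openin (rtop M) G0" "G = G0 \<inter> {p. \<pi> p = b}" using G(1) by (auto simp: openin_fibre)
    obtain G' h' where 2: "openin (rtop M) G'" "p \<in> G'" "h' \<in> smf M" "\<And>q. q \<in> G' \<Longrightarrow> \<pi> q = b \<Longrightarrow> h q = h' q"
      by (rule smf_fibreE[OF G(3) p]) blast
    show "\<exists>G h. openin (rtop M) G \<and> p \<in> G \<and> h \<in> smf M \<and> (\<forall>q\<in>G. \<pi> q = b \<longrightarrow> f q = h q)"
      using G G0 2 by (intro exI[of _ "G0 \<inter> G'"] exI[of _ h']) auto
  qed
next
  fix G p assume G: "openin (rtop (Fb b)) G" "p \<in> G"
  obtain G0 where G0: "openin (rtop M) G0" "G = G0 \<inter> {p. \<pi> p = b}" using G(1) by (auto simp: openin_fibre)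
  obtain \<eta> H where \<eta>: "\<eta> \<in> smf M" "openin (rtop M) H" "p \<in> H" "H \<subseteq> G0" "\<And>q. q \<in> H \<Longrightarrow> \<eta> q = 1"
    "\<And>q. q \<notin> G0 \<Longrightarrow> \<eta> q = 0"
    using M.bump[OF G0(1), of p] G(2) G0(2) by blast
  show "\<exists>\<eta>\<in>smf (Fb b). \<exists>H. openin (rtop (Fb b)) H \<and> p \<in> H \<and> H \<subseteq> G \<and> (\<forall>q\<in>H. \<eta> q = 1) \<and> (\<forall>q. q \<notin> G \<longrightarrow> \<eta> q = 0)"
  \<comment> \<open>The bump function has to vanish off \<open>G\<close> outside the fibre as well,
    so the ambient one is set to 0 there.\<close>
  proof (intro bexI[of _ "\<lambda>q. if \<pi> q = b then \<eta> q else 0"] exI[of _ "H \<inter> {p. \<pi> p = b}"] conjI)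
    show "(\<lambda>q. if \<pi> q = b then \<eta> q else 0) \<in> smf (Fb b)" by (rule smf_restrict[OF \<eta>(1)]) simp
    show "openin (rtop (Fb b)) (H \<inter> {p. \<pi> p = b})" using \<eta>(2) by (auto simp: openin_fibre)
  qed (use \<eta> G G0 in auto)
qed

section \<open>Tangent vectors of a fibre\<close>

lemma inc_apply: "h \<in> smf M \<Longrightarrow> inc w h = w h"
  by (simp add: pushforward_def o_def)

lemma inc_lin: "inc (\<lambda>f. a * u f + b * v f) = (\<lambda>f. a * inc u f + b * inc v f)"
  by (auto simp: pushforward_def fun_eq_iff)

context
  fixes b p assumes p: "p \<in> pts M" and b: "\<pi> p = b"
begin

interpretation F: smooth_algebra "Fb b" by (rule fibre_algebra)

lemma p_fibre: "p \<in> pts (Fb b)"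
  using p b by (simp add: pts_fibre)

text \<open>A function f \<circ> \<pi> is constant on the fibre, so a derivation of the fibre
  algebra kills it.\<close>

lemma inc_Ver:
  assumes w: "w \<in> F.T p"
  shows "inc w \<in> Ver p"
proof -
  have r: "f \<in> smf M \<Longrightarrow> f \<in> smf (Fb b)" for f by (erule smf_restrict) simp
  have "inc w \<in> M.T p"
    unfolding tangent_space_def
    by (auto simp: inc_apply M.smf_add M.smf_mult M.smf_cmult F.tv_add[OF w] F.tv_mult[OF w] F.tv_cmult[OF w] r)
      (simp add: pushforward_def)
  moreover have "pf (inc w) f = 0" for f
  proof (cases "f \<in> smf B")
    case True
    have "pf (inc w) f = w (f \<circ> \<pi>)"
      by (simp add: pf_apply[OF True] inc_apply[OF comp_smf[OF True]])
    also have "\<dots> = w (\<lambda>q. f b)"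
      by (rule F.tv_cong[OF w p_fibre]) (simp add: pts_fibre)
    also have "\<dots> = 0" by (rule F.tv_const[OF w])
    finally show ?thesis .
  qed (simp add: pushforward_def)
  ultimately show ?thesis by (simp add: Ver_iff fun_eq_iff)
qed

lemma fibre_tan_local:
  assumes w: "w \<in> F.T p" and G: "openin (rtop M) G" "p \<in> G" and h: "h \<in> smf M" and f: "f \<in> smf (Fb b)"
    and eq: "\<And>q. q \<in> G \<Longrightarrow> \<pi> q = b \<Longrightarrow> f q = h q"
  shows "w f = w h"
proof (rule F.tv_local[OF w, of "G \<inter> {p. \<pi> p = b}"])
  show "openin (rtop (Fb b)) (G \<inter> {p. \<pi> p = b})" using G by (auto simp: openin_fibre)
  show "h \<in> smf (Fb b)" by (rule smf_restrict[OF h]) simp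
qed (use G b f eq in auto)

text \<open>Smooth functions on the fibre are locally restrictions of smooth functions on
  \<open>M\<close>, so a derivation is known from its values on the latter.\<close>

lemma fibre_tan_eqI:
  assumes w: "w \<in> F.T p" "w' \<in> F.T p" and eq: "\<And>h. h \<in> smf M \<Longrightarrow> w h = w' h"
  shows "w = w'"
proof
  fix f
  show "w f = w' f"
  proof (cases "f \<in> smf (Fb b)")
    case True
    obtain G h where G: "openin (rtop M) G" "p \<in> G" "h \<in> smf M" "\<And>q. q \<in> G \<Longrightarrow> \<pi> q = b \<Longrightarrow> f q = h q"
      by (rule smf_fibreE[OF True p_fibre]) blast
    show ?thesis
      using fibre_tan_local[OF w(1) G(1-3) True] fibre_tan_local[OF w(2) G(1-3) True] G(4) eq[OF G(3)] by simp
  next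
    case False
    then show ?thesis using F.tv_nonsmooth[OF w(1)] F.tv_nonsmooth[OF w(2)] by simp
  qed
qed

lemma inc_inj: "w \<in> F.T p \<Longrightarrow> w' \<in> F.T p \<Longrightarrow> inc w = inc w' \<Longrightarrow> w = w'"
  by (rule fibre_tan_eqI) (metis inc_apply)+

text \<open>The preimage evaluates \<open>v\<close> on any local extension of a fibre function. Two
  extensions differ by a function vanishing on the fibre near \<open>p\<close>, which
  \<open>v\<close> kills by \<open>vertical_vanish\<close>.\<close>

lemma inc_onto:
  assumes v: "v \<in> Ver p"
  shows "\<exists>w\<in>F.T p. inc w = v"
proof -
  define germ where "germ f h \<longleftrightarrow> h \<in> smf M \<and> (\<exists>G. openin (rtop M) G \<and> p \<in> G \<and> (\<forall>q\<in>G. \<pi> q = b \<longrightarrow> f q = h q))"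
    for f h :: "'a \<Rightarrow> real"
  define w where "w f = (if f \<in> smf (Fb b) then v (SOME h. germ f h) else 0)" for f
  note vt = Ver_tan[OF v]
  have r: "f \<in> smf M \<Longrightarrow> f \<in> smf (Fb b)" for f by (erule smf_restrict) simp
  have ex: "\<exists>h. germ f h" if "f \<in> smf (Fb b)" for f
    using smf_fibreE[OF that p_fibre] unfolding germ_def by metis
  have wd: "v h = v h'" if "germ f h" "germ f h'" for f h h'
  proof -
    obtain G G' where G: "openin (rtop M) G" "p \<in> G" "\<forall>q\<in>G. \<pi> q = b \<longrightarrow> f q = h q"
      "openin (rtop M) G'" "p \<in> G'" "\<forall>q\<in>G'. \<pi> q = b \<longrightarrow> f q = h' q" "h \<in> smf M" "h' \<in> smf M"
      using \<open>germ f h\<close> \<open>germ f h'\<close> by (auto simp: germ_def)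
    have "v (\<lambda>x. h x - h' x) = 0"
      by (rule vertical_vanish[OF p v, of _ "G \<inter> G'"]) (use G b in \<open>auto intro: M.smf_diff\<close>)
    then show ?thesis using M.tv_diff[OF vt G(7,8)] by simp
  qed
  have w: "w f = v h" if "germ f h" "f \<in> smf (Fb b)" for f h
    using wd[OF someI[of "germ f", OF that(1)] that(1)] that(2) by (simp add: w_def)
  have "w \<in> F.T p"
    unfolding tangent_space_def
  proof (intro CollectI conjI ballI allI impI)
    fix f k assume f: "f \<in> smf (Fb b)" and k: "k \<in> smf (Fb b)"
    obtain h l where h: "germ f h" and l: "germ k l" using ex[OF f] ex[OF k] by blast
    have hl: "h \<in> smf M" "l \<in> smf M" using h l by (auto simp: germ_def)
    obtain G G' where G: "openin (rtop M) G" "p \<in> G" "\<forall>q\<in>G. \<pi> q = b \<longrightarrow> f q = h q"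
      "openin (rtop M) G'" "p \<in> G'" "\<forall>q\<in>G'. \<pi> q = b \<longrightarrow> k q = l q"
      using h l by (auto simp: germ_def)
    have "germ (\<lambda>x. f x + k x) (\<lambda>x. h x + l x)" "germ (\<lambda>x. f x * k x) (\<lambda>x. h x * l x)"
      unfolding germ_def using G hl
      by (auto intro!: exI[of _ "G \<inter> G'"] M.smf_add M.smf_mult)
    from w[OF this(1) F.smf_add[OF f k]] w[OF this(2) F.smf_mult[OF f k]]
    show "w (\<lambda>x. f x + k x) = w f + w k" "w (\<lambda>x. f x * k x) = f p * w k + k p * w f"
      using G b by (simp_all add: w[OF h f] w[OF l k] M.tv_add[OF vt hl] M.tv_mult[OF vt hl])
  next
    fix f and c :: real assume f: "f \<in> smf (Fb b)"
    obtain h where h: "germ f h" using ex[OF f] by blast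
    then have hs: "h \<in> smf M" by (simp add: germ_def)
    have "germ (\<lambda>x. c * f x) (\<lambda>x. c * h x)"
      using h unfolding germ_def by (auto intro: M.smf_cmult)
    from w[OF this F.smf_cmult[OF f]] show "w (\<lambda>x. c * f x) = c * w f"
      by (simp add: w[OF h f] M.tv_cmult[OF vt hs])
  next
    fix f assume "f \<notin> smf (Fb b)"
    then show "w f = 0" by (simp add: w_def)
  qed
  moreover have "inc w f = v f" for f
  proof (cases "f \<in> smf M")
    case True
    then have "germ f f" unfolding germ_def using p by (auto intro!: exI[of _ "pts M"])
    then show ?thesis using w[OF _ r[OF True]] by (simp add: inc_apply[OF True])
  next
    case False
    then show ?thesis using M.tv_nonsmooth[OF vt] by (simp add: pushforward_def)
  qed
  ultimately show ?thesis by blast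
qed

lemma to_fibre:
  assumes v: "v \<in> Ver p"
  shows tf_tan: "tf p v \<in> F.T p" and inc_tf: "inc (tf p v) = v"
proof -
  obtain w where w: "w \<in> F.T p" "inc w = v" using inc_onto[OF v] by blast
  have "tf p v = w"
    unfolding to_fibre_def b
    by (rule the_equality) (use w inc_inj in auto)
  then show "tf p v \<in> F.T p" "inc (tf p v) = v" using w by simp_all
qed

lemma tf_apply: "v \<in> Ver p \<Longrightarrow> h \<in> smf M \<Longrightarrow> tf p v h = v h"
  using inc_tf inc_apply by metis

lemma tf_inc: "w \<in> F.T p \<Longrightarrow> tf p (inc w) = w"
  using inc_inj inc_Ver to_fibre by metis

lemma met_fibre: "met (Fb b) p u v = M.g p (inc u) (inc v)"
  by (simp add: fibre_def)

lemma met_tf: "u \<in> Ver p \<Longrightarrow> v \<in> Ver p \<Longrightarrow> met (Fb b) p (tf p u) (tf p v) = M.g p u v"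
  by (simp add: met_fibre inc_tf)

end

text \<open>Where a fibre function is the restriction of some \<open>h\<close>, its derivative along
  the restricted field is the restriction of \<open>V q h\<close>.\<close>

lemma vf_fibre_field:
  assumes V: "M.VF V" "\<And>p. p \<in> pts M \<Longrightarrow> V p \<in> Ver p"
  shows "vector_field (Fb b) (\<lambda>p. tf p (V p))"
proof -
  interpret F: smooth_algebra "Fb b" by (rule fibre_algebra)
  show ?thesis
  proof (rule F.vfI)
    show "tf p (V p) \<in> F.T p" if "p \<in> pts (Fb b)" for p
      using that V(2) by (intro tf_tan) (auto simp: pts_fibre)
    fix f assume f: "f \<in> smf (Fb b)"
    show "(\<lambda>p. tf p (V p) f) \<in> smf (Fb b)"
    proof (rule smf_fibreI)
      fix p assume p: "p \<in> pts (Fb b)"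
      obtain G h where G: "openin (rtop M) G" "p \<in> G" "h \<in> smf M" "\<And>q. q \<in> G \<Longrightarrow> \<pi> q = b \<Longrightarrow> f q = h q"
        by (rule smf_fibreE[OF f p]) blast
      have "tf q (V q) f = V q h" if q: "q \<in> G" "\<pi> q = b" for q
      proof -
        have qM: "q \<in> pts M" using q(1) G(1) openin_subset by blast
        have "tf q (V q) f = tf q (V q) h"
          by (rule fibre_tan_local[OF qM q(2) tf_tan[OF qM q(2) V(2)[OF qM]] G(1) q(1) G(3) f G(4)])
        also have "\<dots> = V q h" by (rule tf_apply[OF qM q(2) V(2)[OF qM] G(3)])
        finally show ?thesis .
      qed
      then show "\<exists>G h. openin (rtop M) G \<and> p \<in> G \<and> h \<in> smf M \<and> (\<forall>q\<in>G. \<pi> q = b \<longrightarrow> tf q (V q) f = h q)"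
        using G M.vf_smf[OF V(1)] by (intro exI[of _ G] exI[of _ "\<lambda>q. V q h"]) simp
    qed
  qed
qed

section \<open>Spanning fields and metric of a fibre\<close>

lemma Ver_lincomb: "(\<And>i. i \<in> I \<Longrightarrow> u i \<in> Ver p) \<Longrightarrow> (\<lambda>f. \<Sum>i\<in>I. c i * u i f) \<in> Ver p"
proof (induction I rule: infinite_finite_induct)
  case (insert i I)
  then have "(\<lambda>f. c i * u i f + 1 * (\<Sum>i\<in>I. c i * u i f)) \<in> Ver p"
    by (intro Ver_lin) simp_all
  then show ?case using insert.hyps by simp
qed (simp_all add: Ver_zero)

lemma Hor_lincomb:
  assumes p: "p \<in> pts M" and u: "\<And>i. i \<in> I \<Longrightarrow> u i \<in> Hor p"
  shows "(\<lambda>f. \<Sum>i\<in>I. c i * u i f) \<in> Hor p"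
  unfolding Hor_iff
proof (intro conjI ballI)
  show t: "(\<lambda>f. \<Sum>i\<in>I. c i * u i f) \<in> M.T p"
    using u by (intro M.tv_lincomb) (simp add: Hor_iff)
  fix v assume v: "v \<in> Ver p"
  have "M.g p v (\<lambda>f. \<Sum>i\<in>I. c i * u i f) = (\<Sum>i\<in>I. c i * M.g p (u i) v)"
    using M.met_sym[OF p Ver_tan[OF v] t] M.met_lincomb_left[OF p Ver_tan[OF v], of I u c] u Hor_tan by simp
  also have "\<dots> = 0" using u Hor_Ver[OF p v] by simp
  finally show "M.g p v (\<lambda>f. \<Sum>i\<in>I. c i * u i f) = 0" .
qed

lemma ver_lincomb:
  assumes p: "p \<in> pts M" and u: "\<And>i. i \<in> I \<Longrightarrow> u i \<in> M.T p"
  shows "ver p (\<lambda>f. \<Sum>i\<in>I. c i * u i f) = (\<lambda>f. \<Sum>i\<in>I. c i * ver p (u i) f)"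
proof -
  have e: "(\<lambda>f. (\<Sum>i\<in>I. c i * u i f) - (\<Sum>i\<in>I. c i * hor p (u i) f)) = (\<lambda>f. \<Sum>i\<in>I. c i * ver p (u i) f)"
    using ver_eq[OF p u] by (simp add: sum_subtractf[symmetric] right_diff_distrib)
  have "ver p (\<lambda>f. \<Sum>i\<in>I. c i * u i f) = (\<lambda>f. (\<Sum>i\<in>I. c i * u i f) - (\<Sum>i\<in>I. c i * hor p (u i) f))"
  proof (rule hor_eqI(2)[OF p])
    show "(\<lambda>f. \<Sum>i\<in>I. c i * hor p (u i) f) \<in> Hor p" by (intro Hor_lincomb p hor_Hor u)
    show "(\<lambda>f. (\<Sum>i\<in>I. c i * u i f) - (\<Sum>i\<in>I. c i * hor p (u i) f)) \<in> Ver p"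
      unfolding e by (intro Ver_lincomb ver_Ver p u)
  qed
  then show ?thesis using e by simp
qed

text \<open>Spanning fields come from a local frame of \<open>M\<close>, projected vertically, with
  the same functions x_i: a vertical vector is expanded in \<open>M\<close>, and projecting the
  expansion fixes the vector. Positivity of the metric rests on the injectivity of
  \<open>inc\<close>.\<close>

lemma fibre_metric_space: "metric_smooth_space (Fb b)"
proof -
  interpret F: smooth_algebra "Fb b" by (rule fibre_algebra)
  show ?thesis
  proof
    fix p assume pF: "p \<in> pts (Fb b)"
    then have p: "p \<in> pts M" "\<pi> p = b" by (simp_all add: pts_fibre)
    obtain n x E G where F: "local_frame M n x E G" "p \<in> G" using M.frame[OF p(1)] by blast
    then have oG: "openin (rtop M) G" and x: "\<And>i. i < n \<Longrightarrow> x i \<in> smf M" and EV: "\<And>i. i < n \<Longrightarrow> M.VF (E i)"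
      by (auto simp: local_frame_def)
    let ?E = "\<lambda>i q. tf q (ver q (E i q))"
    have EF: "F.VF (?E i)" if "i < n" for i
      using vf_fibre_field[OF vf_ver[OF EV[OF that]]] ver_Ver M.vf_tan[OF EV[OF that]] by blast
    have "w f = (\<Sum>i<n. w (x i) * ?E i q f)"
      if q: "q \<in> G \<inter> {p. \<pi> p = b}" and w: "w \<in> F.T q" for q w f
    proof -
      have qM: "q \<in> pts M" "\<pi> q = b" using q oG openin_subset by auto
      have Et: "E i q \<in> M.T q" if "i < n" for i using M.vf_tan[OF EV[OF that] qM(1)] .
      have iw: "inc w \<in> Ver q" by (rule inc_Ver[OF qM w])
      have "w = (\<lambda>f. \<Sum>i\<in>{..<n}. w (x i) * ?E i q f)"
      proof (rule fibre_tan_eqI[OF qM w])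
        show "(\<lambda>f. \<Sum>i\<in>{..<n}. w (x i) * ?E i q f) \<in> F.T q"
          by (intro F.tv_lincomb tf_tan qM ver_Ver Et) simp
        fix h assume h: "h \<in> smf M"
        have "inc w = (\<lambda>f. \<Sum>i\<in>{..<n}. w (x i) * E i q f)"
        proof
          fix f
          have "inc w f = (\<Sum>i<n. inc w (x i) * E i q f)"
            using F(1) q Ver_tan[OF iw] unfolding local_frame_def by blast
          then show "inc w f = (\<Sum>i<n. w (x i) * E i q f)" by (simp add: inc_apply x)
        qed
        then have "ver q (inc w) = ver q (\<lambda>f. \<Sum>i\<in>{..<n}. w (x i) * E i q f)" by (rule arg_cong)
        also have "\<dots> = (\<lambda>f. \<Sum>i\<in>{..<n}. w (x i) * ver q (E i q) f)"
          by (rule ver_lincomb[OF qM(1)]) (simp add: Et)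
        finally have "inc w h = (\<Sum>i\<in>{..<n}. w (x i) * ver q (E i q) h)"
          by (simp add: ver_of_Ver[OF qM(1) iw])
        then show "w h = (\<Sum>i<n. w (x i) * ?E i q h)"
          using tf_apply[OF qM ver_Ver[OF qM(1) Et] h] by (simp add: inc_apply[OF h])
      qed
      then show ?thesis by (rule fun_cong)
    qed
    then have "local_frame (Fb b) n x ?E (G \<inter> {p. \<pi> p = b})"
      unfolding local_frame_def using EF oG x smf_restrict[OF x] by (auto simp: openin_fibre)
    then show "\<exists>n x E G. local_frame (Fb b) n x E G \<and> p \<in> G"
      using F(2) p(2) by blast
  next
    fix p u v w and \<alpha> \<beta> :: real
    assume pF: "p \<in> pts (Fb b)" and t: "u \<in> F.T p" "v \<in> F.T p" "w \<in> F.T p"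
    then have p: "p \<in> pts M" "\<pi> p = b" by (simp_all add: pts_fibre)
    note i = Ver_tan[OF inc_Ver[OF p t(1)]] Ver_tan[OF inc_Ver[OF p t(2)]] Ver_tan[OF inc_Ver[OF p t(3)]]
    show "met (Fb b) p (\<lambda>f. \<alpha> * u f + \<beta> * v f) w = \<alpha> * met (Fb b) p u w + \<beta> * met (Fb b) p v w"
      by (simp add: met_fibre[OF p] inc_lin M.met_lin[OF p(1) i])
  next
    fix p u v assume pF: "p \<in> pts (Fb b)" and t: "u \<in> F.T p" "v \<in> F.T p"
    then have p: "p \<in> pts M" "\<pi> p = b" by (simp_all add: pts_fibre)
    show "met (Fb b) p u v = met (Fb b) p v u"
      by (simp add: met_fibre[OF p] M.met_sym[OF p(1) Ver_tan[OF inc_Ver[OF p t(1)]] Ver_tan[OF inc_Ver[OF p t(2)]]])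
  next
    fix p v assume pF: "p \<in> pts (Fb b)" and v: "v \<in> F.T p" "v \<noteq> (\<lambda>f. 0)"
    then have p: "p \<in> pts M" "\<pi> p = b" by (simp_all add: pts_fibre)
    have "inc v \<noteq> (\<lambda>f. 0)"
      using inc_inj[OF p v(1) F.tv_zero] v(2) by (auto simp: pushforward_def)
    then show "met (Fb b) p v v > 0"
      using M.met_pos[OF p(1) Ver_tan[OF inc_Ver[OF p v(1)]]] by (simp add: met_fibre[OF p])
  qed
qed

end

section \<open>Gauss and O'Neill equations\<close>

locale submersion_connections = riem_submersion M e n B d m \<pi>
  for M :: "('a, 'm::euclidean_space) rmanifold" and e n
    and B :: "('b, 'n::euclidean_space) rmanifold" and d m and \<pi> +
  fixes D DF DB
  assumes lcM: "levi_civita M D"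
    and lcF: "b \<in> pts B \<Longrightarrow> levi_civita (fibre M \<pi> b) (DF b)"
    and lcB: "levi_civita B DB"

sublocale submersion_connections \<subseteq> MD: levi_civita_space M D
  by unfold_locales (rule lcM)

sublocale submersion_connections \<subseteq> BD: levi_civita_space B DB
  by unfold_locales (rule lcB)

context submersion_connections begin

lemma fibre_lc: "b \<in> pts B \<Longrightarrow> levi_civita_space (Fb b) (DF b)"
  by (intro levi_civita_space.intro fibre_metric_space levi_civita_space_axioms.intro lcF)

section \<open>Rules for the connection, the O'Neill tensors and brackets\<close>

lemma D_zero:
  assumes p: "p \<in> pts M" and U: "M.VF U" and Z: "M.VF Z" "\<And>q. q \<in> pts M \<Longrightarrow> Z q = (\<lambda>f. 0)"
  shows "D U Z p = (\<lambda>f. 0)"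
proof
  fix f
  have "M.VF (\<lambda>q h. 0 * Z q h)" by (rule M.vf_scale[OF M.smf_const Z(1)])
  then have "D U Z p = D U (\<lambda>q h. 0 * Z q h) p"
    using Z by (intro MD.D_cong_right[OF p U]) simp_all
  then show "D U Z p f = 0"
    using MD.D_scale_right[OF p U Z(1) M.smf_const[of 0], of f] M.tv_const[OF M.vf_tan[OF U p]] by simp
qed

lemma D_split:
  assumes p: "p \<in> pts M" and U: "M.VF U" and E: "M.VF E"
  shows "D U E p = (\<lambda>f. D U (\<lambda>q. ver q (E q)) p f + D U (\<lambda>q. hor q (E q)) p f)"
proof
  fix f
  have "D U E p = D U (\<lambda>q h. ver q (E q) h + hor q (E q) h) p"
    by (rule MD.D_cong_right[OF p U E M.vf_add[OF vf_ver[OF E] vf_hor[OF E]]])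
       (simp add: ver_eq M.vf_tan[OF E])
  then show "D U E p f = D U (\<lambda>q. ver q (E q)) p f + D U (\<lambda>q. hor q (E q)) p f"
    using MD.D_add_right[OF p U vf_ver[OF E] vf_hor[OF E]] by simp
qed

text \<open>Metric compatibility for a constant pairing. It moves the derivative between a
  horizontal and a vertical field, which is how the second fundamental form and A enter the
  curvature.\<close>

lemma D_orthogonal:
  assumes p: "p \<in> pts M" and U: "M.VF U" and V: "M.VF V" and W: "M.VF W"
    and orth: "\<And>q. q \<in> pts M \<Longrightarrow> M.g q (V q) (W q) = 0"
  shows "M.g p (D U V p) (W p) = - M.g p (V p) (D U W p)"
proof -
  have "U p (\<lambda>q. M.g q (V q) (W q)) = U p (\<lambda>q. 0)"
    by (rule M.tv_cong[OF M.vf_tan[OF U p] p orth])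
  then show ?thesis
    using MD.D_compat[OF p U V W] M.tv_const[OF M.vf_tan[OF U p]] by simp
qed

lemma oneill_T_eq:
  assumes p: "p \<in> pts M" and U: "M.VF U" "\<And>q. q \<in> pts M \<Longrightarrow> U q \<in> Ver q"
    and V: "M.VF V" "\<And>q. q \<in> pts M \<Longrightarrow> V q \<in> Ver q"
  shows "oneill_T M B \<pi> D U V p = hor p (D U V p)"
proof -
  have 1: "D (\<lambda>q. ver q (U q)) W p = D U W p" if "M.VF W" for W
    by (rule MD.D_pointwise[OF p vf_ver[OF U(1)] U(1) that]) (simp add: ver_of_Ver p U)
  have 2: "D U (\<lambda>q. ver q (V q)) p = D U V p"
    by (rule MD.D_cong_right[OF p U(1) vf_ver[OF V(1)] V(1)]) (simp add: ver_of_Ver V)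
  have 3: "D U (\<lambda>q. hor q (V q)) p = (\<lambda>f. 0)"
    by (rule D_zero[OF p U(1) vf_hor[OF V(1)]]) (simp add: hor_of_Ver V)
  show ?thesis
    unfolding oneill_T_def
    by (simp add: 1[OF vf_ver[OF V(1)]] 1[OF vf_hor[OF V(1)]] 2 3 ver_of_Ver[OF p Ver_zero])
qed

lemma oneill_A_eq:
  assumes p: "p \<in> pts M" and Y: "M.VF Y" "\<And>q. q \<in> pts M \<Longrightarrow> Y q \<in> Hor q"
    and Z: "M.VF Z" "\<And>q. q \<in> pts M \<Longrightarrow> Z q \<in> Hor q"
  shows "oneill_A M B \<pi> D Y Z p = ver p (D Y Z p)"
proof -
  have 1: "D (\<lambda>q. hor q (Y q)) W p = D Y W p" if "M.VF W" for W
    by (rule MD.D_pointwise[OF p vf_hor[OF Y(1)] Y(1) that]) (simp add: hor_of_Hor p Y)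
  have 2: "D Y (\<lambda>q. hor q (Z q)) p = D Y Z p"
    by (rule MD.D_cong_right[OF p Y(1) vf_hor[OF Z(1)] Z(1)]) (simp add: hor_of_Hor Z)
  have 3: "D Y (\<lambda>q. ver q (Z q)) p = (\<lambda>f. 0)"
    by (rule D_zero[OF p Y(1) vf_ver[OF Z(1)]]) (simp add: ver_of_Hor Z)
  show ?thesis
    unfolding oneill_A_def
    by (simp add: 1[OF vf_ver[OF Z(1)]] 1[OF vf_hor[OF Z(1)]] 2 3 hor_of_Ver[OF p Ver_zero])
qed

lemma B_zero_field: "B.VF (\<lambda>q f. 0)"
  by (rule B.vfI) (simp_all add: B.tv_zero B.smf_const)

text \<open>Naturality of the bracket for \<pi>-related fields: the derivative of f \<circ> \<pi>
  along \<open>Y\<close> is the pullback of the derivative of \<open>f\<close> along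
  \<open>y\<close>.\<close>

lemma bracket_related:
  assumes p: "p \<in> pts M" and X: "M.VF X" "\<And>q. q \<in> pts M \<Longrightarrow> pf (X q) = x (\<pi> q)" "B.VF x"
    and Y: "M.VF Y" "\<And>q. q \<in> pts M \<Longrightarrow> pf (Y q) = y (\<pi> q)" "B.VF y"
  shows "pf (lie_bracket X Y p) = lie_bracket x y (\<pi> p)"
proof
  fix f
  have *: "X p (\<lambda>q. Y q (f \<circ> \<pi>)) = x (\<pi> p) (\<lambda>b. y b f)" if f: "f \<in> smf B"
    and X: "M.VF X" "\<And>q. q \<in> pts M \<Longrightarrow> pf (X q) = x (\<pi> q)"
    and Y: "\<And>q. q \<in> pts M \<Longrightarrow> pf (Y q) = y (\<pi> q)" "B.VF y" for X Y x y
  proof -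
    have "X p (\<lambda>q. Y q (f \<circ> \<pi>)) = X p ((\<lambda>b. y b f) \<circ> \<pi>)"
      by (rule M.tv_cong[OF M.vf_tan[OF X(1) p] p]) (simp add: Y(1)[symmetric] pf_apply[OF f])
    also have "\<dots> = x (\<pi> p) (\<lambda>b. y b f)"
      using pf_apply[OF B.vf_smf[OF Y(2)], of "X p" f] X(2)[OF p] by simp
    finally show ?thesis .
  qed
  show "pf (lie_bracket X Y p) f = lie_bracket x y (\<pi> p) f"
  proof (cases "f \<in> smf B")
    case True
    then show ?thesis
      using *[OF True X(1,2) Y(2,3)] *[OF True Y(1,2) X(2,3)]
      by (simp add: pf_apply lie_bracket_def)
  next
    case False
    have "lie_bracket x y (\<pi> p) \<in> B.T (\<pi> p)" by (rule B.vf_tan[OF B.vf_bracket[OF X(3) Y(3)] pi_pts[OF p]])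
    then show ?thesis using B.tv_nonsmooth False by (auto simp: pushforward_def)
  qed
qed

text \<open>A vertical field is \<pi>-related to 0, hence so is its bracket with a projectable
  field.\<close>

lemma bracket_Ver:
  assumes p: "p \<in> pts M" and X: "M.VF X" "\<And>q. q \<in> pts M \<Longrightarrow> pf (X q) = x (\<pi> q)" "B.VF x"
    and W: "M.VF W" "\<And>q. q \<in> pts M \<Longrightarrow> W q \<in> Ver q"
  shows "lie_bracket X W p \<in> Ver p"
proof -
  have "pf (lie_bracket X W p) = lie_bracket x (\<lambda>q f. 0) (\<pi> p)"
  proof (rule bracket_related[OF p X W(1) _ B_zero_field])
    show "pf (W q) = (\<lambda>f. 0)" if "q \<in> pts M" for q
      using W(2)[OF that] by (simp add: Ver_iff)
  qed
  also have "\<dots> = (\<lambda>f. 0)"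
    using B.tv_const[OF B.vf_tan[OF X(3) pi_pts[OF p]]] by (simp add: lie_bracket_def)
  finally show ?thesis using M.vf_tan[OF M.vf_bracket[OF X(1) W(1)] p] by (simp add: Ver_iff)
qed

subsection \<open>Vertical directions\<close>

lemma bracket_Ver_Ver:
  assumes p: "p \<in> pts M" and U: "M.VF U" "\<And>q. q \<in> pts M \<Longrightarrow> U q \<in> Ver q"
    and V: "M.VF V" "\<And>q. q \<in> pts M \<Longrightarrow> V q \<in> Ver q"
  shows "lie_bracket U V p \<in> Ver p"
proof (rule bracket_Ver[OF p U(1) _ B_zero_field V])
  show "pf (U q) = (\<lambda>f. 0)" if "q \<in> pts M" for q
    using U(2)[OF that] by (simp add: Ver_iff)
qed

lemma fibre_connection:
  assumes p: "p \<in> pts M" "\<pi> p = b" and U: "M.VF U" "\<And>q. q \<in> pts M \<Longrightarrow> U q \<in> Ver q"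
    and V: "M.VF V" "\<And>q. q \<in> pts M \<Longrightarrow> V q \<in> Ver q"
  shows "DF b (fibre_field M \<pi> U) (fibre_field M \<pi> V) p = tf p (ver p (D U V p))"
proof -
  interpret F: levi_civita_space "Fb b" "DF b" using fibre_lc pi_pts p by blast
  have pF: "p \<in> pts (Fb b)" using p by (simp add: pts_fibre)
  note DT = MD.D_tan[OF p(1) U(1) V(1)]
  \<comment> \<open>Together with \<open>br\<close> this shows that every term of the Koszul formula
    for the restricted fields is the corresponding term on \<open>M\<close>.\<close>
  have dv: "tf p (U p) (\<lambda>q. met (Fb b) q (tf q (V q)) (tf q (W q))) = U p (\<lambda>q. M.g q (V q) (W q))"
    if U: "\<And>q. q \<in> pts M \<Longrightarrow> U q \<in> Ver q" and V: "M.VF V" "\<And>q. q \<in> pts M \<Longrightarrow> V q \<in> Ver q"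
      and W: "M.VF W" "\<And>q. q \<in> pts M \<Longrightarrow> W q \<in> Ver q" for U V W
  proof -
    have "tf p (U p) (\<lambda>q. met (Fb b) q (tf q (V q)) (tf q (W q))) = tf p (U p) (\<lambda>q. M.g q (V q) (W q))"
      by (rule F.tv_cong[OF tf_tan[OF p U[OF p(1)]] pF]) (simp add: pts_fibre met_tf V W)
    then show ?thesis using tf_apply[OF p U[OF p(1)] M.met_smooth[OF V(1) W(1)]] by simp
  qed
  have br: "lie_bracket (fibre_field M \<pi> U) (fibre_field M \<pi> V) p = tf p (lie_bracket U V p)"
    if U: "M.VF U" "\<And>q. q \<in> pts M \<Longrightarrow> U q \<in> Ver q" and V: "M.VF V" "\<And>q. q \<in> pts M \<Longrightarrow> V q \<in> Ver q" for U V
  proof (rule fibre_tan_eqI[OF p])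
    note t = bracket_Ver_Ver[OF p(1) U V]
    show "lie_bracket (fibre_field M \<pi> U) (fibre_field M \<pi> V) p \<in> F.T p"
      by (rule F.vf_tan[OF F.vf_bracket[OF vf_fibre_field[OF U] vf_fibre_field[OF V]] pF])
    show "tf p (lie_bracket U V p) \<in> F.T p" by (rule tf_tan[OF p t])
    fix h assume h: "h \<in> smf M"
    have *: "tf p (U p) (\<lambda>q. tf q (V q) h) = U p (\<lambda>q. V q h)"
      if U: "\<And>q. q \<in> pts M \<Longrightarrow> U q \<in> Ver q" and V: "M.VF V" "\<And>q. q \<in> pts M \<Longrightarrow> V q \<in> Ver q" for U V
    proof -
      have "tf p (U p) (\<lambda>q. tf q (V q) h) = tf p (U p) (\<lambda>q. V q h)"
        by (rule F.tv_cong[OF tf_tan[OF p U[OF p(1)]] pF]) (simp add: pts_fibre tf_apply[OF _ _ _ h] V)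
      then show ?thesis using tf_apply[OF p U[OF p(1)] M.vf_smf[OF V(1)]] by simp
    qed
    show "lie_bracket (fibre_field M \<pi> U) (fibre_field M \<pi> V) p h = tf p (lie_bracket U V p) h"
      using *[OF U(2) V] *[OF V(2) U] tf_apply[OF p t h] by (simp add: lie_bracket_def)
  qed
  show ?thesis
  proof (rule F.met_nondegenerate[OF pF])
    show "DF b (fibre_field M \<pi> U) (fibre_field M \<pi> V) p \<in> F.T p"
      by (rule F.D_tan[OF pF vf_fibre_field[OF U] vf_fibre_field[OF V]])
    show "tf p (ver p (D U V p)) \<in> F.T p" by (rule tf_tan[OF p ver_Ver[OF p(1) DT]])
    fix w assume w: "w \<in> F.T p"
    note iw = inc_Ver[OF p w]
    obtain E where E: "M.VF E" "E p = inc w" using M.extension_exists[OF p(1) Ver_tan[OF iw]] by blast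
    define W where "W = (\<lambda>q. ver q (E q))"
    have W: "M.VF W" "\<And>q. q \<in> pts M \<Longrightarrow> W q \<in> Ver q"
      unfolding W_def using vf_ver[OF E(1)] ver_Ver M.vf_tan[OF E(1)] by simp_all
    have Wp: "W p = inc w" "tf p (W p) = w"
      using ver_of_Ver[OF p(1) iw] tf_inc[OF p w] by (simp_all add: W_def E(2))
    have "2 * met (Fb b) p (DF b (fibre_field M \<pi> U) (fibre_field M \<pi> V) p) (tf p (W p)) = 2 * M.g p (D U V p) (W p)"
      using F.koszul[OF pF vf_fibre_field[OF U] vf_fibre_field[OF V] vf_fibre_field[OF W]]
        MD.koszul[OF p(1) U(1) V(1) W(1)] U(2)[OF p(1)] V(2)[OF p(1)] W(2)[OF p(1)] p
      by (simp add: dv[OF U(2) V W] dv[OF V(2) W U] dv[OF W(2) U V] br[OF U V] br[OF U W] br[OF V W]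
          met_tf[OF p] bracket_Ver_Ver[OF p(1) U V] bracket_Ver_Ver[OF p(1) U W] bracket_Ver_Ver[OF p(1) V W])
    then show "met (Fb b) p (DF b (fibre_field M \<pi> U) (fibre_field M \<pi> V) p) w =
        met (Fb b) p (tf p (ver p (D U V p))) w"
      using met_tf[OF p ver_Ver[OF p(1) DT] W(2)[OF p(1)]] met_ver[OF p(1) DT W(2)[OF p(1)]] Wp by simp
  qed
qed

lemma met_fibre_connection:
  assumes p: "p \<in> pts M" "\<pi> p = b" and U: "M.VF U" "\<And>q. q \<in> pts M \<Longrightarrow> U q \<in> Ver q"
    and V: "M.VF V" "\<And>q. q \<in> pts M \<Longrightarrow> V q \<in> Ver q" and w: "w \<in> Ver p"
  shows "met (Fb b) p (DF b (fibre_field M \<pi> U) (fibre_field M \<pi> V) p) (tf p w) = M.g p (D U V p) w"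
  using MD.D_tan[OF p(1) U(1) V(1)]
  by (simp add: fibre_connection[OF p U V] met_tf[OF p _ w] met_ver p w ver_Ver)

text \<open>In g(D_W D_W' V, U) the field D_W' V is split. Its vertical part gives the second
  derivative in the fibre; its horizontal part is moved onto D_W U and gives products of second
  fundamental forms.\<close>

lemma gauss_equation:
  assumes p: "p \<in> pts M" "\<pi> p = b" and U: "M.VF U" "\<And>q. q \<in> pts M \<Longrightarrow> U q \<in> Ver q"
    and V: "M.VF V" "\<And>q. q \<in> pts M \<Longrightarrow> V q \<in> Ver q"
  shows "M.g p (curvature_field D U V V p) (U p) =
      met (Fb b) p (curvature_field (DF b) (fibre_field M \<pi> U) (fibre_field M \<pi> V) (fibre_field M \<pi> V) p) (tf p (U p))
      + M.g p (hor p (D U V p)) (hor p (D U V p)) - M.g p (hor p (D U U p)) (hor p (D V V p))"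
proof -
  interpret F: levi_civita_space "Fb b" "DF b" using fibre_lc pi_pts p by blast
  have pF: "p \<in> pts (Fb b)" using p by (simp add: pts_fibre)
  let ?F = "fibre_field M \<pi>"
  have FV: "vector_field (Fb b) (?F W)" if "M.VF W" "\<And>q. q \<in> pts M \<Longrightarrow> W q \<in> Ver q" for W
    by (rule vf_fibre_field[OF that])
  note Up = U(2)[OF p(1)]
  have deriv2: "met (Fb b) p (DF b (?F W) (DF b (?F W') (?F V)) p) (tf p (U p)) =
      M.g p (D W (D W' V) p) (U p) + M.g p (hor p (D W' V p)) (D W U p)"
    if W: "M.VF W" "\<And>q. q \<in> pts M \<Longrightarrow> W q \<in> Ver q" and W': "M.VF W'" "\<And>q. q \<in> pts M \<Longrightarrow> W' q \<in> Ver q" for W W'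
  proof -
    let ?v = "\<lambda>q. ver q (D W' V q)" and ?h = "\<lambda>q. hor q (D W' V q)"
    have DV: "M.VF (D W' V)" by (rule MD.D_vf[OF W'(1) V(1)])
    note DVt = M.vf_tan[OF DV]
    have v: "M.VF ?v" "\<And>q. q \<in> pts M \<Longrightarrow> ?v q \<in> Ver q"
      using vf_ver[OF DV] ver_Ver DVt by blast+
    have h: "M.VF ?h" by (rule vf_hor[OF DV])
    have "DF b (?F W) (DF b (?F W') (?F V)) p = DF b (?F W) (?F ?v) p"
      by (rule F.D_cong_right[OF pF FV[OF W] F.D_vf[OF FV[OF W'] FV[OF V]] FV[OF v]])
         (auto simp: pts_fibre intro: fibre_connection W' V)
    then have "met (Fb b) p (DF b (?F W) (DF b (?F W') (?F V)) p) (tf p (U p)) = M.g p (D W ?v p) (U p)"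
      using met_fibre_connection[OF p W v Up] by simp
    moreover have "M.g p (D W (D W' V) p) (U p) = M.g p (D W ?v p) (U p) + M.g p (D W ?h p) (U p)"
      unfolding D_split[OF p(1) W(1) DV]
      by (rule M.met_add_left[OF p(1) MD.D_tan[OF p(1) W(1) v(1)] MD.D_tan[OF p(1) W(1) h] M.vf_tan[OF U(1) p(1)]])
    moreover have "M.g p (D W ?h p) (U p) = - M.g p (?h p) (D W U p)"
      by (rule D_orthogonal[OF p(1) W(1) h U(1)]) (intro Hor_Ver U hor_Hor DVt)
    ultimately show ?thesis by simp
  qed
  let ?L = "lie_bracket U V"
  have L: "M.VF ?L" "\<And>q. q \<in> pts M \<Longrightarrow> ?L q \<in> Ver q"
    using M.vf_bracket[OF U(1) V(1)] bracket_Ver_Ver[OF _ U V] by blast+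
  have FL: "vector_field (Fb b) (lie_bracket (?F U) (?F V))" by (rule F.vf_bracket[OF FV[OF U] FV[OF V]])
  \<comment> \<open>Both connections are torsion-free and have already been compared, which settles
    the brackets.\<close>
  have "lie_bracket (?F U) (?F V) p = ?F ?L p"
  proof (rule F.met_nondegenerate[OF pF F.vf_tan[OF FL pF] F.vf_tan[OF FV[OF L] pF]])
    fix w assume w: "w \<in> F.T p"
    note iw = inc_Ver[OF p w]
    have w': "w = tf p (inc w)" using tf_inc[OF p w] by simp
    note t = F.D_tan[OF pF FV[OF U] FV[OF V]] F.D_tan[OF pF FV[OF V] FV[OF U]]
    have "met (Fb b) p (lie_bracket (?F U) (?F V) p) (tf p (inc w)) =
        M.g p (D U V p) (inc w) - M.g p (D V U p) (inc w)"
      using F.met_diff_left[OF pF t tf_tan[OF p iw]]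
      by (simp add: F.D_torsion[OF pF FV[OF U] FV[OF V]] met_fibre_connection[OF p U V iw] met_fibre_connection[OF p V U iw])
    also have "\<dots> = M.g p (?L p) (inc w)"
      using M.met_diff_left[OF p(1) MD.D_tan[OF p(1) U(1) V(1)] MD.D_tan[OF p(1) V(1) U(1)] Ver_tan[OF iw]]
      by (simp add: MD.D_torsion[OF p(1) U(1) V(1)])
    finally show "met (Fb b) p (lie_bracket (?F U) (?F V) p) w = met (Fb b) p (?F ?L p) w"
      using met_tf[OF p L(2)[OF p(1)] iw] w' by simp
  qed
  then have third: "met (Fb b) p (DF b (lie_bracket (?F U) (?F V)) (?F V) p) (tf p (U p)) = M.g p (D ?L V p) (U p)"
    using F.D_pointwise[OF pF FL FV[OF L] FV[OF V]] met_fibre_connection[OF p L V Up] by simp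
  note vf = U(1) V(1) L(1) MD.D_vf[OF U(1) V(1)] MD.D_vf[OF V(1) V(1)]
  note tM = MD.D_tan[OF p(1)]
  have Rm: "M.g p (curvature_field D U V V p) (U p) =
      M.g p (D U (D V V) p) (U p) - M.g p (D V (D U V) p) (U p) - M.g p (D ?L V p) (U p)"
    unfolding curvature_field_def
    by (simp add: M.met_diff_left[OF p(1)] M.tv_minus' tM vf M.vf_tan[OF U(1) p(1)])
  note tF = F.D_tan[OF pF]
  note vfF = FV[OF U] FV[OF V] FL F.D_vf[OF FV[OF U] FV[OF V]] F.D_vf[OF FV[OF V] FV[OF V]]
  have Rf: "met (Fb b) p (curvature_field (DF b) (?F U) (?F V) (?F V) p) (tf p (U p)) =
      met (Fb b) p (DF b (?F U) (DF b (?F V) (?F V)) p) (tf p (U p)) -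
      met (Fb b) p (DF b (?F V) (DF b (?F U) (?F V)) p) (tf p (U p)) -
      met (Fb b) p (DF b (lie_bracket (?F U) (?F V)) (?F V) p) (tf p (U p))"
    unfolding curvature_field_def
    by (simp add: F.met_diff_left[OF pF] F.tv_minus' tF vfF tf_tan[OF p Up])
  have hh: "M.g p (hor p a) c = M.g p (hor p a) (hor p c)" if "a \<in> M.T p" "c \<in> M.T p" for a c
    using met_hor[OF p(1) that(2) hor_Hor[OF p(1) that(1)]] M.met_sym[OF p(1)] that Hor_tan[OF hor_Hor[OF p(1)]] by metis
  \<comment> \<open>Symmetry of the second fundamental form: D_U V and D_V U differ by the vertical
    vector [U,V].\<close>
  have "M.g p (hor p (D U V p)) (D V U p) = M.g p (hor p (D U V p)) (D U V p)"
  proof -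
    have H: "hor p (D U V p) \<in> Hor p" by (rule hor_Hor[OF p(1) tM[OF U(1) V(1)]])
    have "M.g p (hor p (D U V p)) (?L p) = 0" by (rule Hor_Ver[OF p(1) L(2)[OF p(1)] H])
    then show ?thesis
      using M.met_diff_right[OF p(1) tM[OF U(1) V(1)] tM[OF V(1) U(1)] Hor_tan[OF H]]
      by (simp add: MD.D_torsion[OF p(1) U(1) V(1)])
  qed
  moreover have "M.g p (hor p (D V V p)) (D U U p) = M.g p (hor p (D U U p)) (hor p (D V V p))"
    using hh[OF tM[OF V(1) V(1)] tM[OF U(1) U(1)]]
      M.met_sym[OF p(1) Hor_tan[OF hor_Hor[OF p(1) tM[OF V(1) V(1)]]] Hor_tan[OF hor_Hor[OF p(1) tM[OF U(1) U(1)]]]] by simp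
  ultimately show ?thesis
    using Rm Rf deriv2[OF U V] deriv2[OF V U] third hh[OF tM[OF U(1) V(1)] tM[OF U(1) V(1)]] by simp
qed

text \<open>In g(D_V X, V) the vertical part of \<open>X\<close> gives the weight of the fibre, and
  the horizontal part, moved onto D_V V, gives the term with T_V V. The squared term is unchanged,
  because \<open>V\<close> sees only the vertical part of \<open>X\<close>.\<close>

lemma vertical_weighted:
  assumes p: "p \<in> pts M" and X: "M.VF X" and U: "M.VF U" "\<And>q. q \<in> pts M \<Longrightarrow> U q \<in> Ver q"
    and V: "M.VF V" "\<And>q. q \<in> pts M \<Longrightarrow> V q \<in> Ver q"
  defines "X' \<equiv> fibre_field M \<pi> (vertical_proj M B \<pi> X)"
  defines "R \<equiv> M.g p (oneill_T M B \<pi> D U V p) (oneill_T M B \<pi> D U V p)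
          - M.g p (oneill_T M B \<pi> D U U p) (oneill_T M B \<pi> D V V p)
          - M.g p (oneill_T M B \<pi> D V V p) (hor p (X p)) * M.g p (U p) (U p)"
  shows "wcurv_form M D X p (V p) (U p) (U p) =
      wcurv_form (Fb (\<pi> p)) (DF (\<pi> p)) X' p (tf p (V p)) (tf p (U p)) (tf p (U p)) + R"
    and "swcurv_form M D X p (V p) (U p) (U p) =
      swcurv_form (Fb (\<pi> p)) (DF (\<pi> p)) X' p (tf p (V p)) (tf p (U p)) (tf p (U p)) + R"
proof -
  let ?b = "\<pi> p"
  interpret F: levi_civita_space "Fb ?b" "DF ?b" using fibre_lc pi_pts p by blast
  have pF: "p \<in> pts (Fb ?b)" using p by (simp add: pts_fibre)
  let ?v = "\<lambda>q. ver q (X q)" and ?h = "\<lambda>q. hor q (X q)"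
  note Xt = M.vf_tan[OF X]
  have v: "M.VF ?v" "\<And>q. q \<in> pts M \<Longrightarrow> ?v q \<in> Ver q" and h: "M.VF ?h"
    using vf_ver[OF X] vf_hor[OF X] ver_Ver Xt by blast+
  note FV = vf_fibre_field[of _ ?b]
  note Up = U(2)[OF p] and Vp = V(2)[OF p]
  have X': "vector_field (Fb ?b) X'" unfolding X'_def by (rule FV[OF v])
  note tM = MD.D_tan[OF p]
  have "M.g p (D V X p) (V p) = M.g p (D V ?v p) (V p) + M.g p (D V ?h p) (V p)"
    unfolding D_split[OF p V(1) X]
    by (rule M.met_add_left[OF p tM[OF V(1) v(1)] tM[OF V(1) h] M.vf_tan[OF V(1) p]])
  also have "M.g p (D V ?h p) (V p) = - M.g p (?h p) (D V V p)"
    by (rule D_orthogonal[OF p V(1) h V(1)]) (intro Hor_Ver V hor_Hor Xt)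
  also have "M.g p (?h p) (D V V p) = M.g p (hor p (D V V p)) (?h p)"
    using met_hor[OF p tM[OF V(1) V(1)] hor_Hor[OF p Xt[OF p]]]
      M.met_sym[OF p tM[OF V(1) V(1)] Hor_tan[OF hor_Hor[OF p Xt[OF p]]]] by simp
  also have "M.g p (D V ?v p) (V p) = met (Fb ?b) p (DF ?b (fibre_field M \<pi> V) X' p) (tf p (V p))"
    unfolding X'_def by (rule met_fibre_connection[OF p refl V v Vp, symmetric])
  finally have w: "M.g p (D V X p) (V p) =
    met (Fb ?b) p (DF ?b (fibre_field M \<pi> V) X' p) (tf p (V p)) - M.g p (hor p (D V V p)) (?h p)" by simp
  show 1: "wcurv_form M D X p (V p) (U p) (U p) =
      wcurv_form (Fb (\<pi> p)) (DF (\<pi> p)) X' p (tf p (V p)) (tf p (U p)) (tf p (U p)) + R"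
    using MD.wcurv_form_eq[OF p X U(1) V(1)] F.wcurv_form_eq[OF pF X' FV[OF U] FV[OF V]]
      gauss_equation[OF p refl U V]
    by (simp add: R_def w oneill_T_eq p U V met_tf[OF p refl Up Up] algebra_simps)
  have "met (Fb ?b) p (X' p) (tf p (V p)) = M.g p (X p) (V p)"
    unfolding X'_def using met_tf[OF p refl v(2)[OF p] Vp] met_ver[OF p Xt[OF p] Vp] by simp
  then show "swcurv_form M D X p (V p) (U p) (U p) =
      swcurv_form (Fb (\<pi> p)) (DF (\<pi> p)) X' p (tf p (V p)) (tf p (U p)) (tf p (U p)) + R"
    using MD.swcurv_form_eq[OF p X U(1) V(1)] F.swcurv_form_eq[OF pF X' FV[OF U] FV[OF V]] 1
    by (simp add: met_tf[OF p refl Up Up])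
qed

end

context submersion_connections begin

subsection \<open>Horizontal directions\<close>

lemma met_Hor:
  assumes p: "p \<in> pts M" and v: "v \<in> M.T p" and h: "h \<in> Hor p"
  shows "M.g p v h = B.g (\<pi> p) (pf v) (pf h)"
  using met_hor[OF p v h] isometry[OF p hor_Hor[OF p v] h] pf_hor[OF p v] by simp

lemma Ver_eqI:
  assumes p: "p \<in> pts M" and "u \<in> Ver p" "v \<in> Ver p" and eq: "\<And>w. w \<in> Ver p \<Longrightarrow> M.g p u w = M.g p v w"
  shows "u = v"
proof (rule M.met_nondegenerate[OF p])
  show "u \<in> M.T p" "v \<in> M.T p" using assms by (simp_all add: Ver_tan)
  fix w assume w: "w \<in> M.T p"
  have *: "M.g p z w = M.g p z (ver p w)" if "z \<in> Ver p" for z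
    using met_ver[OF p w that] M.met_sym[OF p Ver_tan[OF that] w] M.met_sym[OF p Ver_tan[OF that] Ver_tan[OF ver_Ver[OF p w]]]
    by simp
  show "M.g p u w = M.g p v w"
    using *[OF assms(2)] *[OF assms(3)] eq[OF ver_Ver[OF p w]] by simp
qed

lemma Ver_extension:
  assumes p: "p \<in> pts M" and w: "w \<in> Ver p"
  obtains W where "M.VF W" "\<And>q. q \<in> pts M \<Longrightarrow> W q \<in> Ver q" "W p = w"
proof -
  obtain E where E: "M.VF E" "E p = w" using M.extension_exists[OF p Ver_tan[OF w]] by blast
  show thesis
    by (rule that[of "\<lambda>q. ver q (E q)"])
       (simp_all add: vf_ver[OF E(1)] ver_Ver M.vf_tan[OF E(1)] E(2) ver_of_Ver[OF p w])
qed

text \<open>Horizontal lifts paired with the base field they cover; the latter is an explicit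
  argument because the computations run in \<open>M\<close> and \<open>B\<close> in
  parallel.\<close>

definition basic :: "'a vfield \<Rightarrow> 'b vfield \<Rightarrow> bool" where
  "basic Y y \<longleftrightarrow> M.VF Y \<and> B.VF y \<and> (\<forall>q\<in>pts M. Y q \<in> Hor q \<and> pf (Y q) = y (\<pi> q))"

lemma basicD:
  assumes "basic Y y"
  shows "M.VF Y" "B.VF y" "q \<in> pts M \<Longrightarrow> Y q \<in> Hor q" "q \<in> pts M \<Longrightarrow> pf (Y q) = y (\<pi> q)"
  using assms by (simp_all add: basic_def)

lemma basic_exists:
  assumes p: "p \<in> pts M" and v: "v \<in> Hor p"
  obtains Y y where "basic Y y" "Y p = v"
proof -
  obtain y where y: "B.VF y" "y (\<pi> p) = pf v"
    using B.extension_exists[OF pi_pts[OF p] pf_tan[OF p Hor_tan[OF v]]] by blast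
  obtain Y where Y: "M.VF Y" "\<And>p. p \<in> pts M \<Longrightarrow> Y p \<in> Hor p" "\<And>p. p \<in> pts M \<Longrightarrow> pf (Y p) = y (\<pi> p)"
    by (rule lift_exists[OF y(1)]) blast
  show thesis
  proof (rule that)
    show "basic Y y" using Y y by (simp add: basic_def)
    show "Y p = v" by (rule Hor_pf_inj[OF p Y(2)[OF p] v]) (simp add: Y(3)[OF p] y(2))
  qed
qed

text \<open>g(Y,Z) is the pullback of a function on \<open>B\<close>. The direction \<open>X\<close>
  has to match \<open>x\<close> at \<open>p\<close> alone, so vertical directions, with
  \<open>x\<close> zero, and projectable fields are both covered.\<close>

lemma derivative_met_basic:
  assumes p: "p \<in> pts M" and X: "M.VF X" "pf (X p) = x (\<pi> p)" and Y: "basic Y y" and Z: "basic Z z"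
  shows "X p (\<lambda>q. M.g q (Y q) (Z q)) = x (\<pi> p) (\<lambda>b. B.g b (y b) (z b))"
proof -
  have "X p (\<lambda>q. M.g q (Y q) (Z q)) = X p ((\<lambda>b. B.g b (y b) (z b)) \<circ> \<pi>)"
  proof (rule M.tv_cong[OF M.vf_tan[OF X(1) p] p])
    fix q assume q: "q \<in> pts M"
    show "M.g q (Y q) (Z q) = ((\<lambda>b. B.g b (y b) (z b)) \<circ> \<pi>) q"
      using met_Hor[OF q M.vf_tan[OF basicD(1)[OF Y] q] basicD(3)[OF Z q]] basicD(4)[OF Y q] basicD(4)[OF Z q] by simp
  qed
  then show ?thesis
    using pf_apply[OF B.met_smooth[OF basicD(2)[OF Y] basicD(2)[OF Z]], of "X p"] X(2) by simp
qed

lemma met_bracket_basic: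
  assumes p: "p \<in> pts M" and X: "M.VF X" "\<And>q. q \<in> pts M \<Longrightarrow> pf (X q) = x (\<pi> q)" "B.VF x"
    and Y: "M.VF Y" "\<And>q. q \<in> pts M \<Longrightarrow> pf (Y q) = y (\<pi> q)" "B.VF y" and Z: "basic Z z"
  shows "M.g p (lie_bracket X Y p) (Z p) = B.g (\<pi> p) (lie_bracket x y (\<pi> p)) (z (\<pi> p))"
  using met_Hor[OF p M.vf_tan[OF M.vf_bracket[OF X(1) Y(1)] p] basicD(3)[OF Z p]]
    bracket_related[OF p X Y] basicD(4)[OF Z p] by simp

lemma base_connection:
  assumes p: "p \<in> pts M" and Y: "basic Y y" and Z: "basic Z z"
  shows "pf (D Y Z p) = DB y z (\<pi> p)"
proof (rule B.met_nondegenerate[OF pi_pts[OF p]])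
  note bp = pi_pts[OF p]
  note DT = MD.D_tan[OF p basicD(1)[OF Y] basicD(1)[OF Z]]
  show "pf (D Y Z p) \<in> B.T (\<pi> p)" by (rule pf_tan[OF p DT])
  show "DB y z (\<pi> p) \<in> B.T (\<pi> p)" by (rule BD.D_tan[OF bp basicD(2)[OF Y] basicD(2)[OF Z]])
  fix u assume u: "u \<in> B.T (\<pi> p)"
  obtain v where v: "v \<in> M.T p" "pf v = u" using pf_surj[OF p] u by (metis imageE)
  obtain W w where W: "basic W w" "W p = hor p v" by (rule basic_exists[OF p hor_Hor[OF p v(1)]])
  have wu: "w (\<pi> p) = u" using basicD(4)[OF W(1) p] W(2) pf_hor[OF p v(1)] v(2) by simp
  have d: "X p (\<lambda>q. M.g q (Y q) (Z q)) = x (\<pi> p) (\<lambda>b. B.g b (y b) (z b))"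
    if "basic X x" "basic Y y" "basic Z z" for X x Y y Z z
    by (rule derivative_met_basic[of p X x, OF p basicD(1)[OF that(1)] basicD(4)[OF that(1) p] that(2,3)])
  have b: "M.g p (lie_bracket X Y p) (Z p) = B.g (\<pi> p) (lie_bracket x y (\<pi> p)) (z (\<pi> p))"
    if "basic X x" "basic Y y" "basic Z z" for X x Y y Z z
    using that by (intro met_bracket_basic[OF p _ _ _ _ _ _ that(3)]) (simp_all add: basic_def)
  have "2 * M.g p (D Y Z p) (W p) = 2 * B.g (\<pi> p) (DB y z (\<pi> p)) (w (\<pi> p))"
    using MD.koszul[OF p basicD(1)[OF Y] basicD(1)[OF Z] basicD(1)[OF W(1)]]
      BD.koszul[OF bp basicD(2)[OF Y] basicD(2)[OF Z] basicD(2)[OF W(1)]]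
      d[OF Y Z W(1)] d[OF Z W(1) Y] d[OF W(1) Y Z] b[OF Y Z W(1)] b[OF Y W(1) Z] b[OF Z W(1) Y] by simp
  then show "B.g (\<pi> p) (pf (D Y Z p)) u = B.g (\<pi> p) (DB y z (\<pi> p)) u"
    using met_Hor[OF p DT basicD(3)[OF W(1) p]] basicD(4)[OF W(1) p] wu by simp
qed

lemma met_connection_basic:
  assumes p: "p \<in> pts M" and Y: "basic Y y" and Z: "basic Z z" and W: "basic W w"
  shows "M.g p (D Y Z p) (W p) = B.g (\<pi> p) (DB y z (\<pi> p)) (w (\<pi> p))"
  using met_Hor[OF p MD.D_tan[OF p basicD(1)[OF Y] basicD(1)[OF Z]] basicD(3)[OF W p]]
    base_connection[OF p Y Z] basicD(4)[OF W p] by simp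

lemma basic_hor:
  assumes X: "M.VF X" "\<And>q. q \<in> pts M \<Longrightarrow> pf (X q) = x (\<pi> q)" "B.VF x"
  shows "basic (\<lambda>q. hor q (X q)) x"
  using vf_hor[OF X(1)] X(2,3) M.vf_tan[OF X(1)] by (simp add: basic_def hor_Hor pf_hor)

text \<open>Keeps the comparison going for second derivatives: the horizontal part of D_Y Z is a
  basic field again.\<close>

lemma basic_hor_connection:
  assumes Y: "basic Y y" and Z: "basic Z z"
  shows "basic (\<lambda>q. hor q (D Y Z q)) (DB y z)"
  by (rule basic_hor[OF MD.D_vf[OF basicD(1)[OF Y] basicD(1)[OF Z]] _ BD.D_vf[OF basicD(2)[OF Y] basicD(2)[OF Z]]])
     (rule base_connection[OF _ Y Z])

text \<open>The right-hand side involves \<open>Z\<close> undifferentiated, so the vertical part of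
  D_Y Z depends on \<open>Y\<close> and \<open>Z\<close> through their values at the point.\<close>

lemma met_A:
  assumes p: "p \<in> pts M" and Y: "M.VF Y" and Z: "M.VF Z" "\<And>q. q \<in> pts M \<Longrightarrow> Z q \<in> Hor q"
    and W: "M.VF W" "\<And>q. q \<in> pts M \<Longrightarrow> W q \<in> Ver q"
  shows "M.g p (D Y Z p) (W p) = - M.g p (Z p) (D Y W p)"
  by (rule D_orthogonal[OF p Y Z(1) W(1)]) (intro Hor_Ver Z W)

text \<open>The bracket of a basic and a vertical field is vertical and pairs to zero with
  \<open>Z\<close>, so the torsion identity exchanges \<open>Y\<close> and \<open>W\<close>.\<close>

lemma met_D_vertical:
  assumes p: "p \<in> pts M" and Y: "basic Y y" and Z: "M.VF Z" "\<And>q. q \<in> pts M \<Longrightarrow> Z q \<in> Hor q"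
    and W: "M.VF W" "\<And>q. q \<in> pts M \<Longrightarrow> W q \<in> Ver q"
  shows "M.g p (Z p) (D Y W p) = M.g p (Z p) (D W Y p)"
proof -
  have "lie_bracket Y W p \<in> Ver p"
    by (rule bracket_Ver[OF p basicD(1)[OF Y] basicD(4)[OF Y] basicD(2)[OF Y] W])
  then have "M.g p (Z p) (lie_bracket Y W p) = 0" by (rule Hor_Ver[OF p _ Z(2)[OF p]])
  then show ?thesis
    using M.met_diff_right[OF p MD.D_tan[OF p basicD(1)[OF Y] W(1)] MD.D_tan[OF p W(1) basicD(1)[OF Y]] M.vf_tan[OF Z(1) p]]
    by (simp add: MD.D_torsion[OF p basicD(1)[OF Y] W(1)])
qed

text \<open>Inner products of basic fields are constant along the fibres, so their derivative along
  \<open>W\<close> is 0; compatibility and the exchange of arguments turn this into skewness of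
  A.\<close>

lemma A_skew:
  assumes p: "p \<in> pts M" and Y: "basic Y y" and Z: "basic Z z"
    and W: "M.VF W" "\<And>q. q \<in> pts M \<Longrightarrow> W q \<in> Ver q"
  shows "M.g p (D Y Z p) (W p) = - M.g p (D Z Y p) (W p)"
proof -
  note Y' = basicD(1,3)[OF Y] and Z' = basicD(1,3)[OF Z]
  note t = M.vf_tan[OF Y'(1) p] M.vf_tan[OF Z'(1) p] MD.D_tan[OF p W(1) Y'(1)] MD.D_tan[OF p W(1) Z'(1)]
  have "M.g p (D W Y p) (Z p) + M.g p (Y p) (D W Z p) = W p (\<lambda>q. M.g q (Y q) (Z q))"
    by (rule MD.D_compat[OF p W(1) Y'(1) Z'(1), symmetric])
  also have "\<dots> = 0"
    using derivative_met_basic[of p W "\<lambda>b f. 0", OF p W(1) _ Y Z] W(2)[OF p] by (simp add: Ver_iff)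
  finally have "M.g p (Z p) (D W Y p) + M.g p (Y p) (D W Z p) = 0"
    using M.met_sym[OF p t(3) t(2)] by simp
  then show ?thesis
    using met_A[OF p Y'(1) Z' W] met_A[OF p Z'(1) Y' W] met_D_vertical[OF p Y Z' W] met_D_vertical[OF p Z Y' W] by simp
qed

text \<open>Allows horizontal fields to be replaced by basic ones with the same values at
  \<open>p\<close>, for which skewness is available.\<close>

lemma A_pointwise:
  assumes p: "p \<in> pts M" and Y: "M.VF Y" "M.VF Y'" "Y p = Y' p"
    and Z: "M.VF Z" "\<And>q. q \<in> pts M \<Longrightarrow> Z q \<in> Hor q" "M.VF Z'" "\<And>q. q \<in> pts M \<Longrightarrow> Z' q \<in> Hor q" "Z p = Z' p"
  shows "ver p (D Y Z p) = ver p (D Y' Z' p)"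
proof (rule Ver_eqI[OF p])
  note t = MD.D_tan[OF p Y(1) Z(1)] MD.D_tan[OF p Y(2) Z(3)]
  show "ver p (D Y Z p) \<in> Ver p" "ver p (D Y' Z' p) \<in> Ver p" using ver_Ver[OF p] t by blast+
  fix w assume w: "w \<in> Ver p"
  obtain W where W: "M.VF W" "\<And>q. q \<in> pts M \<Longrightarrow> W q \<in> Ver q" "W p = w" by (rule Ver_extension[OF p w]) blast
  show "M.g p (ver p (D Y Z p)) w = M.g p (ver p (D Y' Z' p)) w"
    using met_ver[OF p t(1) w] met_ver[OF p t(2) w] met_A[OF p Y(1) Z(1,2) W(1,2)] met_A[OF p Y(2) Z(3,4) W(1,2)]
      MD.D_pointwise[OF p Y(1,2) W(1) Y(3)] W(3) Z(5) by simp
qed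

text \<open>With s = |A_Y Z|^2 the three terms of the curvature exceed those of the base by 0, s and
  2 s; the last two are subtracted.\<close>

lemma oneill_equation:
  assumes p: "p \<in> pts M" and Y: "basic Y y" and Z: "basic Z z"
  shows "M.g p (curvature_field D Y Z Z p) (Y p) =
    B.g (\<pi> p) (curvature_field DB y z z (\<pi> p)) (y (\<pi> p)) - 3 * M.g p (ver p (D Y Z p)) (ver p (D Y Z p))"
proof -
  note bp = pi_pts[OF p]
  note Y' = basicD(1,3)[OF Y] and Z' = basicD(1,3)[OF Z] and y = basicD(2)[OF Y] and z = basicD(2)[OF Z]
  note tM = MD.D_tan[OF p]
  note Yt = M.vf_tan[OF Y'(1) p]
  have DYZ: "M.VF (D Y Z)" and DZZ: "M.VF (D Z Z)" by (intro MD.D_vf Y'(1) Z'(1))+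
  let ?N = "\<lambda>q. ver q (D Y Z q)"
  have N: "M.VF ?N" "\<And>q. q \<in> pts M \<Longrightarrow> ?N q \<in> Ver q"
    using vf_ver[OF DYZ] ver_Ver M.vf_tan[OF DYZ] by blast+
  let ?s = "M.g p (?N p) (?N p)"
  have s: "M.g p (D Y Z p) (?N p) = ?s" by (rule met_ver[OF p tM[OF Y'(1) Z'(1)] N(2)[OF p], symmetric])
  have t1: "M.g p (D Y (D Z Z) p) (Y p) = B.g (\<pi> p) (DB y (DB z z) (\<pi> p)) (y (\<pi> p))"
  proof -
    \<comment> \<open>Skewness with equal arguments makes A_Z Z zero, so D_Z Z is horizontal and the
      whole term comes from the base.\<close>
    have "D Z Z q = hor q (D Z Z q)" if q: "q \<in> pts M" for q
    proof -
      note t = M.vf_tan[OF DZZ q]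
      obtain W where W: "M.VF W" "\<And>q. q \<in> pts M \<Longrightarrow> W q \<in> Ver q" "W q = ver q (D Z Z q)"
        by (rule Ver_extension[OF q ver_Ver[OF q t]]) blast
      have "M.g q (D Z Z q) (W q) = 0" using A_skew[OF q Z Z W(1,2)] by simp
      then have "M.g q (ver q (D Z Z q)) (ver q (D Z Z q)) = 0"
        using met_ver[OF q t ver_Ver[OF q t]] W(3) by simp
      then have "ver q (D Z Z q) = (\<lambda>f. 0)"
        using M.met_pos[OF q Ver_tan[OF ver_Ver[OF q t]]] by force
      then show ?thesis using ver_eq[OF q t] by (simp add: fun_eq_iff)
    qed
    then have "D Y (D Z Z) p = D Y (\<lambda>q. hor q (D Z Z q)) p"
      by (intro MD.D_cong_right[OF p Y'(1) DZZ vf_hor[OF DZZ]])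
    then show ?thesis using met_connection_basic[OF p Y basic_hor_connection[OF Z Z] Y] by simp
  qed
  have t2: "M.g p (D Z (D Y Z) p) (Y p) = B.g (\<pi> p) (DB z (DB y z) (\<pi> p)) (y (\<pi> p)) + ?s"
  proof -
    \<comment> \<open>The vertical part of D_Y Z contributes - g(A_Y Z, D_Z Y), which is s by
      skewness.\<close>
    have "M.g p (D Z ?N p) (Y p) = - M.g p (?N p) (D Z Y p)"
      by (rule D_orthogonal[OF p Z'(1) N(1) Y'(1)]) (intro Ver_Hor N Y')
    also have "\<dots> = ?s"
      using A_skew[OF p Y Z N] s M.met_sym[OF p Ver_tan[OF N(2)[OF p]] tM[OF Z'(1) Y'(1)]] by simp
    finally have v: "M.g p (D Z ?N p) (Y p) = ?s" .
    show ?thesis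
      unfolding D_split[OF p Z'(1) DYZ]
      using M.met_add_left[OF p tM[OF Z'(1) N(1)] tM[OF Z'(1) vf_hor[OF DYZ]] Yt] v
        met_connection_basic[OF p Z basic_hor_connection[OF Y Z] Y] by simp
  qed
  let ?L = "lie_bracket Y Z"
  have L: "M.VF ?L" by (rule M.vf_bracket[OF Y'(1) Z'(1)])
  note Lt = M.vf_tan[OF L]
  have t3: "M.g p (D ?L Z p) (Y p) = B.g (\<pi> p) (DB (lie_bracket y z) z (\<pi> p)) (y (\<pi> p)) + 2 * ?s"
  proof -
    let ?v = "\<lambda>q. ver q (?L q)" and ?h = "\<lambda>q. hor q (?L q)"
    have v: "M.VF ?v" "\<And>q. q \<in> pts M \<Longrightarrow> ?v q \<in> Ver q" and h: "M.VF ?h"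
      using vf_ver[OF L] vf_hor[OF L] ver_Ver Lt by blast+
    have hb: "basic ?h (lie_bracket y z)"
      by (rule basic_hor[OF L _ B.vf_bracket[OF y z]])
         (rule bracket_related[OF _ Y'(1) basicD(4)[OF Y] y Z'(1) basicD(4)[OF Z] z])
    have "D ?L Z p = D (\<lambda>q f. ?v q f + ?h q f) Z p"
      by (rule MD.D_pointwise[OF p L M.vf_add[OF v(1) h] Z'(1)]) (simp add: ver_eq[OF p Lt[OF p]])
    also have "\<dots> = (\<lambda>f. D ?v Z p f + D ?h Z p f)"
      using MD.D_add_left[OF p v(1) h Z'(1)] by blast
    finally have "M.g p (D ?L Z p) (Y p) = M.g p (D ?v Z p) (Y p) + M.g p (D ?h Z p) (Y p)"
      using M.met_add_left[OF p tM[OF v(1) Z'(1)] tM[OF h Z'(1)] Yt] by simp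
    moreover have "M.g p (D ?h Z p) (Y p) = B.g (\<pi> p) (DB (lie_bracket y z) z (\<pi> p)) (y (\<pi> p))"
      by (rule met_connection_basic[OF p hb Z Y])
    \<comment> \<open>The vertical part of [Y,Z] is 2 A_Y Z. Exchanging the arguments of
      \<open>D\<close> and moving the derivative onto \<open>Y\<close> pairs it with A_Y Z once
      more.\<close>
    moreover have "M.g p (D ?v Z p) (Y p) = 2 * ?s"
    proof -
      have "M.g p (D ?v Z p) (Y p) = M.g p (Y p) (D Z ?v p)"
        using met_D_vertical[OF p Z Y' v] M.met_sym[OF p tM[OF v(1) Z'(1)] Yt] by simp
      also have "\<dots> = - M.g p (D Z Y p) (?v p)"
        using met_A[OF p Z'(1) Y' v] by simp
      also have "\<dots> = M.g p (D Y Z p) (?v p)" using A_skew[OF p Y Z v] by simp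
      also have "\<dots> = M.g p (?N p) (?v p)"
        by (rule met_ver[OF p tM[OF Y'(1) Z'(1)] v(2)[OF p], symmetric])
      also have "\<dots> = M.g p (?L p) (?N p)"
        using met_ver[OF p Lt[OF p] N(2)[OF p]] M.met_sym[OF p Ver_tan[OF N(2)[OF p]] Ver_tan[OF v(2)[OF p]]] by simp
      also have "\<dots> = M.g p (D Y Z p) (?N p) - M.g p (D Z Y p) (?N p)"
        unfolding MD.D_torsion[OF p Y'(1) Z'(1)]
        by (rule M.met_diff_left[OF p tM[OF Y'(1) Z'(1)] tM[OF Z'(1) Y'(1)] Ver_tan[OF N(2)[OF p]]])
      finally show ?thesis using A_skew[OF p Y Z N] s by simp
    qed
    ultimately show ?thesis by simp
  qed
  have Rm: "M.g p (curvature_field D Y Z Z p) (Y p) =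
      M.g p (D Y (D Z Z) p) (Y p) - M.g p (D Z (D Y Z) p) (Y p) - M.g p (D ?L Z p) (Y p)"
    unfolding curvature_field_def
    by (simp add: M.met_diff_left[OF p] M.tv_minus' tM Y'(1) Z'(1) DYZ DZZ L Yt)
  note tB = BD.D_tan[OF bp]
  have Rb: "B.g (\<pi> p) (curvature_field DB y z z (\<pi> p)) (y (\<pi> p)) =
      B.g (\<pi> p) (DB y (DB z z) (\<pi> p)) (y (\<pi> p)) - B.g (\<pi> p) (DB z (DB y z) (\<pi> p)) (y (\<pi> p))
      - B.g (\<pi> p) (DB (lie_bracket y z) z (\<pi> p)) (y (\<pi> p))"
    unfolding curvature_field_def
    by (simp add: B.met_diff_left[OF bp] B.tv_minus' tB y z BD.D_vf B.vf_bracket B.vf_tan[OF y bp])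
  show ?thesis using Rm Rb t1 t2 t3 by simp
qed

text \<open>The derivative of \<open>f\<close> along the projected field pulls back to X(f \<circ>
  \<pi>), a smooth function on \<open>M\<close>, and therefore descends.\<close>

lemma vf_projected:
  assumes X: "M.VF X" and pr: "projectable M B \<pi> X"
  shows "p \<in> pts M \<Longrightarrow> pf (X p) = projected_field M B \<pi> X (\<pi> p)" and "B.VF (projected_field M B \<pi> X)"
proof -
  show eq: "pf (X p) = projected_field M B \<pi> X (\<pi> p)" if p: "p \<in> pts M" for p
  proof -
    have "(SOME q. q \<in> pts M \<and> \<pi> q = \<pi> p) \<in> pts M \<and> \<pi> (SOME q. q \<in> pts M \<and> \<pi> q = \<pi> p) = \<pi> p"
      by (rule someI[of _ p]) (use p in simp)
    then show ?thesis using pr p unfolding projectable_def projected_field_def by metis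
  qed
  show "B.VF (projected_field M B \<pi> X)"
  proof (rule B.vfI)
    fix b assume "b \<in> pts B"
    then obtain p where p: "p \<in> pts M" "\<pi> p = b" using pi_onto by blast
    then show "projected_field M B \<pi> X b \<in> B.T b"
      using eq[OF p(1)] pf_tan[OF p(1) M.vf_tan[OF X p(1)]] by simp
  next
    fix f assume f: "f \<in> smf B"
    show "(\<lambda>b. projected_field M B \<pi> X b f) \<in> smf B"
    proof (rule descend, rule M.smf_cong[OF M.vf_smf[OF X, of "f \<circ> \<pi>"]])
      show "X q (f \<circ> \<pi>) = ((\<lambda>b. projected_field M B \<pi> X b f) \<circ> \<pi>) q" if "q \<in> pts M" for q
        using eq[OF that] pf_apply[OF f, of "X q"] by simp
    qed
  qed
qed

text \<open>[Z,X] is \<pi>-related to the bracket on the base, which reduces the claim to D_X Z; and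
  g(D_X Z, Z) is half the derivative of g(Z,Z) along \<open>X\<close>. This treats the vertical part
  of \<open>X\<close> without splitting it off.\<close>

lemma met_D_projectable:
  assumes p: "p \<in> pts M" and X: "M.VF X" "\<And>q. q \<in> pts M \<Longrightarrow> pf (X q) = x (\<pi> q)" "B.VF x" and Z: "basic Z z"
  shows "M.g p (D Z X p) (Z p) = B.g (\<pi> p) (DB z x (\<pi> p)) (z (\<pi> p))"
proof -
  note bp = pi_pts[OF p] and Z1 = basicD(1)[OF Z] and z = basicD(2)[OF Z]
  note t = MD.D_tan[OF p Z1 X(1)] MD.D_tan[OF p X(1) Z1] M.vf_tan[OF Z1 p]
  note t' = BD.D_tan[OF bp z X(3)] BD.D_tan[OF bp X(3) z] B.vf_tan[OF z bp]
  have "M.g p (lie_bracket Z X p) (Z p) = B.g (\<pi> p) (lie_bracket z x (\<pi> p)) (z (\<pi> p))"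
    by (rule met_bracket_basic[OF p Z1 basicD(4)[OF Z] z X Z])
  then have "M.g p (D Z X p) (Z p) - M.g p (D X Z p) (Z p) =
      B.g (\<pi> p) (DB z x (\<pi> p)) (z (\<pi> p)) - B.g (\<pi> p) (DB x z (\<pi> p)) (z (\<pi> p))"
    using M.met_diff_left[OF p t] B.met_diff_left[OF bp t']
    by (simp add: MD.D_torsion[OF p Z1 X(1)] BD.D_torsion[OF bp z X(3)])
  moreover have "2 * M.g p (D X Z p) (Z p) = 2 * B.g (\<pi> p) (DB x z (\<pi> p)) (z (\<pi> p))"
    using derivative_met_basic[of p X x, OF p X(1) X(2)[OF p] Z Z] MD.D_compat[OF p X(1) Z1 Z1] BD.D_compat[OF bp X(3) z z]
      M.met_sym[OF p t(2,3)] B.met_sym[OF bp t'(2,3)] by simp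
  ultimately show ?thesis by simp
qed

text \<open>The quantities compared depend on the values of \<open>Y\<close> and \<open>Z\<close> at
  \<open>p\<close>, so basic fields with these values can be substituted. The third identity is
  stated with A_Z Y because the sectional identity uses the first two with \<open>Y\<close> and
  \<open>Z\<close> exchanged.\<close>

lemma horizontal_weighted:
  assumes p: "p \<in> pts M" and X: "M.VF X" "projectable M B \<pi> X"
    and Y: "M.VF Y" "\<And>q. q \<in> pts M \<Longrightarrow> Y q \<in> Hor q" and Z: "M.VF Z" "\<And>q. q \<in> pts M \<Longrightarrow> Z q \<in> Hor q"
  defines "x \<equiv> projected_field M B \<pi> X"
  shows "wcurv_form M D X p (Z p) (Y p) (Y p) = wcurv_form B DB x (\<pi> p) (pf (Z p)) (pf (Y p)) (pf (Y p))
          - 3 * M.g p (oneill_A M B \<pi> D Y Z p) (oneill_A M B \<pi> D Y Z p)"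
    and "swcurv_form M D X p (Z p) (Y p) (Y p) = swcurv_form B DB x (\<pi> p) (pf (Z p)) (pf (Y p)) (pf (Y p))
          - 3 * M.g p (oneill_A M B \<pi> D Y Z p) (oneill_A M B \<pi> D Y Z p)"
    and "M.g p (ver p (lie_bracket Y Z p)) (ver p (lie_bracket Y Z p)) =
          4 * M.g p (oneill_A M B \<pi> D Z Y p) (oneill_A M B \<pi> D Z Y p)"
proof -
  note bp = pi_pts[OF p]
  have x: "\<And>q. q \<in> pts M \<Longrightarrow> pf (X q) = x (\<pi> q)" "B.VF x" unfolding x_def using vf_projected[OF X] by blast+
  obtain Y' y where Y': "basic Y' y" "Y' p = Y p" by (rule basic_exists[OF p Y(2)[OF p]])
  obtain Z' z where Z': "basic Z' z" "Z' p = Z p" by (rule basic_exists[OF p Z(2)[OF p]])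
  note BY = basicD[OF Y'(1)] and BZ = basicD[OF Z'(1)]
  have yz: "y (\<pi> p) = pf (Y p)" "z (\<pi> p) = pf (Z p)" using BY(4)[OF p] BZ(4)[OF p] Y'(2) Z'(2) by simp_all
  have AYZ: "oneill_A M B \<pi> D Y Z p = ver p (D Y Z p)" by (rule oneill_A_eq[OF p Y Z])
  also have "\<dots> = ver p (D Y' Z' p)"
    by (rule A_pointwise[OF p Y(1) BY(1) Y'(2)[symmetric] Z BZ(1) BZ(3) Z'(2)[symmetric]])
  finally have A: "oneill_A M B \<pi> D Y Z p = ver p (D Y' Z' p)" .
  have AZY: "oneill_A M B \<pi> D Z Y p = ver p (D Z Y p)" by (rule oneill_A_eq[OF p Z Y])
  also have "\<dots> = ver p (D Z' Y' p)"
    by (rule A_pointwise[OF p Z(1) BZ(1) Z'(2)[symmetric] Y BY(1) BY(3) Y'(2)[symmetric]])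
  finally have A': "oneill_A M B \<pi> D Z Y p = ver p (D Z' Y' p)" .
  have gY: "M.g p (Y p) (Y p) = B.g (\<pi> p) (pf (Y p)) (pf (Y p))"
    by (rule met_Hor[OF p Hor_tan[OF Y(2)[OF p]] Y(2)[OF p]])
  \<comment> \<open>A horizontal \<open>Z\<close> sees only the horizontal part of \<open>X\<close>,
    so the squared term agrees with that of the base.\<close>
  have gX: "M.g p (X p) (Z p) = B.g (\<pi> p) (x (\<pi> p)) (pf (Z p))"
    using met_Hor[OF p M.vf_tan[OF X(1) p] Z(2)[OF p]] x(1)[OF p] by simp
  show 1: "wcurv_form M D X p (Z p) (Y p) (Y p) = wcurv_form B DB x (\<pi> p) (pf (Z p)) (pf (Y p)) (pf (Y p))
          - 3 * M.g p (oneill_A M B \<pi> D Y Z p) (oneill_A M B \<pi> D Y Z p)"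
    using MD.wcurv_form_eq[OF p X(1) BY(1) BZ(1)] BD.wcurv_form_eq[OF bp x(2) BY(2) BZ(2)]
      oneill_equation[OF p Y'(1) Z'(1)] met_D_projectable[OF p X(1) x Z'(1)]
    by (simp add: A Y'(2) Z'(2) yz gY)
  show "swcurv_form M D X p (Z p) (Y p) (Y p) = swcurv_form B DB x (\<pi> p) (pf (Z p)) (pf (Y p)) (pf (Y p))
          - 3 * M.g p (oneill_A M B \<pi> D Y Z p) (oneill_A M B \<pi> D Y Z p)"
    using MD.swcurv_form_eq[OF p X(1) Y(1) Z(1)] BD.swcurv_form_eq[OF bp x(2) BY(2) BZ(2)] 1
    by (simp add: yz gY gX)
  let ?N = "ver p (D Z' Y' p)"
  note t = MD.D_tan[OF p Y(1) Z(1)] MD.D_tan[OF p Z(1) Y(1)] MD.D_tan[OF p BY(1) BZ(1)] MD.D_tan[OF p BZ(1) BY(1)]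
  note N = ver_Ver[OF p t(4)]
  note Lt = M.vf_tan[OF M.vf_bracket[OF Y(1) Z(1)] p]
  \<comment> \<open>By skewness A_Y Z - A_Z Y = -2 A_Z Y. The summand with factor 0 gives the vector
    the shape of \<open>Ver_lin\<close>.\<close>
  have "ver p (lie_bracket Y Z p) = (\<lambda>f. (- 2) * ?N f + 0 * ?N f)"
  proof (rule Ver_eqI[OF p ver_Ver[OF p Lt] Ver_lin[OF N N]])
    fix w assume w: "w \<in> Ver p"
    obtain W where W: "M.VF W" "\<And>q. q \<in> pts M \<Longrightarrow> W q \<in> Ver q" "W p = w" by (rule Ver_extension[OF p w]) blast
    have e: "ver p (D Y Z p) = ver p (D Y' Z' p)" "ver p (D Z Y p) = ?N"
      using A A' AYZ AZY by simp_all
    have "M.g p (ver p (lie_bracket Y Z p)) w = M.g p (D Y Z p) w - M.g p (D Z Y p) w"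
      using met_ver[OF p Lt w] M.met_diff_left[OF p t(1,2) Ver_tan[OF w]]
      by (simp add: MD.D_torsion[OF p Y(1) Z(1)])
    also have "\<dots> = M.g p (D Y' Z' p) w - M.g p (D Z' Y' p) w"
      using met_ver[OF p t(1) w] met_ver[OF p t(2) w] met_ver[OF p t(3) w] met_ver[OF p t(4) w] e by simp
    also have "\<dots> = - 2 * M.g p ?N w"
      using A_skew[OF p Y'(1) Z'(1) W(1,2)] W(3) met_ver[OF p t(4) w] by simp
    finally show "M.g p (ver p (lie_bracket Y Z p)) w = M.g p (\<lambda>f. (- 2) * ?N f + 0 * ?N f) w"
      using M.met_lin[OF p Ver_tan[OF N] Ver_tan[OF N] Ver_tan[OF w], of "- 2" 0] by simp
  qed
  then have L: "ver p (lie_bracket Y Z p) = (\<lambda>f. (- 2) * ?N f)" by simp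
  show "M.g p (ver p (lie_bracket Y Z p)) (ver p (lie_bracket Y Z p)) =
          4 * M.g p (oneill_A M B \<pi> D Z Y p) (oneill_A M B \<pi> D Z Y p)"
    unfolding L A' M.met_scale_left[OF p Ver_tan[OF N] M.tv_scale[OF Ver_tan[OF N]]]
      M.met_scale_right[OF p Ver_tan[OF N] Ver_tan[OF N]] by simp
qed

end

theorem theorem4p1:
  fixes M :: "('a, 'm::euclidean_space) rmanifold"
    and B :: "('b, 'n::euclidean_space) rmanifold"
    and \<pi> :: "'a \<Rightarrow> 'b"
    and D :: "'a vfield \<Rightarrow> 'a vfield \<Rightarrow> 'a vfield"
    and DF :: "'b \<Rightarrow> 'a vfield \<Rightarrow> 'a vfield \<Rightarrow> 'a vfield"
    and DB :: "'b vfield \<Rightarrow> 'b vfield \<Rightarrow> 'b vfield"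
    and X Y Z U V :: "'a vfield"
  assumes "closed_riemannian_manifold M"
    and "riemannian_manifold B"
    and "riemannian_submersion M B \<pi>"
    and "levi_civita M D"
    and "\<And>b. b \<in> pts B \<Longrightarrow> levi_civita (fibre M \<pi> b) (DF b)"
    and "levi_civita B DB"
    and "vector_field M X" and "projectable M B \<pi> X"
    and "horizontal_field M B \<pi> Y" and "horizontal_field M B \<pi> Z"
    and "vertical_field M B \<pi> U" and "vertical_field M B \<pi> V"
  shows "\<forall>p\<in>pts M.
       (wcurv_form M D X p (V p) (U p) (U p) =
          wcurv_form (fibre M \<pi> (\<pi> p)) (DF (\<pi> p)) (fibre_field M \<pi> (vertical_proj M B \<pi> X)) p
            (to_fibre M \<pi> p (V p)) (to_fibre M \<pi> p (U p)) (to_fibre M \<pi> p (U p))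
          + met M p (oneill_T M B \<pi> D U V p) (oneill_T M B \<pi> D U V p)
          - met M p (oneill_T M B \<pi> D U U p) (oneill_T M B \<pi> D V V p)
          - met M p (oneill_T M B \<pi> D V V p) (horizontal_part M B \<pi> p (X p)) * met M p (U p) (U p)) \<and>
       (wcurv_form M D X p (Z p) (Y p) (Y p) =
          wcurv_form B DB (projected_field M B \<pi> X) (\<pi> p)
            (pushforward B \<pi> (Z p)) (pushforward B \<pi> (Y p)) (pushforward B \<pi> (Y p))
          - 3 * met M p (oneill_A M B \<pi> D Y Z p) (oneill_A M B \<pi> D Y Z p)) \<and>
       (swcurv_form M D X p (V p) (U p) (U p) =
          swcurv_form (fibre M \<pi> (\<pi> p)) (DF (\<pi> p)) (fibre_field M \<pi> (vertical_proj M B \<pi> X)) p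
            (to_fibre M \<pi> p (V p)) (to_fibre M \<pi> p (U p)) (to_fibre M \<pi> p (U p))
          + met M p (oneill_T M B \<pi> D U V p) (oneill_T M B \<pi> D U V p)
          - met M p (oneill_T M B \<pi> D U U p) (oneill_T M B \<pi> D V V p)
          - met M p (oneill_T M B \<pi> D V V p) (horizontal_part M B \<pi> p (X p)) * met M p (U p) (U p)) \<and>
       (swcurv_form M D X p (Z p) (Y p) (Y p) =
          swcurv_form B DB (projected_field M B \<pi> X) (\<pi> p)
            (pushforward B \<pi> (Z p)) (pushforward B \<pi> (Y p)) (pushforward B \<pi> (Y p))
          - 3 * met M p (oneill_A M B \<pi> D Y Z p) (oneill_A M B \<pi> D Y Z p)) \<and>
       (met M p (Y p) (Y p) = 1 \<and> met M p (Z p) (Z p) = 1 \<and> met M p (Y p) (Z p) = 0 \<longrightarrow>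
          wsec B DB (projected_field M B \<pi> X) (\<pi> p) (pushforward B \<pi> (Y p)) (pushforward B \<pi> (Z p)) =
            wsec M D X p (Y p) (Z p)
            + 3/4 * met M p (vertical_part M B \<pi> p (lie_bracket Y Z p))
                            (vertical_part M B \<pi> p (lie_bracket Y Z p))) \<and>
       (met M p (Y p) (Y p) = 1 \<and> met M p (Z p) (Z p) = 1 \<and> met M p (Y p) (Z p) = 0 \<longrightarrow>
          swsec B DB (projected_field M B \<pi> X) (\<pi> p) (pushforward B \<pi> (Y p)) (pushforward B \<pi> (Z p)) =
            swsec M D X p (Y p) (Z p)
            + 3/4 * met M p (vertical_part M B \<pi> p (lie_bracket Y Z p))
                            (vertical_part M B \<pi> p (lie_bracket Y Z p)))"
proof (rule ballI, goal_cases)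
  case (1 p)
  note p = \<open>p \<in> pts M\<close>
  have M: "smooth_manifold M" "riemannian_metric M" and B: "smooth_manifold B" "riemannian_metric B"
    using assms(1,2) by (simp_all add: closed_riemannian_manifold_def riemannian_manifold_def)
  obtain e n where e: "mfd M e n" by (rule mfd_exists[OF M(1)])
  obtain d m where d: "mfd B d m" by (rule mfd_exists[OF B(1)])
  interpret submersion_connections M e n B d m \<pi> D DF DB
    by (intro submersion_connections.intro submersion_connections_axioms.intro riem_submersion.intro
        riem_submersion_axioms.intro riemannian_mfd.intro riemannian_mfd_axioms.intro e d M B assms)
  have Y: "M.VF Y" "\<And>q. q \<in> pts M \<Longrightarrow> Y q \<in> Hor q" and Z: "M.VF Z" "\<And>q. q \<in> pts M \<Longrightarrow> Z q \<in> Hor q"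
    and U: "M.VF U" "\<And>q. q \<in> pts M \<Longrightarrow> U q \<in> Ver q" and V: "M.VF V" "\<And>q. q \<in> pts M \<Longrightarrow> V q \<in> Ver q"
    using assms(9-12) by (simp_all add: horizontal_field_def vertical_field_def)
  note v = vertical_weighted[OF p assms(7) U V] and h = horizontal_weighted[OF p assms(7,8) Y Z]
    and h' = horizontal_weighted[OF p assms(7,8) Z Y]
  \<comment> \<open>The sectional identities have \<open>Y\<close> as direction and \<open>Z\<close>
    as argument, hence \<open>h'\<close>; its term 3 |A_Z Y|^2 becomes 3/4 |[Y,Z]^V|^2 by
    \<open>h(3)\<close>.\<close>
  show ?case
    using v h h'(1,2) h(3) by (simp add: wsec_def swsec_def wcurv_form_def swcurv_form_def)
qed

end
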